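(* Let $k \geq 1$ and let $f(x) = \alpha_1 x + \cdots + \alpha_k x^k$ with real coefficients and $\alpha_k \neq 0$. Let $N \geq 2$ and $m$ be positive integers with $m \leq N$, let $b$ be an integer with $0 \leq b < m$ and $\gcd(b,m) = 1$, and let $a$ and $q \geq 1$ be integers such that $\gcd(a,q) = 1$ and $\left| \alpha_k - \frac{a}{q} \right| \leq \frac{1}{q^2}$. Then, for $k > 1$ and every $\epsilon > 0$, \[ \sum_{n=1}^{N} \lambda_{m,b}(n) e(f(n)) \ll_{k,\epsilon} (Nm)^{1+\epsilon} \left( q^{-1} + (Nm)^{-1/2} + qN^{-k} \right)^{4^{1-k}}, \] and for $k = 1$, \[ \sum_{n=1}^{N} \lambda_{m,b}(n) e(f(n)) \ll Nm (\log N)^4 \left( q^{-1/2} + (Nm)^{-1/5} + N^{-1/2} q^{1/2} \right). \]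
   Context: $e(x) = e^{2\pi i x}$. For a positive integer $m$ and an integer $b$ with $0 \leq b < m$ and $\gcd(b,m)=1$, the weight $\lambda_{m,b}(n)$ is defined by $\lambda_{m,b}(n) = \log(mn+b)$ if $mn+b$ is prime, and $\lambda_{m,b}(n) = 0$ otherwise. *)

theory Defs
  imports Complex_Main "HOL-Computational_Algebra.Primes"
begin

definition e2pi :: "real \<Rightarrow> complex" where
  "e2pi x = exp (2 * complex_of_real pi * \<i> * complex_of_real x)"

definition prime_weight :: "nat \<Rightarrow> nat \<Rightarrow> nat \<Rightarrow> real" where
  "prime_weight m b n = (if prime (m * n + b) then ln (real (m * n + b)) else 0)"

definition phase :: "nat \<Rightarrow> (nat \<Rightarrow> real) \<Rightarrow> real \<Rightarrow> real" where
  "phase k \<alpha> x = (\<Sum>j=1..k. \<alpha> j * x ^ j)"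

definition weighted_sum :: "nat \<Rightarrow> (nat \<Rightarrow> real) \<Rightarrow> nat \<Rightarrow> nat \<Rightarrow> nat \<Rightarrow> complex" where
  "weighted_sum k \<alpha> m b N =
     (\<Sum>n=1..N. complex_of_real (prime_weight m b n) * e2pi (phase k \<alpha> (real n)))"

definition admissible ::
  "nat \<Rightarrow> (nat \<Rightarrow> real) \<Rightarrow> nat \<Rightarrow> nat \<Rightarrow> nat \<Rightarrow> int \<Rightarrow> nat \<Rightarrow> bool" where
  "admissible k \<alpha> N m b a q \<longleftrightarrow>
     \<alpha> k \<noteq> 0 \<and>
     2 \<le> N \<and> 1 \<le> m \<and> m \<le> N \<and>
     b < m \<and> coprime b m \<and>
     1 \<le> q \<and> coprime a (int q) \<and>
     \<bar>\<alpha> k - real_of_int a / real q\<bar> \<le> 1 / (real q)\<^sup>2"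

end

theory Submission
  imports Defs "HOL-Number_Theory.Number_Theory" "HOL-Computational_Algebra.Squarefree" "HOL-Computational_Algebra.Polynomial" "HOL-Analysis.Convex"
begin

text \<open>
  Vaughan's identity with cut-off \<open>U\<close> splits the sum over \<open>\<Lambda>\<close> into type I sums and bilinear sums
  over \<open>d * l \<le> X\<close> whose variables both exceed \<open>U\<close>.

  For \<open>k = 1\<close> the congruence modulo \<open>m\<close> is kept throughout: the inner sums are geometric progressions,
  Cauchy-Schwarz removes the coefficients of the bilinear sums, and the spacing modulo 1 of the points
  \<open>\<alpha> n\<close> finishes the estimate.

  For \<open>k = Suc j > 1\<close> the factor \<open>(N m) powr \<epsilon>\<close> makes room for cruder steps. The prime sum has absolute value
  at most of order \<open>N log N\<close>, which already suffices unless \<open>m ^ 3 \<le> N\<close>; the congruence is then detected by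
  additive characters, so the polynomial has leading coefficient \<open>\<alpha> / m ^ k\<close> in the variable \<open>m n + b\<close>.
  Each bilinear sum is Weyl-differenced \<open>j\<close> times in the shorter variable \<open>l\<close> and afterwards \<open>j\<close> times in
  \<open>d\<close>, whence the exponent \<open>1 / (2 ^ j * 2 ^ j)\<close>. What remains is the sum of
  \<open>min D (1 / \<parallel>n \<alpha> / m ^ k\<parallel>)\<close> over products \<open>n\<close> of the shifts and variables, whose multiplicities are
  controlled by the divisor bound. With \<open>B\<close> the bracket in the claim and \<open>U = B powr (- 1 / 2 ^ j)\<close>, the
  diagonal loss \<open>L powr (- (2 ^ j))\<close> of the first differencing, \<open>L > U\<close> being the length of the range of \<open>l\<close>, is at most \<open>B\<close>.
\<close>

section \<open>Exponential sums and distances to the nearest integer\<close>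

text \<open>The phase of a bilinear sum is a polynomial in the product d * l, so differencing in l
  leaves the degree in d as it is: after j differences the coefficient of d ^ k is the leading
  coefficient times the j-th difference of l ^ k. The arbitrary weights of l have by then become
  bounded factors free of d. This makes a second round of differencing in d possible, and it is why
  the exponents multiply. The choice of U meets two opposite demands. A range longer than U keeps
  the diagonal harmless, while a type I sum over r near Y loses a factor Y ^ j, because the
  multipliers r ^ k are sparse; with U ^ (2 ^ j) about 1 / B there remains U ^ j * B, at most B powr
  (1 / 2 ^ j). The condition m ^ 3 \<le> N gives N m / N ^ k \<le> (N m) powr (- 1 / 2), so the term
  that a long d contributes to the mean value disappears in the bracket. Averaging over the m
  characters costs only that each twisted sum is measured against N m, the length of its full range;
  the twist is linear and does not touch the leading coefficient when k > 1.\<close>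

definition dni :: "real \<Rightarrow> real" where
  "dni x = \<bar>x - of_int (round x)\<bar>"

lemma dni_le: "dni x \<le> \<bar>x - of_int n\<bar>"
  unfolding dni_def by (rule round_diff_minimal)

lemma dni_nonneg [simp]: "0 \<le> dni x"
  by (simp add: dni_def)

lemma dni_le_half: "dni x \<le> 1 / 2"
  using of_int_round_abs_le[of x] by (simp add: dni_def abs_minus_commute)

lemma dni_triangle: "dni (x + y) \<le> dni x + dni y"
proof -
  have "dni (x + y) \<le> \<bar>(x + y) - of_int (round x + round y)\<bar>" by (rule dni_le)
  also have "\<dots> \<le> dni x + dni y" by (simp add: dni_def)
  finally show ?thesis .
qed

lemma dni_le_abs: "dni x \<le> \<bar>x\<bar>"
  using dni_le[of x 0] by simp

lemma dni_minus [simp]: "dni (- x) = dni x"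
proof -
  have "dni (- y) \<le> dni y" for y
    using dni_le[of "- y" "- round y"] by (simp add: dni_def)
  from this[of x] this[of "- x"] show ?thesis by simp
qed

text \<open>The first branch also covers \<open>dni x = 0\<close>, where \<open>1 / dni x\<close> would be the junk value 0.\<close>

definition wmin :: "real \<Rightarrow> real \<Rightarrow> real" where
  "wmin D x = (if D * dni x \<le> 1 then D else 1 / dni x)"

lemma wmin_le: "0 \<le> D \<Longrightarrow> wmin D x \<le> D"
  by (auto simp: wmin_def divide_simps not_le) (smt (verit, best) dni_nonneg mult_nonneg_nonneg)

lemma wmin_le_inverse: "0 < dni x \<Longrightarrow> wmin D x \<le> 1 / dni x"
  by (auto simp: wmin_def divide_simps)

text \<open>The rule by which exponential sums are bounded by \<open>wmin\<close>: a trivial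
  estimate, and a second one that is asked for only when the frequency is not an integer.\<close>

lemma wmin_greatest: "A \<le> D \<Longrightarrow> (0 < dni x \<Longrightarrow> A \<le> 1 / dni x) \<Longrightarrow> A \<le> wmin D x"
  by (auto simp: wmin_def) (metis dni_nonneg less_eq_real_def mult_zero_right zero_less_one_class.zero_le_one)

lemma wmin_nonneg: "0 \<le> D \<Longrightarrow> 0 \<le> wmin D x"
  by (auto simp: wmin_def)

lemma wmin_mono: "0 \<le> D \<Longrightarrow> D \<le> D' \<Longrightarrow> wmin D x \<le> wmin D' x"
  by (rule wmin_greatest) (use wmin_le[of D x] wmin_le_inverse[of x D] in auto)

lemma wmin_minus [simp]: "wmin D (- x) = wmin D x"
  by (simp add: wmin_def)

section \<open>The exponential e(x) and geometric sums\<close>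

lemma e2pi_eq_cis: "e2pi x = cis (2 * pi * x)"
  by (simp add: e2pi_def cis_conv_exp mult_ac)

lemma norm_e2pi [simp]: "norm (e2pi x) = 1"
  by (simp add: e2pi_eq_cis)

lemma e2pi_add: "e2pi (x + y) = e2pi x * e2pi y"
  by (simp add: e2pi_eq_cis cis_mult algebra_simps)

lemma e2pi_0 [simp]: "e2pi 0 = 1"
  by (simp add: e2pi_def)

lemma cnj_e2pi: "cnj (e2pi x) = e2pi (- x)"
  by (simp add: e2pi_eq_cis cis_cnj)

lemma e2pi_of_int [simp]: "e2pi (of_int n) = 1"
  unfolding e2pi_eq_cis by (rule cis_multiple_2pi) simp

text \<open>Up to pi / 3 the cosine is at least 1 / 2, so the mean value theorem gives slope at
  least pi / 2 \<ge> 1 in t; beyond t = 1 / 3 monotonicity already yields sin (pi / 6) = 1 / 2. The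
  sharp slope 2 is given up for this short argument.\<close>

lemma sin_pi_ge: assumes "0 \<le> t" "t \<le> 1 / 2" shows "t \<le> sin (pi * t)"
proof (cases "t \<le> 1 / 3")
  case True
  show ?thesis
  proof (cases "t = 0")
    case False
    then have t: "0 < pi * t" using assms by simp
    obtain z where z: "0 < z" "z < pi * t" "sin (pi * t) - sin 0 = (pi * t - 0) * cos z"
      using MVT2[OF t, of sin cos] by (auto intro: DERIV_sin)
    have "pi * t \<le> pi / 3" using True by simp
    with z(2) have "z \<le> pi / 3" by linarith
    then have "cos (pi / 3) \<le> cos z"
      using z(1) by (intro cos_monotone_0_pi_le) auto
    then have "1 / 2 \<le> cos z" by (simp add: cos_60)
    then have "pi * t * (1 / 2) \<le> pi * t * cos z" using t by (intro mult_left_mono) auto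
    moreover have "t \<le> pi * t * (1 / 2)" using mult_right_mono[OF pi_ge_two assms(1)] by simp
    moreover have "sin (pi * t) = pi * t * cos z" using z by simp
    ultimately show ?thesis by linarith
  qed simp
next
  case False
  have "pi / 6 \<le> pi * t" using False by simp
  then have "sin (pi / 6) \<le> sin (pi * t)"
    using assms by (intro sin_monotone_2pi_le) auto
  then show ?thesis using assms by (simp add: sin_30)
qed

text \<open>After reduction modulo 1 the left factor is |t| and the norm is 2 |sin (pi t)|. The
  factor 2 is exactly what the two end terms of a telescoped geometric sum cost.\<close>

lemma norm_e2pi_minus_1: "2 * dni x \<le> norm (e2pi x - 1)"
proof -
  define t where "t = x - of_int (round x)"
  have x: "x = t + of_int (round x)" by (simp add: t_def)
  have e: "e2pi x = e2pi t" by (subst x) (simp only: e2pi_add e2pi_of_int mult_1_right)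
  have d: "dni x = \<bar>t\<bar>" by (simp add: dni_def t_def)
  have "e2pi t = cis (2 * (pi * t))" by (simp add: e2pi_eq_cis mult_ac)
  then have "norm (e2pi t - 1) = 2 * \<bar>sin (pi * t)\<bar>"
  proof -
    assume *: "e2pi t = cis (2 * (pi * t))"
    let ?y = "pi * t"
    have "(norm (e2pi t - 1))\<^sup>2 = (cos (2 * ?y) - 1)\<^sup>2 + (sin (2 * ?y))\<^sup>2"
      unfolding * by (simp add: cmod_power2)
    also have "\<dots> = 2 - 2 * cos (2 * ?y)"
      using sin_cos_squared_add[of "2 * ?y"] by (simp add: power2_eq_square algebra_simps)
    also have "\<dots> = (2 * \<bar>sin ?y\<bar>)\<^sup>2"
      by (simp add: cos_double_sin power_mult_distrib)
    finally show ?thesis by (metis abs_ge_zero mult_nonneg_nonneg norm_ge_zero power2_eq_imp_eq zero_le_numeral)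
  qed
  moreover have "\<bar>t\<bar> \<le> \<bar>sin (pi * t)\<bar>"
  proof -
    have "\<bar>t\<bar> \<le> 1 / 2" using dni_le_half[of x] d by simp
    then have "\<bar>t\<bar> \<le> sin (pi * \<bar>t\<bar>)" by (intro sin_pi_ge) auto
    also have "\<dots> \<le> \<bar>sin (pi * t)\<bar>" by (auto simp: abs_if)
    finally show ?thesis .
  qed
  ultimately show ?thesis by (simp add: e d)
qed

lemma int_interval_image:
  "{lo..hi::int} = (\<lambda>i. lo + int i) ` {..<nat (hi - lo + 1)}"
proof -
  have "x \<in> (\<lambda>i. lo + int i) ` {..<nat (hi - lo + 1)}" if "lo \<le> x" "x \<le> hi" for x
    using that by (intro image_eqI[of _ _ "nat (x - lo)"]) auto
  then show ?thesis by auto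
qed

text \<open>Multiplication by e(\<theta>) - 1 telescopes the sum. The cap is any real upper bound D
  for the number of terms, which lets callers insert quotients without rounding.\<close>

lemma norm_linear_exp_sum:
  fixes lo hi :: int
  assumes D: "of_int (hi - lo + 1) \<le> D" "0 \<le> D"
  shows "norm (\<Sum>n\<in>{lo..hi}. e2pi (\<theta> * of_int n + c)) \<le> wmin D \<theta>"
proof (rule wmin_greatest)
  let ?S = "\<Sum>n\<in>{lo..hi}. e2pi (\<theta> * of_int n + c)"
  have "norm ?S \<le> (\<Sum>n\<in>{lo..hi}. 1)"
    by (rule sum_norm_le) simp
  also have "\<dots> \<le> D" using D by (simp add: nat_le_eq_zle)
  finally show "norm ?S \<le> D" .
  assume pos: "0 < dni \<theta>"
  define M where "M = nat (hi - lo + 1)"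
  define g where "g = (\<lambda>i::nat. e2pi (\<theta> * (of_int lo + real i) + c))"
  have "?S = (\<Sum>i<M. g i)"
    unfolding int_interval_image M_def g_def by (subst sum.reindex) (auto simp: inj_on_def)
  moreover have "(e2pi \<theta> - 1) * (\<Sum>i<M. g i) = (\<Sum>i<M. g (Suc i) - g i)"
    unfolding sum_distrib_left g_def
    by (intro sum.cong refl) (simp add: algebra_simps flip: e2pi_add)
  ultimately have "(e2pi \<theta> - 1) * ?S = g M - g 0" by (simp add: sum_lessThan_telescope)
  then have "norm (e2pi \<theta> - 1) * norm ?S = norm (g M - g 0)" by (metis norm_mult)
  also have "\<dots> \<le> norm (g M) + norm (g 0)" by (rule norm_triangle_ineq4)
  also have "\<dots> = 2" by (simp add: g_def)
  finally have "norm (e2pi \<theta> - 1) * norm ?S \<le> 2" .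
  moreover have "2 * dni \<theta> * norm ?S \<le> norm (e2pi \<theta> - 1) * norm ?S"
    by (intro mult_right_mono norm_e2pi_minus_1) auto
  ultimately show "norm ?S \<le> 1 / dni \<theta>" using pos by (simp add: field_simps)
qed

section \<open>Sums of \<open>wmin\<close> over points that are spaced modulo 1\<close>

lemma sum_inverse_le_ln: "1 \<le> n \<Longrightarrow> (\<Sum>c=1..n. 1 / real c) \<le> 1 + ln (real n)"
proof (induction n rule: nat_induct_at_least)
  case (Suc n)
  have "ln (real n / real (Suc n)) \<le> real n / real (Suc n) - 1"
    using Suc by (intro ln_le_minus_one) auto
  then have "1 / real (Suc n) \<le> ln (real (Suc n)) - ln (real n)"
    using Suc by (simp add: ln_div field_simps)
  with Suc show ?case by simp
qed simp

text \<open>The residues in [- 1 / 2, 1 / 2] of one sign are sorted into cells of width \<delta>,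
  and the spacing puts at most one of them into each cell. Cell 0 costs D, cell c costs 1 / (c
  \<delta>), and Q cells reach up to 1 / 2. The factor 2 counts the two signs.\<close>

lemma sum_wmin_spaced:
  fixes f :: "'a \<Rightarrow> real"
  assumes S: "finite S" and \<delta>: "0 < \<delta>" and D: "0 \<le> D" and Q: "1 / 2 \<le> real Q * \<delta>"
    and sp: "\<And>x y. x \<in> S \<Longrightarrow> y \<in> S \<Longrightarrow> x \<noteq> y \<Longrightarrow> \<delta> \<le> dni (f x - f y)"
  shows "(\<Sum>x\<in>S. wmin D (f x)) \<le> 2 * (D + (\<Sum>c=1..Q. 1 / real c) / \<delta>)"
proof -
  define s where "s = (\<lambda>x. f x - of_int (round (f x)))"
  define cell where "cell = (\<lambda>x. nat \<lfloor>\<bar>s x\<bar> / \<delta>\<rfloor>)"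
  define w where "w = (\<lambda>c::nat. if c = 0 then D else 1 / (real c * \<delta>))"
  have sd: "dni (f x) = \<bar>s x\<bar>" for x by (simp add: dni_def s_def)
  have cell_le: "real (cell x) \<le> \<bar>s x\<bar> / \<delta>" for x
    unfolding cell_def using \<delta> by simp
  have cell_gt: "\<bar>s x\<bar> / \<delta> < real (cell x) + 1" for x
    unfolding cell_def using \<delta> by (simp add: floor_less_iff)
  have wbd: "wmin D (f x) \<le> w (cell x)" for x
  proof (cases "cell x = 0")
    case False
    then have c: "0 < real (cell x) * \<delta>" using \<delta> by simp
    moreover have cs: "real (cell x) * \<delta> \<le> \<bar>s x\<bar>" using cell_le[of x] \<delta> by (simp add: field_simps)
    ultimately have p: "0 < dni (f x)" by (simp add: sd)
    have "wmin D (f x) \<le> 1 / dni (f x)" by (rule wmin_le_inverse[OF p])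
    also have "\<dots> \<le> 1 / (real (cell x) * \<delta>)"
      using c cs by (intro divide_left_mono) (auto simp: sd)
    finally show ?thesis using False by (simp add: w_def)
  qed (use D in \<open>simp add: w_def wmin_le\<close>)
  have cQ: "cell x \<le> Q" for x
  proof -
    have "\<bar>s x\<bar> \<le> real Q * \<delta>" using dni_le_half[of "f x"] Q by (simp add: sd)
    then have "\<bar>s x\<bar> / \<delta> \<le> real Q" using \<delta> by (simp add: field_simps)
    then show ?thesis using cell_le[of x] by linarith
  qed
  \<comment> \<open>The second condition says that \<open>s\<close> does not change its sign on T,
    so that distances between residues can be read off from their absolute values.\<close>
  have key: "(\<Sum>x\<in>T. wmin D (f x)) \<le> D + (\<Sum>c=1..Q. 1 / real c) / \<delta>"
    if T: "T \<subseteq> S" "\<And>x y. x \<in> T \<Longrightarrow> y \<in> T \<Longrightarrow> \<bar>s x - s y\<bar> = \<bar>\<bar>s x\<bar> - \<bar>s y\<bar>\<bar>" for T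
  proof -
    have inj: "inj_on cell T"
    proof (rule inj_onI, rule ccontr)
      fix x y assume xy: "x \<in> T" "y \<in> T" "cell x = cell y" "x \<noteq> y"
      have "\<bar>\<bar>s x\<bar> / \<delta> - \<bar>s y\<bar> / \<delta>\<bar> < 1"
        using cell_le[of x] cell_gt[of x] cell_le[of y] cell_gt[of y] xy(3) by linarith
      then have "\<bar>\<bar>s x\<bar> - \<bar>s y\<bar>\<bar> < \<delta>" using \<delta> by (simp add: abs_if field_simps split: if_splits)
      moreover have "dni (f x - f y) \<le> \<bar>s x - s y\<bar>"
        using dni_le[of "f x - f y" "round (f x) - round (f y)"] by (simp add: s_def algebra_simps)
      moreover have "\<delta> \<le> dni (f x - f y)" using sp T xy by auto
      ultimately show False using T(2)[OF xy(1,2)] by simp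
    qed
    have "(\<Sum>x\<in>T. wmin D (f x)) \<le> (\<Sum>x\<in>T. w (cell x))" by (intro sum_mono wbd)
    also have "\<dots> = (\<Sum>c\<in>cell ` T. w c)" by (simp add: sum.reindex[OF inj])
    also have "\<dots> \<le> (\<Sum>c\<in>{0..Q}. w c)"
      using \<delta> D cQ by (intro sum_mono2) (auto simp: w_def)
    also have "\<dots> = D + (\<Sum>c=1..Q. 1 / real c) / \<delta>"
      by (simp add: sum.atLeast_Suc_atMost w_def sum_divide_distrib mult.commute)
    finally show ?thesis .
  qed
  have "(\<Sum>x\<in>S. wmin D (f x)) = (\<Sum>x\<in>{x\<in>S. 0 \<le> s x}. wmin D (f x)) + (\<Sum>x\<in>{x\<in>S. s x < 0}. wmin D (f x))"
    using S by (subst sum.union_disjoint[symmetric]) (auto intro!: sum.cong)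
  also have "\<dots> \<le> (D + (\<Sum>c=1..Q. 1 / real c) / \<delta>) + (D + (\<Sum>c=1..Q. 1 / real c) / \<delta>)"
    by (intro add_mono key) auto
  finally show ?thesis by simp
qed

definition rat_approx :: "real \<Rightarrow> int \<Rightarrow> nat \<Rightarrow> bool" where
  "rat_approx \<alpha> a q \<longleftrightarrow> 1 \<le> q \<and> coprime a (int q) \<and> \<bar>\<alpha> - real_of_int a / real q\<bar> \<le> 1 / (real q)\<^sup>2"

text \<open>The fraction a h / q misses every integer by at least 1 / q, and replacing a / q by
  \<alpha> moves the point by at most |h| / q ^ 2. The restriction |h| \<le> q / 2 is what leaves
  half of the gap.\<close>

lemma dni_rat_approx:
  assumes \<alpha>: "rat_approx \<alpha> a q" and h: "h \<noteq> 0" "2 * \<bar>h\<bar> \<le> int q"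
  shows "1 / (2 * real q) \<le> dni (\<alpha> * of_int h)"
proof -
  have q: "0 < q" using \<alpha> by (simp add: rat_approx_def)
  have nd: "\<not> int q dvd a * h"
  proof
    assume "int q dvd a * h"
    moreover have "coprime (int q) a" using \<alpha> by (simp add: rat_approx_def coprime_commute)
    ultimately have "int q dvd h" by (simp add: coprime_dvd_mult_right_iff)
    then have "int q \<le> \<bar>h\<bar>" using h(1) by (simp add: zdvd_imp_le dvd_imp_le_int)
    then show False using h q by simp
  qed
  have "1 / real q \<le> dni (of_int a * of_int h / real q)"
  proof -
    let ?n = "round (of_int a * of_int h / real q)"
    have "a * h - ?n * int q \<noteq> 0" using nd by (metis dvd_triv_right eq_iff_diff_eq_0)
    then have "1 \<le> \<bar>a * h - ?n * int q\<bar>" by linarith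
    then have "1 \<le> \<bar>of_int (a * h - ?n * int q) :: real\<bar>" by linarith
    then have "1 / real q \<le> \<bar>of_int (a * h - ?n * int q)\<bar> / real q" using q by (simp add: divide_right_mono)
    also have "\<dots> = dni (of_int a * of_int h / real q)"
    proof -
      have "of_int (a * h - ?n * int q) / real q = of_int a * of_int h / real q - of_int ?n"
        using q by (simp add: field_simps)
      then show ?thesis using q unfolding dni_def by (metis abs_divide abs_of_nat)
    qed
    finally show ?thesis .
  qed
  also have "of_int a * of_int h / real q = \<alpha> * of_int h + - ((\<alpha> - of_int a / real q) * of_int h)"
    by (simp add: field_simps)
  also have "dni \<dots> \<le> dni (\<alpha> * of_int h) + dni (- ((\<alpha> - of_int a / real q) * of_int h))"
    by (rule dni_triangle)
  also have "dni (- ((\<alpha> - of_int a / real q) * of_int h)) \<le> \<bar>\<alpha> - of_int a / real q\<bar> * \<bar>of_int h\<bar>"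
    using dni_le_abs[of "(\<alpha> - of_int a / real q) * of_int h"] by (simp add: abs_mult)
  also have "\<dots> \<le> 1 / (real q)\<^sup>2 * (real q / 2)"
  proof (intro mult_mono)
    have "real_of_int (2 * \<bar>h\<bar>) \<le> real_of_int (int q)" using h(2) by (rule of_int_le_iff[THEN iffD2])
    then show "\<bar>of_int h\<bar> \<le> real q / 2" by simp
  qed (use \<alpha> in \<open>auto simp: rat_approx_def\<close>)
  also have "\<dots> = 1 / (2 * real q)" using q by (simp add: power2_eq_square)
  finally show ?thesis using q by (simp add: field_simps)
qed

lemma sum_wmin_block:
  assumes \<alpha>: "rat_approx \<alpha> a q" and D: "0 \<le> D"
    and S: "finite S" "\<And>x y. x \<in> S \<Longrightarrow> y \<in> S \<Longrightarrow> 2 * \<bar>x - y\<bar> \<le> int q"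
  shows "(\<Sum>n\<in>S. wmin D (\<alpha> * of_int n + \<theta>)) \<le> 2 * D + 4 * real q * (1 + ln (real q))"
proof -
  have q: "1 \<le> q" using \<alpha> by (simp add: rat_approx_def)
  have "(\<Sum>n\<in>S. wmin D (\<alpha> * of_int n + \<theta>)) \<le> 2 * (D + (\<Sum>c=1..q. 1 / real c) / (1 / (2 * real q)))"
  proof (rule sum_wmin_spaced)
    fix x y assume "x \<in> S" "y \<in> S" "x \<noteq> y"
    then show "1 / (2 * real q) \<le> dni (\<alpha> * of_int x + \<theta> - (\<alpha> * of_int y + \<theta>))"
      using dni_rat_approx[OF \<alpha>, of "x - y"] S(2)[of x y] by (simp add: algebra_simps)
  qed (use S D q in auto)
  also have "\<dots> = 2 * D + 4 * real q * (\<Sum>c=1..q. 1 / real c)"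
    by (simp add: algebra_simps)
  also have "\<dots> \<le> 2 * D + 4 * real q * (1 + ln (real q))"
    by (intro add_left_mono mult_left_mono sum_inverse_le_ln q) auto
  finally show ?thesis .
qed

text \<open>Blocks of (q + 1) div 2 consecutive integers are cut off one at a time: two members of a
  block differ by at most q / 2, and every block lowers 2 R / q by at least 1. The offset \<theta>
  serves correlations and residue classes, whose phases have a constant term.\<close>

lemma sum_wmin_interval:
  assumes \<alpha>: "rat_approx \<alpha> a q" and D: "0 \<le> D"
  shows "(\<Sum>n\<in>{A + 1..A + int R}. wmin D (\<alpha> * of_int n + \<theta>))
           \<le> (2 * real R / real q + 1) * (2 * D + 4 * real q * (1 + ln (real q)))"
proof (induction R arbitrary: A rule: less_induct)
  case (less R)
  let ?W = "2 * D + 4 * real q * (1 + ln (real q))"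
  have q: "1 \<le> q" using \<alpha> by (simp add: rat_approx_def)
  then have W: "0 \<le> ?W" using D by simp
  define B where "B = (q + 1) div 2"
  have B: "1 \<le> B" "2 * B \<le> q + 1" "q \<le> 2 * B" using q by (auto simp: B_def)
  have Bi: "2 * int B \<le> int q + 1" using B(2) unfolding of_nat_le_iff[where 'a = int, symmetric] by simp
  show ?case
  proof (cases "R \<le> B")
    case True
    have "(\<Sum>n\<in>{A + 1..A + int R}. wmin D (\<alpha> * of_int n + \<theta>)) \<le> ?W"
    proof (rule sum_wmin_block[OF \<alpha> D])
      fix x y assume "x \<in> {A + 1..A + int R}" "y \<in> {A + 1..A + int R}"
      then have "\<bar>x - y\<bar> \<le> int R - 1" by auto
      then have "2 * \<bar>x - y\<bar> \<le> 2 * (int B - 1)" using True by (intro mult_left_mono) auto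
      also have "\<dots> \<le> int q" using Bi by simp
      finally show "2 * \<bar>x - y\<bar> \<le> int q" .
    qed simp
    also have "\<dots> \<le> (2 * real R / real q + 1) * ?W"
      using W mult_right_mono[of 1 "2 * real R / real q + 1" ?W] by simp
    finally show ?thesis .
  next
    case False
    then have R: "int R = int B + int (R - B)" by simp
    have "{A + 1..A + int R} = {A + 1..A + int B} \<union> {(A + int B) + 1..(A + int B) + int (R - B)}"
    proof -
      have "{A + 1..A + (u + v)} = {A + 1..A + u} \<union> {(A + u) + 1..(A + u) + v}"
        if "0 \<le> u" "0 \<le> v" for u v :: int using that by auto
      then show ?thesis unfolding R by simp
    qed
    then have "(\<Sum>n\<in>{A + 1..A + int R}. wmin D (\<alpha> * of_int n + \<theta>))
      = (\<Sum>n\<in>{A + 1..A + int B}. wmin D (\<alpha> * of_int n + \<theta>))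
        + (\<Sum>n\<in>{(A + int B) + 1..(A + int B) + int (R - B)}. wmin D (\<alpha> * of_int n + \<theta>))"
      by (simp only:) (rule sum.union_disjoint, auto)
    also have "\<dots> \<le> ?W + (2 * real (R - B) / real q + 1) * ?W"
    proof (intro add_mono less.IH sum_wmin_block[OF \<alpha> D])
      fix x y assume "x \<in> {A + 1..A + int B}" "y \<in> {A + 1..A + int B}"
      then have "\<bar>x - y\<bar> \<le> int B - 1" by auto
      then have "2 * \<bar>x - y\<bar> \<le> 2 * (int B - 1)" by (intro mult_left_mono) auto
      also have "\<dots> \<le> int q" using Bi by simp
      finally show "2 * \<bar>x - y\<bar> \<le> int q" .
    qed (use False B in auto)
    also have "\<dots> = (2 * (real R - real B) / real q + 2) * ?W"
      using False by (simp add: of_nat_diff algebra_simps)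
    also have "\<dots> \<le> (2 * real R / real q + 1) * ?W"
      using q B W by (intro mult_right_mono) (auto simp: field_simps)
    finally show ?thesis .
  qed
qed

text \<open>The cap Y / r is the length of the inner sum in a type I sum. As there is no offset, the
  first block needs no cap: for r below q / 2 the distance to the integers is at least 1 / (2 q), so
  Y does not enter. In block i > 0 one has r \<ge> i q / 2, and the caps add up to a harmonic sum
  times Y / q.\<close>

lemma sum_wmin_hyperbola:
  assumes \<alpha>: "rat_approx \<alpha> a q" and Y: "0 \<le> Y" and V: "1 \<le> V"
  shows "(\<Sum>r=1..V. wmin (Y / real r) (\<alpha> * real r))
     \<le> 8 * (Y / real q + real V + real q) * (1 + ln (real q) + ln (real V))"
proof -
  have q: "1 \<le> q" using \<alpha> by (simp add: rat_approx_def)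
  let ?L = "1 + ln (real q)"
  have L: "1 \<le> ?L" using q by simp
  define B where "B = (q + 1) div 2"
  have B: "1 \<le> B" "2 * B \<le> q + 1" "q \<le> 2 * B" using q by (auto simp: B_def)
  have Bi: "2 * int B \<le> int q + 1" using B(2) unfolding of_nat_le_iff[where 'a = int, symmetric] by simp
  let ?f = "\<lambda>r. wmin (Y / real r) (\<alpha> * real r)"
  have blk: "(\<Sum>r\<in>{r\<in>{1..V}. r div B = i}. ?f r) \<le> (if i = 0 then 8 * real q * ?L else 4 * Y / real q * (1 / real i) + 4 * real q * ?L)" for i
  proof -
    let ?S = "{r\<in>{1..V}. r div B = i}"
    define D where "D = (if i = 0 then 2 * real q else 2 * Y / (real q * real i))"
    have D: "0 \<le> D" using Y by (auto simp: D_def)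
    have le: "?f r \<le> wmin D (\<alpha> * of_int (int r) + 0)" if r: "r \<in> ?S" for r
    proof (cases "i = 0")
      case True
      then have "r < B" "1 \<le> r" using r B by (auto simp: div_eq_0_iff)
      then have d: "1 / (2 * real q) \<le> dni (\<alpha> * of_int (int r))"
        using B by (intro dni_rat_approx[OF \<alpha>]) auto
      have p: "0 < dni (\<alpha> * real r)" using q by (intro order.strict_trans2[OF _ d[simplified]]) auto
      have "1 / dni (\<alpha> * real r) \<le> D" using d p q True by (simp add: D_def field_simps)
      with wmin_le_inverse[OF p] have "?f r \<le> D" "?f r \<le> 1 / dni (\<alpha> * real r)" by (auto intro: order_trans)
      then show ?thesis by (auto intro: wmin_greatest)
    next
      case False
      have "i * B \<le> r" using r div_times_less_eq_dividend[of r B] by blast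
      then have "real i * real B \<le> real r" by (metis of_nat_le_iff of_nat_mult)
      moreover have "real q * real i \<le> 2 * real B * real i"
        using B by (intro mult_right_mono) auto
      ultimately have r2: "real q * real i \<le> 2 * real r" by (simp add: mult.commute mult.left_commute)
      have "Y / real r = 2 * Y / (2 * real r)" by simp
      also have "\<dots> \<le> 2 * Y / (real q * real i)"
        using r2 False q Y r by (intro divide_left_mono mult_pos_pos) auto
      also have "\<dots> = D" using False by (simp add: D_def)
      finally show ?thesis using Y by (auto intro: wmin_mono)
    qed
    have "(\<Sum>r\<in>?S. ?f r) \<le> (\<Sum>r\<in>?S. wmin D (\<alpha> * of_int (int r) + 0))"
      by (intro sum_mono le)
    also have "\<dots> = (\<Sum>n\<in>int ` ?S. wmin D (\<alpha> * of_int n + 0))"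
      by (subst sum.reindex) auto
    also have "\<dots> \<le> 2 * D + 4 * real q * ?L"
    proof (rule sum_wmin_block[OF \<alpha> D])
      fix x y assume "x \<in> int ` ?S" "y \<in> int ` ?S"
      then obtain r t where rt: "x = int r" "y = int t" "r div B = i" "t div B = i" by auto
      have "r = i * B + r mod B" "t = i * B + t mod B" using rt by (metis div_mult_mod_eq)+
      moreover have "r mod B < B" "t mod B < B" using B by auto
      ultimately have "\<bar>x - y\<bar> \<le> int B - 1" using rt(1,2) by linarith
      then have "2 * \<bar>x - y\<bar> \<le> 2 * (int B - 1)" by (intro mult_left_mono) auto
      also have "\<dots> \<le> int q" using Bi by simp
      finally show "2 * \<bar>x - y\<bar> \<le> int q" .
    qed auto
    also have "\<dots> \<le> (if i = 0 then 8 * real q * ?L else 4 * Y / real q * (1 / real i) + 4 * real q * ?L)"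
      using q by (simp add: D_def algebra_simps)
    finally show ?thesis .
  qed
  have "(\<Sum>r=1..V. ?f r) = (\<Sum>i\<in>{0..V div B}. \<Sum>r\<in>{r\<in>{1..V}. r div B = i}. ?f r)"
    by (rule sum.group[symmetric]) (auto simp: div_le_mono)
  also have "\<dots> \<le> (\<Sum>i\<in>{0..V div B}. if i = 0 then 8 * real q * ?L else 4 * Y / real q * (1 / real i) + 4 * real q * ?L)"
    by (intro sum_mono blk)
  also have "\<dots> = 8 * real q * ?L + (\<Sum>i=1..V div B. 4 * Y / real q * (1 / real i) + 4 * real q * ?L)"
    by (subst sum.atLeast_Suc_atMost) (auto intro!: sum.cong)
  also have "(\<Sum>i=1..V div B. 4 * Y / real q * (1 / real i) + 4 * real q * ?L)
     = 4 * Y / real q * (\<Sum>i=1..V div B. 1 / real i) + real (V div B) * (4 * real q * ?L)"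
    by (simp add: sum.distrib sum_distrib_left)
  also have "4 * Y / real q * (\<Sum>i=1..V div B. 1 / real i) + real (V div B) * (4 * real q * ?L)
      \<le> 4 * Y / real q * (1 + ln (real V)) + 2 * real V / real q * (4 * real q * ?L)"
  proof (intro add_mono mult_left_mono mult_right_mono)
  have "(\<Sum>i=1..V div B. 1 / real i) \<le> (\<Sum>i=1..V. 1 / real i)"
    by (intro sum_mono2) (auto intro: order_trans[OF _ div_le_dividend])
  also have "\<dots> \<le> 1 + ln (real V)" by (rule sum_inverse_le_ln[OF V])
  finally show "(\<Sum>i=1..V div B. 1 / real i) \<le> 1 + ln (real V)" .
  show "real (V div B) \<le> 2 * real V / real q"
  proof -
    have "V div B * B \<le> V" by simp
    then have "real (V div B) * real B \<le> real V" by (metis of_nat_le_iff of_nat_mult)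
    moreover have "real (V div B) * real q \<le> real (V div B) * (2 * real B)"
      using B by (intro mult_left_mono) auto
    ultimately show ?thesis using q by (simp add: field_simps)
  qed
  qed (use Y L in auto)
  finally have "(\<Sum>r=1..V. ?f r) \<le> 8 * real q * ?L + (4 * Y / real q * (1 + ln (real V)) + 2 * real V / real q * (4 * real q * ?L))"
    by simp
  also have "\<dots> = 8 * real q * ?L + 4 * Y / real q * (1 + ln (real V)) + 8 * real V * ?L"
    using q by simp
  also have "\<dots> \<le> 8 * real q * (?L + ln (real V)) + 8 * (Y / real q) * (?L + ln (real V)) + 8 * real V * (?L + ln (real V))"
  proof -
    have "4 * Y / real q * (1 + ln (real V)) \<le> 8 * Y / real q * (?L + ln (real V))"
      using Y V q by (intro mult_mono divide_right_mono) auto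
    moreover have "8 * real q * ?L \<le> 8 * real q * (?L + ln (real V))"
      by (rule mult_left_mono) (use V in auto)
    moreover have "8 * real V * ?L \<le> 8 * real V * (?L + ln (real V))"
      by (rule mult_left_mono) (use V in auto)
    ultimately show ?thesis by simp
  qed
  finally show ?thesis by (simp add: algebra_simps)
qed

section \<open>Vaughan's identity\<close>

definition moeb :: "nat \<Rightarrow> real" where
  "moeb n = (if squarefree n then (- 1) ^ card (prime_factors n) else 0)"

lemma abs_moeb_le: "\<bar>moeb n\<bar> \<le> 1"
  by (simp add: moeb_def power_abs)

lemma moeb_1 [simp]: "moeb (Suc 0) = 1"
  by (simp add: moeb_def)

lemma moeb_prime_mult:
  assumes p: "prime p" and d: "\<not> p dvd d" "d \<noteq> 0"
  shows "moeb (p * d) = - moeb d"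
proof -
  have cop: "coprime p d" using p d by (simp add: prime_imp_coprime)
  have "squarefree (p * d) \<longleftrightarrow> squarefree d"
    using cop p squarefree_prime[OF p] by (metis squarefree_mult_coprime squarefree_multD(2))
  moreover have "prime_factors (p * d) = insert p (prime_factors d)"
    using p d by (simp add: prime_factors_product prime_prime_factors prime_gt_0_nat)
  moreover have "p \<notin> prime_factors d" using d by auto
  ultimately show ?thesis by (simp add: moeb_def)
qed

text \<open>For n > 1 a prime p dividing n pairs every squarefree divisor d prime to p with p * d,
  and the two terms cancel.\<close>

lemma sum_moeb:
  assumes n: "0 < n"
  shows "(\<Sum>d | d dvd n. moeb d) = (if n = 1 then 1 else 0)"
proof (cases "n = 1")
  case False
  then obtain p where p: "prime p" "p dvd n" using prime_factor_nat by auto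
  let ?S = "{d. d dvd n \<and> squarefree d}"
  let ?A = "{d \<in> ?S. \<not> p dvd d}" and ?B = "{d \<in> ?S. p dvd d}"
  have fin: "finite ?S" using n by simp
  have nz: "d \<noteq> 0" if "d dvd n" for d using that n by (auto intro!: Nat.gr0I)
  have bij: "bij_betw (\<lambda>d. p * d) ?A ?B"
  proof (rule bij_betwI[where g = "\<lambda>d. d div p"])
    show "(\<lambda>d. p * d) \<in> ?A \<rightarrow> ?B"
    proof
      fix d assume d: "d \<in> ?A"
      then have cop: "coprime p d" using p by (simp add: prime_imp_coprime)
      then have "p * d dvd n" using p d by (simp add: divides_mult)
      moreover have "squarefree (p * d)"
        using cop d squarefree_prime[OF p(1)] by (simp add: squarefree_mult_coprime)
      ultimately show "p * d \<in> ?B" by simp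
    qed
    show "(\<lambda>d. d div p) \<in> ?B \<rightarrow> ?A"
    proof
      fix d assume d: "d \<in> ?B"
      then obtain e where e: "d = p * e" by auto
      have p0: "p > 0" using p(1) by (rule prime_gt_0_nat)
      have "\<not> p dvd e"
      proof
        assume "p dvd e"
        then have "p\<^sup>2 dvd d" by (auto simp: e power2_eq_square)
        then have "is_unit p" using d by (auto simp: squarefree_def)
        with p show False by auto
      qed
      moreover have "e dvd n" using d e by (auto dest: dvd_mult_right)
      moreover have "squarefree e" using d e by (auto dest: squarefree_multD)
      ultimately show "d div p \<in> ?A" using e p0 by simp
    qed
  qed (use p(1) prime_gt_0_nat in auto)
  have "(\<Sum>d | d dvd n. moeb d) = (\<Sum>d\<in>?S. moeb d)"
    by (rule sum.mono_neutral_right) (use n in \<open>auto simp: moeb_def\<close>)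
  also have "\<dots> = (\<Sum>d\<in>?A. moeb d) + (\<Sum>d\<in>?B. moeb d)"
    using n by (subst sum.union_disjoint[symmetric]) (auto intro!: sum.cong)
  also have "(\<Sum>d\<in>?B. moeb d) = (\<Sum>d\<in>?A. moeb (p * d))"
    by (rule sum.reindex_bij_betw[OF bij, symmetric])
  also have "\<dots> = - (\<Sum>d\<in>?A. moeb d)"
    unfolding sum_negf[symmetric] by (intro sum.cong refl moeb_prime_mult) (use p nz in auto)
  finally show ?thesis using False by simp
qed simp

lemma ln_2_ge_half: "1 / 2 \<le> ln (2::real)"
  using ln_le_minus_one[of "1 / 2 :: real"] by (simp add: ln_div)

definition tau :: "nat \<Rightarrow> nat" where "tau n = card {d. d dvd n}"

definition dconv :: "(nat \<Rightarrow> real) \<Rightarrow> (nat \<Rightarrow> real) \<Rightarrow> nat \<Rightarrow> real" where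
  "dconv f g n = (\<Sum>d | d dvd n. f d * g (n div d))"

lemma dconv_commute: assumes "0 < n" shows "dconv f g n = dconv g f n"
  unfolding dconv_def
  by (rule sum.reindex_bij_witness[of _ "\<lambda>d. n div d" "\<lambda>d. n div d"])
     (use assms in \<open>auto simp: div_dvd_iff_mult elim!: dvdE\<close>)

text \<open>Both sides run over the chains in which e divides d and d divides n; the right-hand side
  names such a chain by e and the quotient d div e.\<close>

lemma dconv_assoc:
  assumes n: "0 < n"
  shows "dconv (dconv f g) h n = dconv f (dconv g h) n"
proof -
  have "dconv (dconv f g) h n = (\<Sum>d | d dvd n. \<Sum>e | e dvd d. f e * g (d div e) * h (n div d))"
    by (simp add: dconv_def sum_distrib_right)
  also have "\<dots> = (\<Sum>(d, e)\<in>(SIGMA d:{d. d dvd n}. {e. e dvd d}). f e * g (d div e) * h (n div d))"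
    using n by (intro sum.Sigma) (auto intro!: finite_divisors_nat Nat.gr0I)
  also have "\<dots> = (\<Sum>(e, k)\<in>(SIGMA e:{e. e dvd n}. {k. k dvd n div e}). f e * (g k * h (n div e div k)))"
  proof (rule sum.reindex_bij_witness[of _ "\<lambda>(e, k). (e * k, e)" "\<lambda>(d, e). (e, d div e)"])
    fix a assume "a \<in> (SIGMA d:{d. d dvd n}. {e. e dvd d})"
    then obtain d e where a: "a = (d, e)" "d dvd n" "e dvd d" by auto
    obtain k where k: "d = e * k" using a(3) by (elim dvdE)
    obtain l where l: "n = d * l" using a(2) by (elim dvdE)
    have pos: "0 < e" "0 < k" "0 < l" using n k l by auto
    show "(case case a of (d, e) \<Rightarrow> (e, d div e) of (e, k) \<Rightarrow> (e * k, e)) = a"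
      using a k pos by simp
    show "(case a of (d, e) \<Rightarrow> (e, d div e)) \<in> (SIGMA e:{e. e dvd n}. {k. k dvd n div e})"
      using a k l pos by simp
    show "(case case a of (d, e) \<Rightarrow> (e, d div e) of (e, k) \<Rightarrow> f e * (g k * h (n div e div k))) =
         (case a of (d, e) \<Rightarrow> f e * g (d div e) * h (n div d))"
      using a k l pos by (simp add: mult.assoc)
  next
    fix b assume "b \<in> (SIGMA e:{e. e dvd n}. {k. k dvd n div e})"
    then obtain e k where b: "b = (e, k)" "e dvd n" "k dvd n div e" by auto
    obtain m where m: "n = e * m" using b(2) by (elim dvdE)
    have e: "0 < e" using n m by auto
    obtain l where l: "m = k * l" using b(3) m e by (auto elim!: dvdE)
    have pos: "0 < e" "0 < k" "0 < l" using n m l by auto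
    show "(case case b of (e, k) \<Rightarrow> (e * k, e) of (d, e) \<Rightarrow> (e, d div e)) = b"
      using b pos by simp
    show "(case b of (e, k) \<Rightarrow> (e * k, e)) \<in> (SIGMA d:{d. d dvd n}. {e. e dvd d})"
      using b m l pos by simp
  qed
  also have "\<dots> = (\<Sum>e | e dvd n. \<Sum>k | k dvd n div e. f e * (g k * h (n div e div k)))"
    using n by (intro sum.Sigma[symmetric]) (auto intro!: finite_divisors_nat elim!: dvdE)
  also have "\<dots> = dconv f (dconv g h) n"
    by (simp add: dconv_def sum_distrib_left)
  finally show ?thesis .
qed

lemma dconv_cong:
  assumes "0 < n" "\<And>d. d dvd n \<Longrightarrow> f d = f' d" "\<And>d. d dvd n \<Longrightarrow> g d = g' d"
  shows "dconv f g n = dconv f' g' n"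
  unfolding dconv_def
  by (intro sum.cong refl) (use assms in \<open>auto simp: div_dvd_iff_mult\<close>)

lemma dconv_diff_left: "dconv (\<lambda>n. f n - f' n) g n = dconv f g n - dconv f' g n"
  by (simp add: dconv_def sum_subtractf algebra_simps)

lemma dconv_diff_right: "dconv f (\<lambda>n. g n - g' n) n = dconv f g n - dconv f g' n"
  by (simp add: dconv_def sum_subtractf algebra_simps)

lemma dconv_delta_left: "0 < n \<Longrightarrow> dconv (\<lambda>n. if n = 1 then 1 else 0) g n = g n"
  unfolding dconv_def by (subst sum.remove[of _ "1::nat"]) (auto intro!: sum.neutral simp: if_distrib)

section \<open>Truncations and the decomposition of the von Mangoldt function\<close>

definition up_to :: "nat \<Rightarrow> (nat \<Rightarrow> real) \<Rightarrow> nat \<Rightarrow> real" where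
  "up_to U f n = (if n \<le> U then f n else 0)"

definition beyond :: "nat \<Rightarrow> (nat \<Rightarrow> real) \<Rightarrow> nat \<Rightarrow> real" where
  "beyond U f n = (if U < n then f n else 0)"

text \<open>For positive arguments this is the unit of convolution minus (\<open>moeb\<close> cut at
  U) * 1, because \<open>moeb\<close> * 1 is that unit.\<close>

definition vaughan_c :: "nat \<Rightarrow> nat \<Rightarrow> real" where
  "vaughan_c U = dconv (beyond U moeb) (\<lambda>_. 1)"

definition vaughan_w :: "nat \<Rightarrow> nat \<Rightarrow> real" where
  "vaughan_w U = dconv (up_to U moeb) (up_to U mangoldt)"

text \<open>Let M and L be the Moebius and von Mangoldt functions cut at U, and let \<delta> be the
  unit of convolution. Since \<open>vaughan_c U\<close> is \<delta> - M * 1, its convolution with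
  \<Lambda> - L is \<Lambda> - L - M * 1 * \<Lambda> + M * 1 * L. Here 1 * \<Lambda> is the
  logarithm and M * L is \<open>vaughan_w U\<close>.\<close>

lemma vaughan_identity:
  assumes n: "0 < n"
  shows "mangoldt n = up_to U mangoldt n + dconv (up_to U moeb) (\<lambda>l. ln (real l)) n
           - dconv (vaughan_w U) (\<lambda>_. 1) n + dconv (vaughan_c U) (beyond U mangoldt) n"
proof -
  let ?\<delta> = "\<lambda>n::nat. if n = 1 then 1 else 0 :: real"
  let ?one = "\<lambda>_::nat. 1 :: real"
  let ?\<mu> = "up_to U moeb" and ?\<Lambda> = "up_to U mangoldt" and ?\<Lambda>' = "beyond U mangoldt"
  have b: "beyond U f = (\<lambda>n. f n - up_to U f n)" for f by (auto simp: beyond_def up_to_def)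
  have c: "vaughan_c U d = ?\<delta> d - dconv ?\<mu> ?one d" if "0 < d" for d
    unfolding vaughan_c_def b dconv_diff_left using sum_moeb[OF that] by (simp add: dconv_def)
  have one: "dconv ?one mangoldt d = ln (real d)" if "0 < d" for d
    using mangoldt_sum[of d, where 'a = real] that
    by (subst dconv_commute) (auto simp: dconv_def)
  have "dconv (vaughan_c U) ?\<Lambda>' n = dconv (\<lambda>d. ?\<delta> d - dconv ?\<mu> ?one d) ?\<Lambda>' n"
    using n by (intro dconv_cong c) (auto intro!: Nat.gr0I)
  also have "\<dots> = ?\<Lambda>' n - dconv (dconv ?\<mu> ?one) ?\<Lambda>' n"
    using dconv_delta_left[OF n] by (simp add: dconv_diff_left)
  also have "dconv (dconv ?\<mu> ?one) ?\<Lambda>' n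
     = dconv (dconv ?\<mu> ?one) mangoldt n - dconv (dconv ?\<mu> ?one) ?\<Lambda> n"
    by (simp add: b dconv_diff_right)
  also have "dconv (dconv ?\<mu> ?one) mangoldt n = dconv ?\<mu> (\<lambda>l. ln (real l)) n"
    unfolding dconv_assoc[OF n] using n by (intro dconv_cong one) (auto intro!: Nat.gr0I)
  also have "dconv (dconv ?\<mu> ?one) ?\<Lambda> n = dconv (vaughan_w U) ?one n"
  proof -
    have "dconv (dconv ?\<mu> ?one) ?\<Lambda> n = dconv ?\<mu> (dconv ?one ?\<Lambda>) n" by (rule dconv_assoc[OF n])
    also have "\<dots> = dconv ?\<mu> (dconv ?\<Lambda> ?one) n"
      using n by (intro dconv_cong dconv_commute refl) (auto intro!: Nat.gr0I)
    also have "\<dots> = dconv (dconv ?\<mu> ?\<Lambda>) ?one n" by (rule dconv_assoc[OF n, symmetric])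
    finally show ?thesis by (simp add: vaughan_w_def)
  qed
  finally show ?thesis by (simp add: b)
qed

lemma abs_vaughan_c_le: "0 < k \<Longrightarrow> \<bar>vaughan_c U k\<bar> \<le> real (tau k)"
proof -
  assume k: "0 < k"
  have "\<bar>vaughan_c U k\<bar> \<le> (\<Sum>d | d dvd k. \<bar>beyond U moeb d * 1\<bar>)"
    unfolding vaughan_c_def dconv_def by (rule sum_abs)
  also have "\<dots> \<le> (\<Sum>d | d dvd k. 1)"
    by (intro sum_mono) (simp add: beyond_def abs_moeb_le)
  finally show ?thesis by (simp add: tau_def)
qed

lemma vaughan_c_eq_0: "0 < k \<Longrightarrow> k \<le> U \<Longrightarrow> vaughan_c U k = 0"
  unfolding vaughan_c_def dconv_def
  by (intro sum.neutral) (auto simp: beyond_def dest!: dvd_imp_le)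

text \<open>Dropping signs and cut-offs leaves 1 * \<Lambda>, which is the logarithm.\<close>

lemma abs_vaughan_w_le: "0 < r \<Longrightarrow> \<bar>vaughan_w U r\<bar> \<le> ln (real r)"
proof -
  assume r: "0 < r"
  have "\<bar>vaughan_w U r\<bar> \<le> (\<Sum>d | d dvd r. \<bar>up_to U moeb d * up_to U mangoldt (r div d)\<bar>)"
    unfolding vaughan_w_def dconv_def by (rule sum_abs)
  also have "\<dots> \<le> (\<Sum>d | d dvd r. 1 * mangoldt (r div d))"
    unfolding abs_mult
    by (intro sum_mono mult_mono) (auto simp: up_to_def abs_moeb_le mangoldt_nonneg)
  also have "\<dots> = dconv mangoldt (\<lambda>_. 1) r"
    by (subst dconv_commute[OF r]) (simp add: dconv_def)
  also have "\<dots> = ln (real r)" using mangoldt_sum[of r, where 'a = real] r by (simp add: dconv_def)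
  finally show ?thesis .
qed

lemma vaughan_w_eq_0: "U\<^sup>2 < r \<Longrightarrow> vaughan_w U r = 0"
  unfolding vaughan_w_def dconv_def
proof (intro sum.neutral ballI)
  fix d assume r: "U\<^sup>2 < r" and d: "d \<in> {d. d dvd r}"
  then have "r = d * (r div d)" by simp
  then have "\<not> (d \<le> U \<and> r div d \<le> U)"
    using r mult_le_mono[of d U "r div d" U] by (auto simp: power2_eq_square)
  then show "up_to U moeb d * up_to U mangoldt (r div d) = 0" by (auto simp: up_to_def)
qed

section \<open>Exponential sums weighted by convolutions\<close>

lemma sum_dconv:
  fixes F :: "nat \<Rightarrow> complex"
  shows "(\<Sum>n=1..X. of_real (dconv f g n) * F n)
     = (\<Sum>d=1..X. of_real (f d) * (\<Sum>l=1..X div d. of_real (g l) * F (d * l)))"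
proof -
  have "(\<Sum>n=1..X. of_real (dconv f g n) * F n)
      = (\<Sum>n=1..X. \<Sum>d | d dvd n. of_real (f d) * (of_real (g (n div d)) * F n))"
    by (simp add: dconv_def sum_distrib_right mult.assoc)
  also have "\<dots> = (\<Sum>(n, d)\<in>(SIGMA n:{1..X}. {d. d dvd n}). of_real (f d) * (of_real (g (n div d)) * F n))"
    by (rule sum.Sigma) auto
  also have "\<dots> = (\<Sum>(d, l)\<in>(SIGMA d:{1..X}. {1..X div d}). of_real (f d) * (of_real (g l) * F (d * l)))"
  proof (rule sum.reindex_bij_witness[of _ "\<lambda>(d, l). (d * l, d)" "\<lambda>(n, d). (d, n div d)"])
    fix a assume "a \<in> (SIGMA n:{1..X}. {d. d dvd n})"
    then obtain n d where a: "a = (n, d)" "1 \<le> n" "n \<le> X" "d dvd n" by auto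
    obtain l where l: "n = d * l" using a(4) by (elim dvdE)
    have pos: "0 < d" "0 < l" using a l by (auto intro!: Nat.gr0I)
    have dX: "d \<le> X" using a pos by (auto dest: dvd_imp_le)
    have lX: "l \<le> X div d" using a l pos by (simp add: less_eq_div_iff_mult_less_eq mult.commute)
    show "(case case a of (n, d) \<Rightarrow> (d, n div d) of (d, l) \<Rightarrow> (d * l, d)) = a"
      using a l pos by simp
    show "(case a of (n, d) \<Rightarrow> (d, n div d)) \<in> (SIGMA d:{1..X}. {1..X div d})"
      using a l pos dX lX by simp
    show "(case case a of (n, d) \<Rightarrow> (d, n div d) of (d, l) \<Rightarrow> complex_of_real (f d) * (of_real (g l) * F (d * l)))
      = (case a of (n, d) \<Rightarrow> of_real (f d) * (of_real (g (n div d)) * F n))"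
      using a l pos by simp
  next
    fix b assume "b \<in> (SIGMA d:{1..X}. {1..X div d})"
    then obtain d l where b: "b = (d, l)" "1 \<le> d" "d \<le> X" "1 \<le> l" "l \<le> X div d" by auto
    have dl: "d * l \<le> X" using b by (simp add: less_eq_div_iff_mult_less_eq mult.commute)
    show "(case case b of (d, l) \<Rightarrow> (d * l, d) of (n, d) \<Rightarrow> (d, n div d)) = b"
      using b by simp
    show "(case b of (d, l) \<Rightarrow> (d * l, d)) \<in> (SIGMA n:{1..X}. {d. d dvd n})"
      using b dl by simp
  qed
  also have "\<dots> = (\<Sum>d=1..X. \<Sum>l=1..X div d. of_real (f d) * (of_real (g l) * F (d * l)))"
    by (rule sum.Sigma[symmetric]) auto
  finally show ?thesis by (simp add: sum_distrib_left)
qed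

text \<open>Partial summation: the logarithm is a sum of nonnegative increments, and exchanging the
  sums leaves tails j..T, whose increments add up to ln T.\<close>

lemma norm_sum_ln_le:
  fixes G :: "nat \<Rightarrow> complex"
  assumes T: "1 \<le> T" and M: "\<And>j. 1 \<le> j \<Longrightarrow> j \<le> T \<Longrightarrow> norm (\<Sum>l=j..T. G l) \<le> M"
  shows "norm (\<Sum>l=1..T. of_real (ln (real l)) * G l) \<le> ln (real T) * M"
proof -
  define \<delta> where "\<delta> = (\<lambda>j::nat. if j = 1 then 0 else ln (real j) - ln (real (j - 1)))"
  have \<delta>0: "0 \<le> \<delta> j" if "1 \<le> j" for j
    using that by (cases "j = 1") (auto simp: \<delta>_def)
  have ln_eq: "ln (real n) = (\<Sum>j=1..n. \<delta> j)" if "1 \<le> n" for n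
    using that by (induction n rule: nat_induct_at_least) (simp_all add: \<delta>_def)
  have "(\<Sum>l=1..n. of_real (\<Sum>j=1..l. \<delta> j) * G l) = (\<Sum>j=1..n. of_real (\<delta> j) * (\<Sum>l=j..n. G l))" for n
  proof (induction n)
    case (Suc n)
    have "(\<Sum>j=1..Suc n. of_real (\<delta> j) * (\<Sum>l=j..Suc n. G l))
        = (\<Sum>j=1..n. of_real (\<delta> j) * (\<Sum>l=j..n. G l) + of_real (\<delta> j) * G (Suc n)) + of_real (\<delta> (Suc n)) * G (Suc n)"
      by (simp add: algebra_simps)
    also have "\<dots> = (\<Sum>j=1..n. of_real (\<delta> j) * (\<Sum>l=j..n. G l)) + of_real (\<Sum>j=1..Suc n. \<delta> j) * G (Suc n)"
      by (simp add: sum.distrib sum_distrib_left algebra_simps)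
    finally show ?case using Suc by simp
  qed simp
  then have "norm (\<Sum>l=1..T. of_real (ln (real l)) * G l) = norm (\<Sum>j=1..T. of_real (\<delta> j) * (\<Sum>l=j..T. G l))"
    by (simp add: ln_eq)
  also have "\<dots> \<le> (\<Sum>j=1..T. \<delta> j * M)"
    using \<delta>0 M by (intro sum_norm_le) (auto simp: norm_mult intro!: mult_mono)
  also have "\<dots> = ln (real T) * M" by (simp add: ln_eq[OF T] sum_distrib_right)
  finally show ?thesis .
qed

text \<open>\<open>M r\<close> has to bound all inner intervals because the logarithm is removed by
  partial summation. The last two sums are left as they stand since the linear and the polynomial
  case treat them differently: the one with \<open>vaughan_w\<close> is handled as type I throughout
  in the former, and is bilinear for r > U in the latter.\<close>

lemma vaughan_inequality:
  fixes F :: "nat \<Rightarrow> complex" and M :: "nat \<Rightarrow> real"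
  assumes F: "\<And>n. norm (F n) \<le> 1" and U: "1 \<le> U" "U \<le> X"
    and M: "\<And>r i j. 1 \<le> r \<Longrightarrow> r \<le> U \<Longrightarrow> 1 \<le> i \<Longrightarrow> j * r \<le> X \<Longrightarrow> norm (\<Sum>l=i..j. F (r * l)) \<le> M r"
  shows "norm (\<Sum>n=1..X. of_real (mangoldt n) * F n) \<le>
      real U * ln (real X) + ln (real X) * (\<Sum>r=1..U. M r)
    + norm (\<Sum>r=1..U\<^sup>2. of_real (vaughan_w U r) * (\<Sum>l=1..X div r. F (r * l)))
    + norm (\<Sum>k=1..X. of_real (vaughan_c U k) * (\<Sum>l=1..X div k. of_real (beyond U mangoldt l) * F (k * l)))"
proof -
  let ?T4 = "\<Sum>k=1..X. of_real (vaughan_c U k) * (\<Sum>l=1..X div k. of_real (beyond U mangoldt l) * F (k * l))"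
  let ?T3 = "\<Sum>r=1..X. of_real (vaughan_w U r) * (\<Sum>l=1..X div r. of_real 1 * F (r * l))"
  let ?T3' = "\<Sum>r=1..U\<^sup>2. of_real (vaughan_w U r) * (\<Sum>l=1..X div r. F (r * l))"
  let ?T2 = "\<Sum>d=1..X. of_real (up_to U moeb d) * (\<Sum>l=1..X div d. of_real (ln (real l)) * F (d * l))"
  let ?T1 = "\<Sum>n=1..X. of_real (up_to U mangoldt n) * F n"
  have X: "1 \<le> X" using U by simp
  have "(\<Sum>n=1..X. of_real (mangoldt n) * F n)
      = (\<Sum>n=1..X. of_real (up_to U mangoldt n) * F n + of_real (dconv (up_to U moeb) (\<lambda>l. ln (real l)) n) * F n
          - of_real (dconv (vaughan_w U) (\<lambda>_. 1) n) * F n + of_real (dconv (vaughan_c U) (beyond U mangoldt) n) * F n)"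
  proof (rule sum.cong[OF refl])
    fix n assume "n \<in> {1..X}"
    then have "(mangoldt n :: complex) = of_real (up_to U mangoldt n + dconv (up_to U moeb) (\<lambda>l. ln (real l)) n
           - dconv (vaughan_w U) (\<lambda>_. 1) n + dconv (vaughan_c U) (beyond U mangoldt) n)"
      by (subst vaughan_identity[symmetric]) auto
    then show "of_real (mangoldt n) * F n = of_real (up_to U mangoldt n) * F n + of_real (dconv (up_to U moeb) (\<lambda>l. ln (real l)) n) * F n
          - of_real (dconv (vaughan_w U) (\<lambda>_. 1) n) * F n + of_real (dconv (vaughan_c U) (beyond U mangoldt) n) * F n"
      by (simp only: of_real_mangoldt ring_distribs of_real_add of_real_diff)
  qed
  also have "\<dots> = ?T1 + ?T2 - ?T3 + ?T4"
    by (simp only: sum.distrib sum_subtractf sum_dconv)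
  finally have eq: "(\<Sum>n=1..X. of_real (mangoldt n) * F n) = ?T1 + ?T2 - ?T3 + ?T4" .
  have n4: "norm (a + b - c + d) \<le> norm a + norm b + norm c + norm d" for a b c d :: complex
    using norm_triangle_ineq[of "a + b - c" d] norm_triangle_ineq4[of "a + b" c] norm_triangle_ineq[of a b]
    by linarith
  have T1: "norm ?T1 \<le> real U * ln (real X)"
  proof -
    have "?T1 = (\<Sum>n=1..U. of_real (up_to U mangoldt n) * F n)"
      using U by (intro sum.mono_neutral_right) (auto simp: up_to_def)
    also have "norm \<dots> \<le> (\<Sum>n=1..U. ln (real X))"
    proof (rule sum_norm_le)
      fix n assume n: "n \<in> {1..U}"
      have "norm (of_real (up_to U mangoldt n) * F n) \<le> ln (real n) * 1"
        unfolding norm_mult using n F mangoldt_le[of n]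
        by (intro mult_mono) (auto simp: up_to_def)
      also have "\<dots> \<le> ln (real X)" using n U by simp
      finally show "norm (of_real (up_to U mangoldt n) * F n) \<le> ln (real X)" .
    qed
    also have "(\<Sum>n=1..U. ln (real X)) = real U * ln (real X)" by simp
    finally show ?thesis .
  qed
  have T2: "norm ?T2 \<le> ln (real X) * (\<Sum>r=1..U. M r)"
  proof -
    have "?T2 = (\<Sum>d=1..U. of_real (up_to U moeb d) * (\<Sum>l=1..X div d. of_real (ln (real l)) * F (d * l)))"
      using U by (intro sum.mono_neutral_right) (auto simp: up_to_def)
    also have "norm \<dots> \<le> (\<Sum>d=1..U. ln (real X) * M d)"
    proof (rule sum_norm_le)
      fix d assume d: "d \<in> {1..U}"
      have T: "1 \<le> X div d" using d U by (simp add: less_eq_div_iff_mult_less_eq)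
      have "0 \<le> M d" using M[of d 1 0] d by simp
      have "norm (\<Sum>l=1..X div d. of_real (ln (real l)) * F (d * l)) \<le> ln (real (X div d)) * M d"
        using d by (intro norm_sum_ln_le[OF T] M) auto
      also have "\<dots> \<le> ln (real X) * M d"
        using T \<open>0 \<le> M d\<close> div_le_dividend[of X d] by (intro mult_right_mono ln_mono) auto
      finally have "norm (\<Sum>l=1..X div d. of_real (ln (real l)) * F (d * l)) \<le> ln (real X) * M d" .
      moreover have "\<bar>up_to U moeb d\<bar> \<le> 1" by (simp add: up_to_def abs_moeb_le)
      ultimately have "\<bar>up_to U moeb d\<bar> * norm (\<Sum>l=1..X div d. of_real (ln (real l)) * F (d * l)) \<le> 1 * (ln (real X) * M d)"
        by (intro mult_mono) auto
      then show "norm (of_real (up_to U moeb d) * (\<Sum>l=1..X div d. of_real (ln (real l)) * F (d * l))) \<le> ln (real X) * M d"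
        by (simp add: norm_mult)
    qed
    finally show ?thesis by (simp add: sum_distrib_left)
  qed
  \<comment> \<open>X and U ^ 2 are not compared here: both ranges are extended to their union,
    since the inner sum is empty for r > X and the coefficient vanishes for r > U ^ 2.\<close>
  have T3: "?T3 = ?T3'"
  proof -
    let ?g = "\<lambda>r. of_real (vaughan_w U r) * (\<Sum>l=1..X div r. F (r * l))"
    have "(\<Sum>r=1..X. ?g r) = (\<Sum>r\<in>{1..X} \<union> {1..U\<^sup>2}. ?g r)"
      by (rule sum.mono_neutral_left) (auto simp: not_le)
    also have "\<dots> = (\<Sum>r=1..U\<^sup>2. ?g r)"
      by (rule sum.mono_neutral_right) (auto simp: not_le vaughan_w_eq_0)
    finally show ?thesis by simp
  qed
  show ?thesis
    unfolding eq using n4[of ?T1 ?T2 ?T3 ?T4] T1 T2 unfolding T3 by linarith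
qed

text \<open>Opening the square counts the n divisible by both d and e, at most x * gcd d e / (d e)
  of them. Splitting off g = gcd d e turns the weight into 1 / (g d' e'), and forgetting that d' and
  e' are coprime leaves three harmonic sums.\<close>

lemma sum_tau_squared_le:
  assumes x: "1 \<le> x"
  shows "(\<Sum>n=1..x. (real (tau n))\<^sup>2) \<le> real x * (1 + ln (real x)) ^ 3"
proof -
  have sq: "(real (tau n))\<^sup>2 = (\<Sum>d=1..x. \<Sum>e=1..x. if d dvd n \<and> e dvd n then 1 else 0)" if n: "n \<in> {1..x}" for n
  proof -
    have "real (tau n) = (\<Sum>d=1..x. if d dvd n then 1 else 0)"
    proof -
      have "{d. d dvd n} = {1..x} \<inter> {d. d dvd n}" using n
        by (auto intro: order_trans[OF dvd_imp_le] dvd_pos_nat simp: Suc_le_eq)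
      then show ?thesis by (simp add: tau_def sum.If_cases flip: Collect_conj_eq)
    qed
    then have "(real (tau n))\<^sup>2 = (\<Sum>d=1..x. \<Sum>e=1..x. (if d dvd n then 1 else 0) * (if e dvd n then 1 else 0))"
      by (simp only: power2_eq_square sum_product)
    also have "\<dots> = (\<Sum>d=1..x. \<Sum>e=1..x. if d dvd n \<and> e dvd n then 1 else 0)"
      by (intro sum.cong) auto
    finally show ?thesis .
  qed
  have cnt: "(\<Sum>n=1..x. if d dvd n \<and> e dvd n then 1 else 0 :: real) \<le> real x * (real (gcd d e) / (real d * real e))"
    if de: "1 \<le> d" "1 \<le> e" for d e
  proof -
    have l0: "0 < lcm d e" using de by (simp add: lcm_pos_nat)
    have "(\<Sum>n=1..x. if d dvd n \<and> e dvd n then 1 else 0 :: real) = real (card {n\<in>{1..x}. lcm d e dvd n})"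
      by (simp add: sum.If_cases Int_def)
    also have "{n\<in>{1..x}. lcm d e dvd n} \<subseteq> (\<lambda>i. lcm d e * i) ` {1..x div lcm d e}"
    proof
      fix n assume n: "n \<in> {n\<in>{1..x}. lcm d e dvd n}"
      then have "lcm d e dvd n" by blast
      then obtain i where "n = lcm d e * i" by (rule dvdE)
      with n have i: "n = lcm d e * i" "1 \<le> n" "n \<le> x" by auto
      then have "i \<in> {1..x div lcm d e}"
        using l0 by (auto simp: less_eq_div_iff_mult_less_eq mult.commute intro!: Nat.gr0I)
      then show "n \<in> (\<lambda>i. lcm d e * i) ` {1..x div lcm d e}" unfolding i(1) by (rule imageI)
    qed
    then have "card {n\<in>{1..x}. lcm d e dvd n} \<le> card ((\<lambda>i. lcm d e * i) ` {1..x div lcm d e})"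
      by (intro card_mono) auto
    also have "\<dots> \<le> x div lcm d e" using card_image_le[of "{1..x div lcm d e}"] by simp
    also have "real (x div lcm d e) \<le> real x / real (lcm d e)" by (rule of_nat_div_le_of_nat)
    also have "real (lcm d e) = real d * real e / real (gcd d e)"
      using prod_gcd_lcm_nat[of d e] de by (simp add: field_simps flip: of_nat_mult)
    finally show ?thesis by simp
  qed
  have "(\<Sum>(d, e)\<in>{1..x} \<times> {1..x}. real (gcd d e) / (real d * real e))
     \<le> (\<Sum>(g, d, e)\<in>{1..x} \<times> {1..x} \<times> {1..x}. 1 / real g * (1 / real d * (1 / real e)))"
  proof -
    let ?\<phi> = "\<lambda>(d::nat, e). (gcd d e, d div gcd d e, e div gcd d e)"
    have inj: "inj_on ?\<phi> ({1..x} \<times> {1..x})"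
    proof (rule inj_on_inverseI)
      fix p assume "p \<in> {1..x} \<times> {1..x}"
      obtain d e where p: "p = (d, e)" by (cases p)
      show "(\<lambda>(g, d, e). (g * d, g * e)) (?\<phi> p) = p" by (simp add: p)
    qed
    have "(\<Sum>(d, e)\<in>{1..x} \<times> {1..x}. real (gcd d e) / (real d * real e))
       = (\<Sum>p\<in>{1..x} \<times> {1..x}. (\<lambda>(g, d, e). 1 / real g * (1 / real d * (1 / real e))) (?\<phi> p))"
    proof (rule sum.cong[OF refl])
      fix p assume p: "p \<in> {1..x} \<times> {1..x}"
      obtain d e where de: "p = (d, e)" by (cases p)
      let ?g = "gcd d e"
      have g: "0 < ?g" using p de by simp
      have "real d = real ?g * real (d div ?g)" "real e = real ?g * real (e div ?g)"
        by (simp_all flip: of_nat_mult)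
      then show "(case p of (d, e) \<Rightarrow> real (gcd d e) / (real d * real e)) =
           (\<lambda>(g, d, e). 1 / real g * (1 / real d * (1 / real e))) (?\<phi> p)"
        using g unfolding de by (simp add: field_simps)
    qed
    also have "\<dots> = (\<Sum>t\<in>?\<phi> ` ({1..x} \<times> {1..x}). (\<lambda>(g, d, e). 1 / real g * (1 / real d * (1 / real e))) t)"
      by (simp only: sum.reindex[OF inj] o_def)
    also have "\<dots> \<le> (\<Sum>(g, d, e)\<in>{1..x} \<times> {1..x} \<times> {1..x}. 1 / real g * (1 / real d * (1 / real e)))"
    proof (rule sum_mono2)
      show "?\<phi> ` ({1..x} \<times> {1..x}) \<subseteq> {1..x} \<times> {1..x} \<times> {1..x}"
      proof
        fix t assume "t \<in> ?\<phi> ` ({1..x} \<times> {1..x})"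
        then obtain d e where de: "d \<in> {1..x}" "e \<in> {1..x}" "t = ?\<phi> (d, e)" by auto
        then have "gcd d e \<le> d" "1 \<le> gcd d e" by (auto simp: gcd_le1_nat Suc_le_eq)
        moreover have "1 \<le> d div gcd d e" "1 \<le> e div gcd d e"
          using de by (auto simp: Suc_le_eq div_greater_zero_iff gcd_le1_nat gcd_le2_nat)
        moreover have "d div gcd d e \<le> x" "e div gcd d e \<le> x"
          using de by (auto intro: order_trans[OF div_le_dividend])
        ultimately show "t \<in> {1..x} \<times> {1..x} \<times> {1..x}" using de by auto
      qed
    qed auto
    finally show ?thesis .
  qed
  also have "\<dots> = (\<Sum>g=1..x. 1 / real g) * ((\<Sum>d=1..x. 1 / real d) * (\<Sum>e=1..x. 1 / real e))"
    by (simp add: sum_product sum.cartesian_product case_prod_unfold)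
  also have "\<dots> \<le> (1 + ln (real x)) * ((1 + ln (real x)) * (1 + ln (real x)))"
    using x by (intro mult_mono sum_inverse_le_ln sum_nonneg mult_nonneg_nonneg) auto
  finally have main: "(\<Sum>(d, e)\<in>{1..x} \<times> {1..x}. real (gcd d e) / (real d * real e)) \<le> (1 + ln (real x)) ^ 3"
    by (simp only: power3_eq_cube mult.assoc)
  have "(\<Sum>n=1..x. (real (tau n))\<^sup>2) = (\<Sum>n=1..x. \<Sum>d=1..x. \<Sum>e=1..x. if d dvd n \<and> e dvd n then 1 else 0)"
    by (rule sum.cong[OF refl sq])
  also have "\<dots> = (\<Sum>d=1..x. \<Sum>n=1..x. \<Sum>e=1..x. if d dvd n \<and> e dvd n then 1 else 0)"
    by (rule sum.swap)
  also have "\<dots> = (\<Sum>d=1..x. \<Sum>e=1..x. \<Sum>n=1..x. if d dvd n \<and> e dvd n then 1 else 0)"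
    by (intro sum.cong refl sum.swap)
  also have "\<dots> \<le> (\<Sum>d=1..x. \<Sum>e=1..x. real x * (real (gcd d e) / (real d * real e)))"
    by (intro sum_mono cnt) auto
  also have "\<dots> = real x * (\<Sum>(d, e)\<in>{1..x} \<times> {1..x}. real (gcd d e) / (real d * real e))"
    by (simp add: sum_distrib_left sum.cartesian_product case_prod_unfold)
  also have "\<dots> \<le> real x * (1 + ln (real x)) ^ 3"
    by (intro mult_left_mono main) simp
  finally show ?thesis .
qed

text \<open>What remains are the powers p ^ i with i \<ge> 2. There p is at most sqrt X, the
  exponent at most the binary logarithm of X, and each term at most ln X.\<close>

lemma sum_mangoldt_minus_prime_le:
  assumes X: "1 \<le> X"
  shows "(\<Sum>n=1..X. mangoldt n - (if prime n then ln (real n) else 0)) \<le> 2 * sqrt (real X) * (ln (real X))\<^sup>2"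
proof -
  define J where "J = nat \<lfloor>log 2 (real X)\<rfloor>"
  define P where "P = nat \<lfloor>sqrt (real X)\<rfloor>"
  let ?A = "{n\<in>{1..X}. primepow n \<and> \<not> prime n}"
  have sub: "?A \<subseteq> (\<lambda>(p, j). p ^ j) ` ({1..P} \<times> {1..J})"
  proof
    fix n assume n: "n \<in> ?A"
    then have "primepow n" by blast
    then obtain p j where pj: "prime p" "j > 0" "n = p ^ j" unfolding primepow_def by blast
    have p2: "2 \<le> p" using pj(1) by (rule prime_ge_2_nat)
    have "n \<le> X" using n by simp
    then have nX: "p ^ j \<le> X" by (simp only: pj(3))
    have "\<not> prime n" using n by blast
    have "j \<noteq> 1"
    proof
      assume "j = 1"
      then have "n = p" unfolding pj(3) by (simp only: power_one_right)
      with \<open>\<not> prime n\<close> pj(1) show False by blast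
    qed
    then have j2: "2 \<le> j" using pj by simp
    have "p ^ 2 \<le> p ^ j" using p2 j2 by (intro power_increasing) auto
    with nX have "p ^ 2 \<le> X" by (rule order_trans[rotated])
    then have "real (p ^ 2) \<le> real X" by (rule of_nat_mono)
    then have "(real p)\<^sup>2 \<le> real X" by (simp only: of_nat_power)
    then have "real p \<le> sqrt (real X)" by (rule real_le_rsqrt)
    then have "p \<le> P" unfolding P_def by (rule le_nat_floor)
    moreover have "j \<le> J"
    proof -
      have "2 ^ j \<le> p ^ j" using p2 by (intro power_mono) auto
      also note nX
      finally have "2 ^ j \<le> X" .
      then have "real j \<le> log 2 (real X)" by (rule le_log2_of_power)
      then show ?thesis unfolding J_def by (rule le_nat_floor)
    qed
    ultimately have "(p, j) \<in> {1..P} \<times> {1..J}" using p2 j2 by auto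
    then have "(\<lambda>(p, j). p ^ j) (p, j) \<in> (\<lambda>(p, j). p ^ j) ` ({1..P} \<times> {1..J})" by (rule imageI)
    then show "n \<in> (\<lambda>(p, j). p ^ j) ` ({1..P} \<times> {1..J})" by (simp only: pj(3) prod.case)
  qed
  have "card ?A \<le> card ((\<lambda>(p, j). p ^ j) ` ({1..P} \<times> {1..J}))"
    by (rule card_mono[OF _ sub]) simp
  also have "\<dots> \<le> card ({1..P} \<times> {1..J})" by (rule card_image_le) simp
  also have "\<dots> = P * J" by simp
  finally have cA: "real (card ?A) \<le> real P * real J" by (simp flip: of_nat_mult)
  have P: "real P \<le> sqrt (real X)" by (simp add: P_def)
  have J: "real J \<le> 2 * ln (real X)"
  proof -
    have "real J \<le> log 2 (real X)" using X by (simp add: J_def)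
    also have "\<dots> = ln (real X) / ln 2" by (simp add: log_def)
    also have "\<dots> \<le> ln (real X) / (1 / 2)"
      using X ln_2_ge_half by (intro divide_left_mono) auto
    finally show ?thesis by simp
  qed
  have "(\<Sum>n=1..X. mangoldt n - (if prime n then ln (real n) else 0)) = (\<Sum>n\<in>?A. mangoldt n)"
    by (rule sum.mono_neutral_cong_right) (auto simp: mangoldt_def)
  also have "\<dots> \<le> (\<Sum>n\<in>?A. ln (real X))"
  proof (rule sum_mono)
    fix n assume n: "n \<in> ?A"
    then have "mangoldt n \<le> ln (real n)" by (intro mangoldt_le) auto
    also have "\<dots> \<le> ln (real X)" using n by simp
    finally show "mangoldt n \<le> ln (real X)" .
  qed
  also have "\<dots> = real (card ?A) * ln (real X)" by simp
  also have "\<dots> \<le> (sqrt (real X) * (2 * ln (real X))) * ln (real X)"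
  proof (rule mult_right_mono)
    have "real P * real J \<le> sqrt (real X) * (2 * ln (real X))" using P J by (intro mult_mono) auto
    then show "real (card ?A) \<le> sqrt (real X) * (2 * ln (real X))" using cA by linarith
  qed (use X in simp)
  finally show ?thesis by (simp add: power2_eq_square mult_ac)
qed

section \<open>Linear phases\<close>

lemma pos_le_zdiv_iff:
  assumes "0 < (m::int)" shows "t \<le> x div m \<longleftrightarrow> m * t \<le> x"
proof -
  have "t \<le> x div m \<longleftrightarrow> t \<le> \<lfloor>real_of_int x / real_of_int m\<rfloor>" by (simp add: floor_divide_of_int_eq)
  also have "\<dots> \<longleftrightarrow> real_of_int (m * t) \<le> real_of_int x"
    using assms by (simp add: le_floor_iff pos_le_divide_eq mult.commute)
  finally show ?thesis by (simp only: of_int_le_iff)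
qed

text \<open>The members of the class are r + m t with r the least residue, so the sum is a geometric
  sum in t with frequency \<gamma> m.\<close>

lemma norm_ap_sum_le:
  fixes i j k0 m :: nat
  assumes m: "1 \<le> m" and D: "0 \<le> D" "(real j - real i) / real m + 1 \<le> D"
  shows "norm (\<Sum>k\<in>{k\<in>{i..j}. [k = k0] (mod m)}. e2pi (\<gamma> * real k + c)) \<le> wmin D (\<gamma> * real m)"
proof -
  define r where "r = k0 mod m"
  \<comment> \<open>The ceiling of (i - r) / m, written with a floor division. It is not negative
    because i \<ge> 0 and r < m; this is checked below before t becomes a natural number.\<close>
  define lo where "lo = - ((int r - int i) div int m)"
  define hi where "hi = (int j - int r) div int m"
  have m0: "0 < int m" using m by simp
  have r: "r < m" using m by (simp add: r_def)
  have hi_iff: "t \<le> hi \<longleftrightarrow> int r + int m * t \<le> int j" for t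
    using m0 unfolding hi_def by (subst pos_le_zdiv_iff) (auto simp: algebra_simps)
  have lo_iff: "lo \<le> t \<longleftrightarrow> int i \<le> int r + int m * t" for t
  proof -
    have "lo \<le> t \<longleftrightarrow> - t \<le> (int r - int i) div int m" by (auto simp: lo_def)
    also have "\<dots> \<longleftrightarrow> int i \<le> int r + int m * t"
      using m0 by (subst pos_le_zdiv_iff) (auto simp: algebra_simps)
    finally show ?thesis .
  qed
  have "(\<Sum>k\<in>{k\<in>{i..j}. [k = k0] (mod m)}. e2pi (\<gamma> * real k + c))
      = (\<Sum>t\<in>{lo..hi}. e2pi ((\<gamma> * real m) * of_int t + (\<gamma> * real r + c)))"
  proof (rule sum.reindex_bij_witness[of _ "\<lambda>t. nat (int r + int m * t)" "\<lambda>k. int (k div m)"])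
    fix k assume k: "k \<in> {k\<in>{i..j}. [k = k0] (mod m)}"
    then have "k mod m = r" by (simp add: r_def cong_def)
    then have kr: "k = r + m * (k div m)" by (metis add.commute mult_div_mod_eq)
    then have kr': "int k = int r + int m * int (k div m)" by (metis of_nat_add of_nat_mult)
    show "nat (int r + int m * int (k div m)) = k" using kr' by simp
    show "int (k div m) \<in> {lo..hi}"
      using k kr' by (auto simp: hi_iff lo_iff simp del: of_nat_div)
    have "real k = real r + real m * real (k div m)" by (subst kr) simp
    then show "e2pi ((\<gamma> * real m) * of_int (int (k div m)) + (\<gamma> * real r + c)) = e2pi (\<gamma> * real k + c)"
      by (simp add: algebra_simps)
  next
    fix t assume "t \<in> {lo..hi}"
    then have t: "int i \<le> int r + int m * t" "int r + int m * t \<le> int j" by (auto simp: hi_iff lo_iff)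
    have t0: "0 \<le> t"
    proof (rule ccontr)
      assume "\<not> 0 \<le> t"
      then have "int m * t \<le> int m * (- 1)" using m0 by (intro mult_left_mono) auto
      then show False using t r by linarith
    qed
    then have e: "nat (int r + int m * t) = r + m * nat t" by (simp add: nat_add_distrib nat_mult_distrib)
    show "int (nat (int r + int m * t) div m) = t" unfolding e using r t0 m by simp
    have "(r + m * nat t) mod m = k0 mod m" by (simp add: r_def)
    then show "nat (int r + int m * t) \<in> {k\<in>{i..j}. [k = k0] (mod m)}"
      using t e by (auto simp: cong_def)
  qed
  also have "norm \<dots> \<le> wmin D (\<gamma> * real m)"
  proof (rule norm_linear_exp_sum[OF _ D(1)])
    have "int r + int m * hi \<le> int j" "int i \<le> int r + int m * lo"
      using hi_iff[of hi] lo_iff[of lo] by auto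
    then have "int m * (hi - lo) \<le> int j - int i" by (simp add: algebra_simps)
    then have "real_of_int (int m * (hi - lo)) \<le> real_of_int (int j - int i)" by (rule of_int_le_iff[THEN iffD2])
    then have "real_of_int (hi - lo) \<le> (real j - real i) / real m"
      using m by (simp add: pos_le_divide_eq mult.commute)
    then show "real_of_int (hi - lo + 1) \<le> D" using D(2) by simp
  qed
  finally show ?thesis .
qed

text \<open>At most 2 ln X + 1 dyadic blocks meet 1..X. Terms vanishing beyond X allow the last
  block to be taken in full.\<close>

lemma norm_dyadic_sum_le:
  fixes t :: "nat \<Rightarrow> complex"
  assumes X: "1 \<le> X" and z: "\<And>k. X < k \<Longrightarrow> t k = 0" and Bd: "0 \<le> Bd"
    and blk: "\<And>i. 2 ^ i \<le> X \<Longrightarrow> norm (\<Sum>k\<in>{2 ^ i..<2 * 2 ^ i}. t k) \<le> Bd"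
  shows "norm (\<Sum>k=1..X. t k) \<le> (2 * ln (real X) + 1) * Bd"
proof -
  have ind: "norm (\<Sum>k\<in>{1..<2 ^ J}. t k) \<le> real J * Bd" for J
  proof (induction J)
    case (Suc J)
    have b: "norm (\<Sum>k\<in>{2 ^ J..<2 * 2 ^ J}. t k) \<le> Bd"
    proof (cases "2 ^ J \<le> X")
      case False
      then have "(\<Sum>k\<in>{2 ^ J..<2 * 2 ^ J}. t k) = 0" by (intro sum.neutral ballI z) auto
      then show ?thesis using Bd by simp
    qed (rule blk)
    have "(\<Sum>k\<in>{1..<2 ^ Suc J}. t k) = (\<Sum>k\<in>{1..<2 ^ J}. t k) + (\<Sum>k\<in>{2 ^ J..<2 * 2 ^ J}. t k)"
      by (simp add: sum.atLeastLessThan_concat)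
    then have "norm (\<Sum>k\<in>{1..<2 ^ Suc J}. t k) \<le> real J * Bd + Bd"
      using norm_triangle_ineq[of "\<Sum>k\<in>{1..<2 ^ J}. t k" "\<Sum>k\<in>{2 ^ J..<2 * 2 ^ J}. t k"] Suc b by simp
    then show ?case by (simp add: algebra_simps)
  qed simp
  define J where "J = nat \<lfloor>log 2 (real X)\<rfloor> + 1"
  have l0: "0 \<le> log 2 (real X)" using X by simp
  have "log 2 (real X) < real J" unfolding J_def using l0 by linarith
  then have "real X < 2 powr real J" using X by (simp add: log_less_iff)
  then have "real X < real (2 ^ J)" by (simp add: powr_realpow)
  then have XJ: "X < 2 ^ J" by (rule of_nat_less_imp_less)
  have "(\<Sum>k=1..X. t k) = (\<Sum>k\<in>{1..<2 ^ J}. t k)"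
    by (rule sum.mono_neutral_left) (use XJ z in auto)
  then have "norm (\<Sum>k=1..X. t k) \<le> real J * Bd" using ind by simp
  also have "real J \<le> 2 * ln (real X) + 1"
  proof -
    have "real J \<le> log 2 (real X) + 1" unfolding J_def using l0 by linarith
    also have "log 2 (real X) = ln (real X) / ln 2" by (simp add: log_def)
    also have "\<dots> \<le> ln (real X) / (1 / 2)"
      using X ln_2_ge_half by (intro divide_left_mono) auto
    finally show ?thesis by simp
  qed
  finally show ?thesis using Bd by (simp add: mult_right_mono)
qed

section \<open>From primes to von Mangoldt weights\<close>

definition prime_ln :: "nat \<Rightarrow> real" where
  "prime_ln n = (if prime n then ln (real n) else 0)"

lemma norm_weighted_sum_trivial:
  assumes "1 \<le> m" "b < m"
  shows "norm (weighted_sum k \<alpha> m b N) \<le> real N * ln (real (m * N + b))"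
proof -
  have "norm (weighted_sum k \<alpha> m b N) \<le> (\<Sum>n=1..N. ln (real (m * N + b)))"
    unfolding weighted_sum_def
  proof (rule sum_norm_le)
    fix n assume n: "n \<in> {1..N}"
    have "0 < m * n" using n assms by simp
    then have "1 \<le> m * n + b" by linarith
    moreover have "m * n + b \<le> m * N + b" using n by simp
    ultimately have le: "m * n + b \<le> m * N + b" "1 \<le> m * n + b" by auto
    then have "ln (real (m * n + b)) \<le> ln (real (m * N + b))" by (intro ln_mono) (auto simp del: of_nat_add of_nat_mult)
    moreover have "0 \<le> ln (real (m * n + b))" using le by (intro ln_ge_zero) (auto simp del: of_nat_add of_nat_mult)
    ultimately show "norm (of_real (prime_weight m b n) * e2pi (phase k \<alpha> (real n))) \<le> ln (real (m * N + b))"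
      by (auto simp: norm_mult prime_weight_def)
  qed
  then show ?thesis by simp
qed

text \<open>F lives on the class of b, so x = m n + b translates the two sums into each other,
  except that the range of x also contains x = b, that is n = 0. This extra term costs ln X, the
  proper prime powers cost the square-root term.\<close>

lemma norm_weighted_sum_le_mangoldt:
  fixes F :: "nat \<Rightarrow> complex"
  assumes m: "1 \<le> m" "b < m" and X: "X = m * N + b" "1 \<le> N"
    and F: "\<And>n. norm (F n) \<le> 1" "\<And>n. \<not> [n = b] (mod m) \<Longrightarrow> F n = 0"
      "\<And>n. F (m * n + b) = e2pi (phase k \<alpha> (real n))"
  shows "norm (weighted_sum k \<alpha> m b N) \<le> norm (\<Sum>n=1..X. of_real (mangoldt n) * F n)
           + 2 * sqrt (real X) * (ln (real X))\<^sup>2 + ln (real X)"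
proof -
  have "0 < m * N" using m X by simp
  then have X1: "1 \<le> X" "b \<le> X" unfolding X(1) by linarith+
  have lnX: "0 \<le> ln (real X)" using X1 by (intro ln_ge_zero) simp
  have "(\<Sum>n=1..X. of_real (prime_ln n) * F n) = (\<Sum>n\<in>(\<lambda>n. m * n + b) ` {0..N}. of_real (prime_ln n) * F n)"
  proof (rule sum.mono_neutral_cong)
    fix x assume x: "x \<in> {1..X} - (\<lambda>n. m * n + b) ` {0..N}"
    have "\<not> [x = b] (mod m)"
    proof
      assume "[x = b] (mod m)"
      then have "x mod m = b" using m by (simp add: cong_def)
      then have e: "x = m * (x div m) + b" by (metis mult_div_mod_eq)
      moreover have "x div m \<le> N"
      proof -
        have "x \<le> X" using x by simp
        then have "m * (x div m) \<le> m * N" using e X by linarith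
        then show ?thesis using m by simp
      qed
      ultimately show False using x by auto
    qed
    then show "of_real (prime_ln x) * F x = 0" by (simp add: F)
  next
    \<comment> \<open>The only such x is 0, reached when n = 0 and b = 0.\<close>
    fix x assume x: "x \<in> (\<lambda>n. m * n + b) ` {0..N} - {1..X}"
    then obtain n where n: "n \<le> N" "x = m * n + b" by auto
    then have "x \<le> X" using X by simp
    then have "x = 0" using x by auto
    then show "of_real (prime_ln x) * F x = 0" by (simp add: prime_ln_def)
  qed auto
  also have "\<dots> = (\<Sum>n\<in>{0..N}. of_real (prime_ln (m * n + b)) * F (m * n + b))"
    using m by (subst sum.reindex) (auto simp: inj_on_def)
  also have "\<dots> = of_real (prime_ln b) * F b + weighted_sum k \<alpha> m b N"
    using F(3)[of 0] by (simp add: sum.atLeast_Suc_atMost weighted_sum_def F(3) prime_ln_def prime_weight_def)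
  finally have eq: "weighted_sum k \<alpha> m b N = (\<Sum>n=1..X. of_real (mangoldt n) * F n)
       - (\<Sum>n=1..X. of_real (mangoldt n - prime_ln n) * F n) - of_real (prime_ln b) * F b"
    by (simp add: sum_subtractf[symmetric] algebra_simps)
  have "norm (\<Sum>n=1..X. of_real (mangoldt n - prime_ln n) * F n) \<le> (\<Sum>n=1..X. mangoldt n - prime_ln n)"
  proof (rule sum_norm_le)
    fix n
    have "prime_ln n \<le> mangoldt n" using mangoldt_nonneg[of n] by (auto simp: prime_ln_def)
    then show "norm (of_real (mangoldt n - prime_ln n) * F n) \<le> mangoldt n - prime_ln n"
      unfolding norm_mult norm_of_real using mult_left_mono[OF F(1)[of n], of "mangoldt n - prime_ln n"] by simp
  qed
  also have "\<dots> \<le> 2 * sqrt (real X) * (ln (real X))\<^sup>2"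
    unfolding prime_ln_def by (rule sum_mangoldt_minus_prime_le[OF X1(1)])
  finally have 1: "norm (\<Sum>n=1..X. of_real (mangoldt n - prime_ln n) * F n) \<le> 2 * sqrt (real X) * (ln (real X))\<^sup>2" .
  have 2: "norm (of_real (prime_ln b) * F b) \<le> ln (real X)"
  proof (cases "prime b")
    case True
    then have "0 < b" "ln (real b) \<le> ln (real X)" "0 \<le> ln (real b)"
      using X1 prime_gt_0_nat[OF True] by (auto intro!: ln_mono)
    moreover have "norm (F b) \<le> 1" by (rule F(1))
    ultimately have "ln (real b) * norm (F b) \<le> ln (real X) * 1" using lnX by (intro mult_mono) auto
    then show ?thesis using \<open>0 \<le> ln (real b)\<close> by (simp add: norm_mult prime_ln_def True)
  qed (use lnX in \<open>simp add: prime_ln_def\<close>)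
  have "norm (a - b - c) \<le> norm a + norm b + norm c" for a b c :: complex
    using norm_triangle_ineq4[of "a - b" c] norm_triangle_ineq4[of a b] by linarith
  from this[of "\<Sum>n=1..X. of_real (mangoldt n) * F n"
      "\<Sum>n=1..X. of_real (mangoldt n - prime_ln n) * F n" "of_real (prime_ln b) * F b"]
  show ?thesis unfolding eq using 1 2 by linarith
qed

text \<open>If r * l = b modulo m has a solution, r is prime to m because b is. The solutions then
  form one residue class, and its step m cancels the division by m in the phase. Without a solution
  all terms are 0.\<close>

lemma norm_linear_progression_le:
  fixes F :: "nat \<Rightarrow> complex"
  assumes m: "1 \<le> m" "coprime b m"
    and F: "\<And>n. F n = (if [n = b] (mod m) then e2pi (\<alpha> * ((real n - real b) / real m)) else 0)"
    and r: "1 \<le> r" "j * r \<le> X" "1 \<le> i" and D: "real X / (real r * real m) + 1 \<le> D"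
  shows "norm (\<Sum>l=i..j. F (r * l)) \<le> wmin D (\<alpha> * real r)"
proof -
  have "0 \<le> real X / (real r * real m)" by simp
  with D have D0: "0 \<le> D" by linarith
  show ?thesis
  proof (cases "\<exists>l0. [r * l0 = b] (mod m)")
    case True
    then obtain l0 where l0: "[r * l0 = b] (mod m)" by auto
    have "coprime (r * l0) m" using l0 m(2) by (metis cong_imp_coprime cong_sym)
    then have cop: "coprime r m" by simp
    have iff: "[r * l = b] (mod m) \<longleftrightarrow> [l = l0] (mod m)" for l
      using cop l0 by (metis cong_mult_lcancel_nat cong_sym cong_trans)
    have "(\<Sum>l=i..j. F (r * l)) = (\<Sum>l\<in>{l\<in>{i..j}. [l = l0] (mod m)}. e2pi ((\<alpha> * real r / real m) * real l + (- \<alpha> * real b / real m)))"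
    proof (rule sum.mono_neutral_cong_right)
      fix l assume "l \<in> {l\<in>{i..j}. [l = l0] (mod m)}"
      then have "[r * l = b] (mod m)" using iff by auto
      then show "F (r * l) = e2pi ((\<alpha> * real r / real m) * real l + (- \<alpha> * real b / real m))"
        by (simp add: F diff_divide_distrib algebra_simps)
    qed (use iff in \<open>auto simp: F\<close>)
    also have "norm \<dots> \<le> wmin D ((\<alpha> * real r / real m) * real m)"
    proof (rule norm_ap_sum_le[OF m(1) D0])
      have "real j * real r \<le> real X" using r by (metis of_nat_le_iff of_nat_mult)
      then have "real j \<le> real X / real r" using r by (simp add: pos_le_divide_eq)
      then have "real j - real i \<le> real X / real r" by simp
      then have "(real j - real i) / real m \<le> real X / real r / real m" by (rule divide_right_mono) simp
      then show "(real j - real i) / real m + 1 \<le> D" using D by simp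
    qed
    finally show ?thesis using m by simp
  next
    case False
    then have "(\<Sum>l=i..j. F (r * l)) = 0" by (simp add: F)
    then show ?thesis using D0 by (simp add: wmin_nonneg)
  qed
qed

text \<open>The two congruences together select at most one class of k modulo m, since l is
  invertible as soon as they have a common solution. A step of m in k then turns the phase by
  \<alpha> (l - l').\<close>

lemma norm_linear_correlation_le:
  fixes F :: "nat \<Rightarrow> complex"
  assumes m: "1 \<le> m" "coprime b m"
    and F: "\<And>n. F n = (if [n = b] (mod m) then e2pi (\<alpha> * ((real n - real b) / real m)) else 0)"
    and j: "j \<le> 2 * K"
  shows "norm (\<Sum>k=K..j. F (k * l) * cnj (F (k * l'))) \<le> wmin (real K / real m + 1) (\<alpha> * (real l - real l'))"
proof (cases "\<exists>k0. [k0 * l = b] (mod m) \<and> [k0 * l' = b] (mod m)")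
  case True
  then obtain k0 where k0: "[k0 * l = b] (mod m)" "[k0 * l' = b] (mod m)" by auto
  have "coprime (k0 * l) m" using k0 m(2) by (metis cong_imp_coprime cong_sym)
  then have cop: "coprime l m" by simp
  have iff: "[k * l = b] (mod m) \<and> [k * l' = b] (mod m) \<longleftrightarrow> [k = k0] (mod m)" for k
  proof
    assume "[k * l = b] (mod m) \<and> [k * l' = b] (mod m)"
    then show "[k = k0] (mod m)"
      using cop k0 by (metis cong_mult_rcancel_nat cong_sym cong_trans)
  next
    assume "[k = k0] (mod m)"
    then show "[k * l = b] (mod m) \<and> [k * l' = b] (mod m)"
      using k0 by (meson cong_scalar_right cong_trans)
  qed
  have "(\<Sum>k=K..j. F (k * l) * cnj (F (k * l')))
     = (\<Sum>k\<in>{k\<in>{K..j}. [k = k0] (mod m)}. e2pi ((\<alpha> * (real l - real l') / real m) * real k + 0))"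
  proof (rule sum.mono_neutral_cong_right)
    fix k assume "k \<in> {k\<in>{K..j}. [k = k0] (mod m)}"
    then have "[k * l = b] (mod m)" "[k * l' = b] (mod m)" using iff by auto
    then show "F (k * l) * cnj (F (k * l')) = e2pi ((\<alpha> * (real l - real l') / real m) * real k + 0)"
      by (simp add: F cnj_e2pi diff_divide_distrib algebra_simps flip: e2pi_add)
  qed (use iff in \<open>auto simp: F\<close>)
  also have "norm \<dots> \<le> wmin (real K / real m + 1) ((\<alpha> * (real l - real l') / real m) * real m)"
    by (rule norm_ap_sum_le[OF m(1)]) (use j m in \<open>auto intro!: divide_right_mono\<close>)
  finally show ?thesis using m by simp
next
  case False
  then have "(\<Sum>k=K..j. F (k * l) * cnj (F (k * l'))) = 0" by (intro sum.neutral) (auto simp: F)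
  then show ?thesis by (simp add: wmin_nonneg)
qed

text \<open>Cauchy-Schwarz in k removes the coefficients c. Opening the square and summing over k
  first leaves, for each fixed l', a spacing sum in l with offset - \<alpha> l'; of the coefficients
  g only the uniform bound G survives.\<close>

lemma bilinear_linear_phase:
  fixes F :: "nat \<Rightarrow> complex" and c g :: "nat \<Rightarrow> real"
  assumes m: "1 \<le> m" "coprime b m"
    and F: "\<And>n. F n = (if [n = b] (mod m) then e2pi (\<alpha> * ((real n - real b) / real m)) else 0)"
    and \<alpha>: "rat_approx \<alpha> a q" and K: "1 \<le> K" and G: "\<And>l. l \<le> X \<Longrightarrow> \<bar>g l\<bar> \<le> G"
  shows "(norm (\<Sum>k\<in>{K..<2 * K}. of_real (c k) * (\<Sum>l=1..X div k. of_real (g l) * F (k * l))))\<^sup>2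
     \<le> (\<Sum>k\<in>{K..<2 * K}. (c k)\<^sup>2) * (G\<^sup>2 * (real (X div K) * ((2 * real (X div K) / real q + 1)
          * (2 * (real K / real m + 1) + 4 * real q * (1 + ln (real q))))))"
proof -
  let ?L = "X div K"
  let ?D = "real K / real m + 1"
  let ?W = "(2 * real ?L / real q + 1) * (2 * ?D + 4 * real q * (1 + ln (real q)))"
  define s where "s = (\<lambda>k. \<Sum>l=1..X div k. of_real (g l) * F (k * l))"
  have G0: "0 \<le> G" using G[of 0] by linarith
  have "norm (\<Sum>k\<in>{K..<2 * K}. of_real (c k) * s k) \<le> (\<Sum>k\<in>{K..<2 * K}. \<bar>c k\<bar> * norm (s k))"
    by (rule order_trans[OF norm_sum]) (simp add: norm_mult)
  then have "(norm (\<Sum>k\<in>{K..<2 * K}. of_real (c k) * s k))\<^sup>2 \<le> (\<Sum>k\<in>{K..<2 * K}. \<bar>c k\<bar> * norm (s k))\<^sup>2"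
    by (rule power_mono) simp
  also have "\<dots> \<le> (\<Sum>k\<in>{K..<2 * K}. \<bar>c k\<bar>\<^sup>2) * (\<Sum>k\<in>{K..<2 * K}. (norm (s k))\<^sup>2)"
    by (rule Cauchy_Schwarz_ineq_sum)
  also have "(\<Sum>k\<in>{K..<2 * K}. (norm (s k))\<^sup>2) \<le> G\<^sup>2 * (real ?L * ?W)"
  proof -
    \<comment> \<open>The range of l is made independent of k at the price of the indicator of k * l
      \<le> X, which afterwards merely shortens the interval of k.\<close>
    have ind: "s k = (\<Sum>l=1..?L. of_real (if k * l \<le> X then g l else 0) * F (k * l))" if k: "k \<in> {K..<2 * K}" for k
      unfolding s_def
    proof (rule sum.mono_neutral_cong_left)
      have "X div k \<le> X div K" using k K by (intro div_le_mono2) auto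
      then show "{1..X div k} \<subseteq> {1..?L}" by auto
    qed (use k K in \<open>auto simp: less_eq_div_iff_mult_less_eq mult.commute\<close>)
    let ?t = "\<lambda>l l' k. (if k * l \<le> X then F (k * l) else 0) * cnj (if k * l' \<le> X then F (k * l') else 0)"
    have inner: "norm (\<Sum>k\<in>{K..<2 * K}. ?t l l' k) \<le> wmin ?D (\<alpha> * of_int (int l) + (- \<alpha> * real l'))"
      if l: "1 \<le> l" "1 \<le> l'" for l l'
    proof -
      define j where "j = min (2 * K - 1) (min (X div l) (X div l'))"
      have "(\<Sum>k\<in>{K..<2 * K}. ?t l l' k) = (\<Sum>k=K..j. F (k * l) * cnj (F (k * l')))"
        by (rule sum.mono_neutral_cong_right)
           (use l K in \<open>auto simp: j_def less_eq_div_iff_mult_less_eq not_le\<close>)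
      also have "norm \<dots> \<le> wmin ?D (\<alpha> * (real l - real l'))"
        by (rule norm_linear_correlation_le[OF m F]) (simp add: j_def)
      finally show ?thesis by (simp add: algebra_simps)
    qed
    have "complex_of_real (\<Sum>k\<in>{K..<2 * K}. (norm (s k))\<^sup>2) = (\<Sum>k\<in>{K..<2 * K}. s k * cnj (s k))"
      unfolding of_real_sum by (simp only: complex_norm_square)
    also have "\<dots> = (\<Sum>k\<in>{K..<2 * K}. \<Sum>l=1..?L. \<Sum>l'=1..?L. of_real (g l * g l') * ?t l l' k)"
      by (rule sum.cong[OF refl]) (auto simp: ind sum_product intro!: sum.cong)
    also have "\<dots> = (\<Sum>l=1..?L. \<Sum>l'=1..?L. of_real (g l * g l') * (\<Sum>k\<in>{K..<2 * K}. ?t l l' k))"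
      by (subst sum.swap, rule sum.cong[OF refl], subst sum.swap) (simp add: sum_distrib_left)
    finally have eq: "complex_of_real (\<Sum>k\<in>{K..<2 * K}. (norm (s k))\<^sup>2)
      = (\<Sum>l=1..?L. \<Sum>l'=1..?L. of_real (g l * g l') * (\<Sum>k\<in>{K..<2 * K}. ?t l l' k))" .
    have "(\<Sum>k\<in>{K..<2 * K}. (norm (s k))\<^sup>2) = norm (complex_of_real (\<Sum>k\<in>{K..<2 * K}. (norm (s k))\<^sup>2))"
      unfolding norm_of_real by (simp add: sum_nonneg)
    also have "\<dots> \<le> (\<Sum>l=1..?L. \<Sum>l'=1..?L. G\<^sup>2 * wmin ?D (\<alpha> * of_int (int l) + (- \<alpha> * real l')))"
      unfolding eq
    proof (intro sum_norm_le)
      fix l l' assume l: "l \<in> {1..?L}" "l' \<in> {1..?L}"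
      then have lX: "l \<le> X" "l' \<le> X" by (auto intro: order_trans[OF _ div_le_dividend])
      have "\<bar>g l * g l'\<bar> \<le> G * G" unfolding abs_mult using G lX G0 by (intro mult_mono) auto
      then show "norm (of_real (g l * g l') * (\<Sum>k\<in>{K..<2 * K}. ?t l l' k)) \<le> G\<^sup>2 * wmin ?D (\<alpha> * of_int (int l) + (- \<alpha> * real l'))"
        unfolding norm_mult norm_of_real power2_eq_square using l by (intro mult_mono inner) auto
    qed
    also have "\<dots> = G\<^sup>2 * (\<Sum>l'=1..?L. \<Sum>l=1..?L. wmin ?D (\<alpha> * of_int (int l) + (- \<alpha> * real l')))"
      by (subst sum.swap) (simp add: sum_distrib_left)
    also have "\<dots> \<le> G\<^sup>2 * (\<Sum>l'=1..?L. ?W)"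
    proof (intro mult_left_mono sum_mono)
      fix l' assume "l' \<in> {1..?L}"
      have "(\<Sum>l=1..?L. wmin ?D (\<alpha> * of_int (int l) + (- \<alpha> * real l')))
        = (\<Sum>n\<in>{0 + 1..0 + int ?L}. wmin ?D (\<alpha> * of_int n + (- \<alpha> * real l')))"
        by (rule sum.reindex_bij_witness[of _ nat int]) auto
      also have "\<dots> \<le> ?W" by (rule sum_wmin_interval[OF \<alpha>]) simp
      finally show "(\<Sum>l=1..?L. wmin ?D (\<alpha> * of_int (int l) + (- \<alpha> * real l'))) \<le> ?W" .
    qed simp
    finally show ?thesis by simp
  qed
  finally show ?thesis by (simp add: s_def mult_left_mono sum_nonneg)
qed

section \<open>The estimate for k = 1\<close>

lemma admissible_rat_approx: "admissible k \<alpha> N m b a q \<Longrightarrow> rat_approx (\<alpha> k) a q"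
  by (simp add: admissible_def rat_approx_def)

text \<open>For q > N the third term of the bracket is at least 1 and the trivial bound is enough.
  Otherwise U near X powr (2 / 5) balances the length U ^ 2 of the type I range against the bilinear
  saving U powr (- 1 / 2): both lead to X powr (4 / 5), the second term of the bracket. The
  constants of the separate estimates add up to 15408.\<close>

lemma theorem5_linear:
  assumes adm: "admissible 1 \<alpha> N m b a q"
  shows "norm (weighted_sum 1 \<alpha> m b N) \<le> 20000 * (real N * real m) * (ln (real N)) ^ 4 *
           (real q powr (- 1 / 2) + (real N * real m) powr (- 1 / 5) + real N powr (- 1 / 2) * real q powr (1 / 2))"
proof -
  define P where "P = real N * real m"
  define LL where "LL = ln (real N)"
  define E1 where "E1 = real q powr (- 1 / 2)"
  define E2 where "E2 = P powr (- 1 / 5)"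
  define E3 where "E3 = real N powr (- 1 / 2) * real q powr (1 / 2)"
  define E where "E = E1 + E2 + E3"
  define X where "X = m * N + b"
  have N: "2 \<le> N" and m: "1 \<le> m" "m \<le> N" "b < m" "coprime b m" and q: "1 \<le> q"
    using adm by (auto simp: admissible_def)
  have \<alpha>: "rat_approx (\<alpha> 1) a q" by (rule admissible_rat_approx[OF adm])
  have NP: "real N \<le> P" using m mult_left_mono[of 1 "real m" "real N"] by (simp add: P_def)
  have mP: "real m \<le> P" using N mult_right_mono[of 1 "real N" "real m"] by (simp add: P_def)
  have P2: "2 \<le> P" using NP N by linarith
  have Xr: "real X = P + real b" by (simp add: X_def P_def mult.commute)
  have XP: "P \<le> real X" "real X \<le> 2 * P" using m mP by (simp_all add: Xr)
  have X2: "2 \<le> X" using XP(1) P2 by linarith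
  have LL: "1 / 2 \<le> LL" "ln 2 \<le> LL"
  proof -
    show "ln 2 \<le> LL" using N by (simp add: LL_def)
    then show "1 / 2 \<le> LL" using ln_2_ge_half by linarith
  qed
  \<comment> \<open>For N = 2 the logarithm is below 1, so raising a lower power of it to the fourth
    costs the factors 8 and 4.\<close>
  have L4: "LL \<le> 8 * LL ^ 4" "LL\<^sup>2 \<le> 4 * LL ^ 4"
  proof -
    have "(1 / 2) ^ 3 \<le> LL ^ 3" "(1 / 2) ^ 2 \<le> LL ^ 2" using LL by (intro power_mono; simp)+
    then have "(1 / 8) * LL \<le> LL ^ 3 * LL" "(1 / 4) * LL\<^sup>2 \<le> LL ^ 2 * LL\<^sup>2"
      using LL by (intro mult_right_mono; simp add: power3_eq_cube power2_eq_square)+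
    then show "LL \<le> 8 * LL ^ 4" "LL\<^sup>2 \<le> 4 * LL ^ 4"
      by (simp_all add: power4_eq_xxxx power3_eq_cube power2_eq_square)
  qed
  define lX where "lX = ln (real X)"
  have lX: "0 \<le> lX" "lX \<le> 3 * LL"
  proof -
    show "0 \<le> lX" using X2 by (simp add: lX_def)
    have "lX \<le> ln (2 * (real N * real N))"
    proof -
      have "real X \<le> 2 * (real N * real N)"
      proof -
        have "P \<le> real N * real N" unfolding P_def using m by (intro mult_left_mono) auto
        then show ?thesis using XP(2) by linarith
      qed
      then show ?thesis unfolding lX_def using X2 by (intro ln_mono) auto
    qed
    also have "\<dots> = ln 2 + 2 * LL" using N by (simp add: ln_mult LL_def)
    finally show "lX \<le> 3 * LL" using LL by linarith
  qed
  have Epos: "0 \<le> E1" "0 \<le> E2" "0 \<le> E3" by (auto simp: E1_def E2_def E3_def)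
  have E: "E1 \<le> E" "E2 \<le> E" "E3 \<le> E" "0 \<le> E" using Epos by (auto simp: E_def)
  have PE: "0 \<le> P * E" using P2 E by simp
  have main: "norm (weighted_sum 1 \<alpha> m b N) \<le> 20000 * (P * E) * LL ^ 4"
  proof (cases "N < q")
    case True
    have "1 \<le> E3"
    proof -
      have "1 = real N powr (- 1 / 2) * real N powr (1 / 2)" using N by (simp flip: powr_add)
      also have "\<dots> \<le> E3" unfolding E3_def using True by (intro mult_left_mono powr_mono2) auto
      finally show ?thesis .
    qed
    then have "1 \<le> E" using E by linarith
    have "norm (weighted_sum 1 \<alpha> m b N) \<le> real N * lX"
      unfolding lX_def X_def by (rule norm_weighted_sum_trivial) (use m in auto)
    also have "\<dots> \<le> P * (3 * (8 * LL ^ 4))" using NP lX L4 by (intro mult_mono) auto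
    also have "\<dots> \<le> (P * E) * (24 * LL ^ 4)"
      using mult_right_mono[of "P * 1" "P * E" "24 * LL ^ 4"] mult_left_mono[OF \<open>1 \<le> E\<close>, of P] P2 by simp
    also have "\<dots> \<le> 20000 * (P * E) * LL ^ 4" using E P2 LL by (simp add: algebra_simps)
    finally show ?thesis .
  next
    case False
    then have qN: "q \<le> N" by simp
    have lq: "0 \<le> ln (real q)" "ln (real q) \<le> LL" using q qN by (auto simp: LL_def)
    define x where "x = real X powr (2 / 5)"
    define U where "U = nat \<lfloor>x\<rfloor>"
    have x1: "1 \<le> x" unfolding x_def using X2 by (intro ge_one_powr_ge_zero) auto
    have U12: "1 \<le> U" "real U \<le> x" "x < real U + 1" using x1 unfolding U_def by linarith+
    then have U: "1 \<le> U" "real U \<le> x" "x \<le> 2 * real U" by linarith+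
    have X45: "real X powr (4 / 5) \<le> 2 * (P * E2)"
    proof -
      have "real X powr (4 / 5) \<le> (2 * P) powr (4 / 5)" using XP by (intro powr_mono2) auto
      also have "\<dots> = 2 powr (4 / 5) * P powr (4 / 5)" using P2 by (simp add: powr_mult)
      also have "2 powr (4 / 5) \<le> 2 powr (1 :: real)" by (rule powr_mono) auto
      also have "P powr (4 / 5) = P * E2"
        using P2 powr_add[of P 1 "- 1 / 5"] by (simp add: E2_def)
      finally show ?thesis using P2 Epos by (simp add: mult_right_mono)
    qed
    have xx: "x\<^sup>2 = real X powr (4 / 5)" using X2 by (simp add: x_def power2_eq_square flip: powr_add)
    have PE2: "P * E2 \<le> P * E" using E P2 by (intro mult_left_mono) auto
    have X45': "real X powr (4 / 5) \<le> 2 * (P * E)" using X45 PE2 by linarith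
    have one: "1 \<le> 2 * (P * E)"
      using X45' ge_one_powr_ge_zero[of "real X" "4 / 5"] X2 by simp
    have xPE: "x \<le> 2 * (P * E)"
    proof -
      have "x \<le> real X powr (4 / 5)" unfolding x_def using X2 by (intro powr_mono) auto
      with X45' show ?thesis by linarith
    qed
    have U2: "real (U\<^sup>2) \<le> 2 * (P * E)"
      using X45' power_mono[OF U(2), of 2] xx by simp
    have U2X: "U\<^sup>2 \<le> X"
    proof -
      have "real (U\<^sup>2) \<le> real X powr (4 / 5)"
        using power_mono[OF U(2), of 2] xx by simp
      also have "\<dots> \<le> real X powr 1" using X2 by (intro powr_mono) auto
      finally have "real (U\<^sup>2) \<le> real X" using X2 by simp
      then show ?thesis by (simp only: of_nat_le_iff)
    qed
    have UU: "U \<le> U\<^sup>2" using U by (simp add: power2_eq_square)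
    have UX: "U \<le> X" using UU U2X by linarith
    have sX: "sqrt (real X) \<le> 2 * (P * E)"
      using X45' powr_mono[of "1 / 2" "4 / 5" "real X"] X2 by (simp add: powr_half_sqrt)

    define F where "F = (\<lambda>n. if [n = b] (mod m) then e2pi (\<alpha> 1 * ((real n - real b) / real m)) else 0)"
    have Fn: "norm (F n) \<le> 1" for n by (simp add: F_def)
    have F_eq: "F n = (if [n = b] (mod m) then e2pi (\<alpha> 1 * ((real n - real b) / real m)) else 0)" for n
      by (simp add: F_def)
    \<comment> \<open>The rounding term 1 in the length of a progression is absorbed here: it is at
      most U ^ 2 / r for r \<le> U ^ 2.\<close>
    define Y where "Y = real X / real m + real (U\<^sup>2)"
    have Y0: "0 \<le> Y" by (simp add: Y_def)
    define M where "M = (\<lambda>r::nat. wmin (Y / real r) (\<alpha> 1 * real r))"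
    have M0: "0 \<le> M r" for r unfolding M_def using Y0 by (intro wmin_nonneg) simp
    have MI: "norm (\<Sum>l=i..j. F (r * l)) \<le> M r" if "1 \<le> r" "r \<le> U\<^sup>2" "1 \<le> i" "j * r \<le> X" for r i j
      unfolding M_def
    proof (rule norm_linear_progression_le[OF m(1,4) F_eq])
      have "1 \<le> real (U\<^sup>2) / real r" using that by (simp del: of_nat_power)
      then show "real X / (real r * real m) + 1 \<le> Y / real r"
        by (simp add: Y_def add_divide_distrib mult.commute del: of_nat_power)
    qed (use that in auto)
    define S1 where "S1 = (\<Sum>r=1..U\<^sup>2. M r)"
    have S1: "S1 \<le> 192 * (P * E) * LL"
    proof -
      have "S1 \<le> 8 * (Y / real q + real (U\<^sup>2) + real q) * (1 + ln (real q) + ln (real (U\<^sup>2)))"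
        unfolding S1_def M_def by (rule sum_wmin_hyperbola[OF \<alpha> Y0]) (use U UU in linarith)
      also have "\<dots> \<le> 8 * (4 * (P * E)) * (6 * LL)"
      proof (intro mult_mono mult_left_mono)
        have "real X / real m \<le> 2 * real N" using XP(2) m by (simp add: P_def pos_divide_le_eq)
        then have "real X / real m / real q \<le> 2 * real N / real q" by (rule divide_right_mono) simp
        moreover have "real (U\<^sup>2) / real q \<le> real (U\<^sup>2)" using q by (simp add: divide_le_eq mult_le_cancel_left1 del: of_nat_power)
        ultimately have "Y / real q + real (U\<^sup>2) + real q \<le> 2 * real N / real q + 2 * real (U\<^sup>2) + real q"
          by (simp add: Y_def add_divide_distrib del: of_nat_power)
        moreover have "real N / real q \<le> P * E1"
        proof -
          have "real q powr (- 1) \<le> E1" unfolding E1_def using q by (intro powr_mono) auto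
          then have "1 / real q \<le> E1" using q by (simp add: powr_minus_divide)
          then have "real N * (1 / real q) \<le> P * E1" using NP P2 by (intro mult_mono) auto
          then show ?thesis by simp
        qed
        moreover have "real q \<le> P * E3"
        proof -
          have "real q = real q powr (1 / 2) * real q powr (1 / 2)" using q by (simp flip: powr_add)
          also have "\<dots> \<le> real N powr (1 / 2) * real q powr (1 / 2)"
            using qN by (intro mult_right_mono powr_mono2) auto
          also have "real N powr (1 / 2) = real N * real N powr (- 1 / 2)"
            using N powr_add[of "real N" 1 "- 1 / 2"] by simp
          also have "real N * real N powr (- 1 / 2) * real q powr (1 / 2) \<le> P * real N powr (- 1 / 2) * real q powr (1 / 2)"
            using NP by (intro mult_right_mono) auto
          finally show ?thesis by (simp add: E3_def mult.assoc)
        qed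
        moreover have "real (U\<^sup>2) \<le> 2 * (P * E2)" using X45 power_mono[OF U(2), of 2] xx by simp
        moreover have "P * E = P * E1 + P * E2 + P * E3" by (simp add: E_def algebra_simps)
        moreover have "0 \<le> P * E1" "0 \<le> P * E3" using Epos P2 by auto
        ultimately show "Y / real q + real (U\<^sup>2) + real q \<le> 4 * (P * E)" by linarith
        have "ln (real (U\<^sup>2)) \<le> lX" unfolding lX_def using U2X U by (intro ln_mono) (auto simp del: of_nat_power)
        then show "1 + ln (real q) + ln (real (U\<^sup>2)) \<le> 6 * LL" using lq lX LL by linarith
        show "0 \<le> 1 + ln (real q) + ln (real (U\<^sup>2))"
          using lq U UU by (intro add_nonneg_nonneg) (auto simp del: of_nat_power)
      qed (use P2 E Y0 in auto)
      finally show ?thesis by simp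
    qed
    let ?T3 = "\<Sum>r=1..U\<^sup>2. of_real (vaughan_w U r) * (\<Sum>l=1..X div r. F (r * l))"
    let ?t = "\<lambda>k. of_real (vaughan_c U k) * (\<Sum>l=1..X div k. of_real (beyond U mangoldt l) * F (k * l))"
    have V: "norm (\<Sum>n=1..X. of_real (mangoldt n) * F n) \<le>
      real U * lX + lX * (\<Sum>r=1..U. M r) + norm ?T3 + norm (\<Sum>k=1..X. ?t k)"
      unfolding lX_def by (rule vaughan_inequality[OF Fn U(1) UX MI]) (use UU in auto)
    have S1': "(\<Sum>r=1..U. M r) \<le> S1" unfolding S1_def using UU M0 by (intro sum_mono2) auto
    have T3: "norm ?T3 \<le> lX * S1"
    proof -
      have "norm ?T3 \<le> (\<Sum>r=1..U\<^sup>2. lX * M r)"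
      proof (rule sum_norm_le)
        fix r assume r: "r \<in> {1..U\<^sup>2}"
        have w: "\<bar>vaughan_w U r\<bar> \<le> lX"
        proof -
          have "\<bar>vaughan_w U r\<bar> \<le> ln (real r)" using r by (intro abs_vaughan_w_le) auto
          also have "\<dots> \<le> lX" unfolding lX_def using r U2X by (intro ln_mono) auto
          finally show ?thesis .
        qed
        show "norm (of_real (vaughan_w U r) * (\<Sum>l=1..X div r. F (r * l))) \<le> lX * M r"
          unfolding norm_mult norm_of_real using r w lX by (intro mult_mono MI) auto
      qed
      then show ?thesis by (simp add: S1_def sum_distrib_left)
    qed
    \<comment> \<open>Under the root there are three logarithms from the mean square of the divisor
      function, two from the von Mangoldt weights and one from 1 + ln q, hence LL ^ 3; the number of
      dyadic blocks supplies the fourth. The root of 3888 * 112 is below 660, and X \<le> 2 P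
      doubles it.\<close>
    define Bd where "Bd = 1320 * LL ^ 3 * (P * E)"
    have Bd0: "0 \<le> Bd" unfolding Bd_def using LL P2 E by (intro mult_nonneg_nonneg) auto
    have T4: "norm (\<Sum>k=1..X. ?t k) \<le> (2 * ln (real X) + 1) * Bd"
    proof (rule norm_dyadic_sum_le)
      show "1 \<le> X" using X2 by simp
      show "?t k = 0" if "X < k" for k using that by simp
      show "0 \<le> Bd" by (rule Bd0)
      fix i assume iX: "2 ^ i \<le> X"
      define K where "K = (2::nat) ^ i"
      define L where "L = X div K"
      have K1: "1 \<le> K" "K \<le> X" using iX by (auto simp: K_def)
      have "norm (\<Sum>k\<in>{K..<2 * K}. ?t k) \<le> Bd"
      \<comment> \<open>The coefficients vanish unless k > U and l > U, so a block contributes only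
        if both ranges reach beyond U.\<close>
      proof (cases "2 * K \<le> U \<or> L \<le> U")
        case True
        have "(\<Sum>k\<in>{K..<2 * K}. ?t k) = 0"
        proof (rule sum.neutral, rule ballI)
          fix k assume k: "k \<in> {K..<2 * K}"
          show "?t k = 0"
          proof (cases "2 * K \<le> U")
            case True
            then have "vaughan_c U k = 0" using k K1 by (intro vaughan_c_eq_0) auto
            then show ?thesis by simp
          next
            case False
            then have LU: "L \<le> U" using \<open>2 * K \<le> U \<or> L \<le> U\<close> by simp
            have "X div k \<le> L" unfolding L_def using k K1 by (intro div_le_mono2) auto
            then have "(\<Sum>l=1..X div k. of_real (beyond U mangoldt l) * F (k * l)) = 0"
              using LU by (intro sum.neutral) (auto simp: beyond_def)
            then show ?thesis by simp
          qed
        qed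
        then show ?thesis using Bd0 by simp
      next
        case False
        then have KU: "U < 2 * K" and LU: "U < L" by auto
        define kr where "kr = real K"
        define l where "l = real L"
        define xr where "xr = real X"
        define u where "u = real U"
        have pos: "0 < kr" "0 < l" "0 < xr" "0 < u" "0 < real q"
          using K1 LU X2 U q by (auto simp: kr_def l_def xr_def u_def)
        have kl: "kr * l \<le> xr" by (simp add: kr_def l_def xr_def L_def flip: of_nat_mult)
        have ku: "u \<le> 2 * kr" using KU by (simp add: u_def kr_def)
        have lu: "u \<le> l" using LU by (simp add: u_def l_def)
        have "(norm (\<Sum>k\<in>{K..<2 * K}. ?t k))\<^sup>2 \<le> (\<Sum>k\<in>{K..<2 * K}. (vaughan_c U k)\<^sup>2) * (lX\<^sup>2 * (real (X div K) * ((2 * real (X div K) / real q + 1)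
          * (2 * (real K / real m + 1) + 4 * real q * (1 + ln (real q))))))"
        proof (rule bilinear_linear_phase[OF m(1,4) F_eq \<alpha> K1(1)])
          fix l assume l: "l \<le> X"
          show "\<bar>beyond U mangoldt l\<bar> \<le> lX"
          proof (cases "0 < l")
            case True
            then have "mangoldt l \<le> ln (real l)" by (rule mangoldt_le)
            also have "\<dots> \<le> lX" unfolding lX_def using True l by (intro ln_mono) auto
            finally show ?thesis using lX by (simp add: beyond_def)
          qed (use lX in \<open>simp add: beyond_def\<close>)
        qed
        also have "\<dots> \<le> (2 * kr * (6 * LL) ^ 3) * ((3 * LL)\<^sup>2 * (l * ((2 * l / real q + 1) * (LL * (8 * kr + 12 * real q)))))"
        proof (intro mult_mono mult_left_mono)
          have "(\<Sum>k\<in>{K..<2 * K}. (vaughan_c U k)\<^sup>2) \<le> (\<Sum>k=1..2 * K. (real (tau k))\<^sup>2)"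
          proof -
            have "(\<Sum>k\<in>{K..<2 * K}. (vaughan_c U k)\<^sup>2) \<le> (\<Sum>k\<in>{K..<2 * K}. (real (tau k))\<^sup>2)"
              using K1 by (intro sum_mono) (auto intro!: power2_le_iff_abs_le[THEN iffD2] abs_vaughan_c_le)
            also have "\<dots> \<le> (\<Sum>k=1..2 * K. (real (tau k))\<^sup>2)" using K1 by (intro sum_mono2) auto
            finally show ?thesis .
          qed
          also have "\<dots> \<le> real (2 * K) * (1 + ln (real (2 * K))) ^ 3"
            using K1 by (intro sum_tau_squared_le) simp
          also have "\<dots> \<le> real (2 * K) * (6 * LL) ^ 3"
          proof (intro mult_left_mono power_mono)
            have "ln (real (2 * K)) = ln 2 + ln (real K)" using K1 by (simp add: ln_mult)
            also have "ln (real K) \<le> lX" unfolding lX_def using K1 by (intro ln_mono) auto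
            finally show "1 + ln (real (2 * K)) \<le> 6 * LL" using LL lX by linarith
            show "0 \<le> 1 + ln (real (2 * K))" using K1 by (intro add_nonneg_nonneg ln_ge_zero) auto
          qed simp
          finally show "(\<Sum>k\<in>{K..<2 * K}. (vaughan_c U k)\<^sup>2) \<le> 2 * kr * (6 * LL) ^ 3" by (simp add: kr_def)
          show "lX\<^sup>2 \<le> (3 * LL)\<^sup>2" using lX by (intro power_mono) auto
          show "2 * (real K / real m + 1) + 4 * real q * (1 + ln (real q)) \<le> LL * (8 * kr + 12 * real q)"
          proof -
            have "real K / real m \<le> kr" using m by (simp add: kr_def divide_le_eq mult_le_cancel_left1)
            moreover have "1 \<le> kr" using K1 by (simp add: kr_def)
            ultimately have "real K / real m + 1 \<le> 2 * kr" by linarith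
            then have "2 * (real K / real m + 1) \<le> 4 * kr" using mult_left_mono[of _ "2 * kr" 2] by simp
            also have "4 * kr \<le> LL * (8 * kr)" using LL pos mult_right_mono[of "1 / 2" LL "8 * kr"] by simp
            finally have "2 * (real K / real m + 1) \<le> LL * (8 * kr)" .
            moreover have "4 * real q * (1 + ln (real q)) \<le> 4 * real q * (3 * LL)"
              using lq LL by (intro mult_left_mono) auto
            then have "4 * real q * (1 + ln (real q)) \<le> LL * (12 * real q)" by (simp add: mult_ac)
            ultimately show ?thesis unfolding distrib_left[of LL] by (rule add_mono)
          qed
        qed (use lq LL pos lX in \<open>auto simp: l_def L_def kr_def intro!: add_nonneg_nonneg mult_nonneg_nonneg\<close>)
        also have "\<dots> = 3888 * LL ^ 6 * (kr * l * ((2 * l / real q + 1) * (8 * kr + 12 * real q)))"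
          by (simp add: power_mult_distrib) (simp add: eval_nat_numeral)
        also have "kr * l * ((2 * l / real q + 1) * (8 * kr + 12 * real q))
            = 16 * ((kr * l) * (kr * l)) / real q + 24 * ((kr * l) * l) + 8 * ((kr * l) * kr) + 12 * ((kr * l) * real q)"
          using pos by (simp add: field_simps)
        also have "3888 * LL ^ 6 * \<dots> \<le> 3888 * LL ^ 6 * (16 * (xr * xr) / real q + 24 * (xr * (2 * xr / u)) + 8 * (xr * (xr / u)) + 12 * (xr * real q))"
        proof -
          \<comment> \<open>Each of the two lengths is at most of order X / U because the other one
            exceeds U, up to a factor 2 for the dyadic one.\<close>
          have k2: "kr \<le> xr / u"
          proof -
            have "kr * u \<le> kr * l" using lu pos by (intro mult_left_mono) auto
            with kl have "kr * u \<le> xr" by linarith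
            then show ?thesis using pos by (simp add: pos_le_divide_eq)
          qed
          have l2: "l \<le> 2 * xr / u"
          proof -
            have "l * u \<le> l * (2 * kr)" using ku pos by (intro mult_left_mono) auto
            also have "\<dots> = 2 * (kr * l)" by simp
            finally have "l * u \<le> 2 * xr" using kl by linarith
            then show ?thesis using pos by (simp add: pos_le_divide_eq)
          qed
          have a1: "(kr * l) * (kr * l) \<le> xr * xr" using kl pos by (intro mult_mono) auto
          have a2: "(kr * l) * l \<le> xr * (2 * xr / u)" using kl pos l2 by (intro mult_mono) auto
          have a3: "(kr * l) * kr \<le> xr * (xr / u)" using kl pos k2 by (intro mult_mono) auto
          have a4: "(kr * l) * real q \<le> xr * real q" using kl by (intro mult_right_mono) auto
          have a1': "16 * ((kr * l) * (kr * l)) / real q \<le> 16 * (xr * xr) / real q"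
            using a1 pos by (intro divide_right_mono) auto
          show ?thesis using a1' a2 a3 a4 LL by (intro mult_left_mono) auto
        qed
        also have "16 * (xr * xr) / real q + 24 * (xr * (2 * xr / u)) + 8 * (xr * (xr / u)) + 12 * (xr * real q)
           = xr\<^sup>2 * (16 * (1 / real q) + 56 * (1 / u) + 12 * (real q / xr))"
          using pos by (simp add: field_simps power2_eq_square)
        also have "3888 * LL ^ 6 * (xr\<^sup>2 * (16 * (1 / real q) + 56 * (1 / u) + 12 * (real q / xr)))
            \<le> 3888 * LL ^ 6 * (xr\<^sup>2 * (112 * E\<^sup>2))"
        proof -
          have e1: "1 / real q = E1\<^sup>2" using q by (simp add: E1_def power2_eq_square powr_minus_divide flip: powr_add)
          have e2: "1 / u \<le> 2 * E2\<^sup>2"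
          proof -
            have "1 / u \<le> 1 / (x / 2)" using U x1 pos by (intro divide_left_mono) (auto simp: u_def)
            also have "\<dots> = 2 * real X powr (- 2 / 5)" by (simp add: x_def powr_minus_divide)
            also have "real X powr (- 2 / 5) \<le> P powr (- 2 / 5)" using XP P2 by (intro powr_mono2') auto
            also have "P powr (- 2 / 5) = E2\<^sup>2" by (simp add: E2_def power2_eq_square flip: powr_add)
            finally show ?thesis by simp
          qed
          have e3: "real q / xr \<le> E3\<^sup>2"
          proof -
            have "real q / xr \<le> real q / real N" using XP NP N pos by (intro divide_left_mono) (auto simp: xr_def)
            also have "\<dots> = E3\<^sup>2"
              using N q by (simp add: E3_def power_mult_distrib power2_eq_square powr_minus_divide flip: powr_add)
            finally show ?thesis .
          qed
          have "E1\<^sup>2 + E2\<^sup>2 + E3\<^sup>2 \<le> E1\<^sup>2 + E2\<^sup>2 + E3\<^sup>2 + 2 * (E1 * E2 + E1 * E3 + E2 * E3)"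
            using Epos by simp
          also have "\<dots> = E\<^sup>2" by (simp add: E_def power2_eq_square algebra_simps)
          finally have "E1\<^sup>2 + E2\<^sup>2 + E3\<^sup>2 \<le> E\<^sup>2" .
          then have "112 * (E1\<^sup>2 + E2\<^sup>2 + E3\<^sup>2) \<le> 112 * E\<^sup>2" by simp
          moreover have "16 * (1 / real q) + 56 * (1 / u) + 12 * (real q / xr) \<le> 16 * E1\<^sup>2 + 112 * E2\<^sup>2 + 12 * E3\<^sup>2"
            using e1 e2 e3 by linarith
          moreover have "16 * E1\<^sup>2 + 112 * E2\<^sup>2 + 12 * E3\<^sup>2 \<le> 112 * (E1\<^sup>2 + E2\<^sup>2 + E3\<^sup>2)"
            by simp
          ultimately have "16 * (1 / real q) + 56 * (1 / u) + 12 * (real q / xr) \<le> 112 * E\<^sup>2" by linarith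
          then show ?thesis using LL by (intro mult_left_mono) auto
        qed
        also have "\<dots> \<le> (660 * LL ^ 3 * xr * E)\<^sup>2"
          by (simp add: power_mult_distrib flip: power_mult)
        finally have "norm (\<Sum>k\<in>{K..<2 * K}. ?t k) \<le> 660 * LL ^ 3 * xr * E"
          by (rule power2_le_imp_le) (use LL E pos in auto)
        also have "\<dots> \<le> 660 * LL ^ 3 * (2 * P) * E"
          using XP E LL by (intro mult_right_mono mult_left_mono) (auto simp: xr_def)
        finally show ?thesis by (simp add: Bd_def)
      qed
      then show "norm (\<Sum>k\<in>{2 ^ i..<2 * 2 ^ i}. ?t k) \<le> Bd" by (simp add: K_def)
    qed
    have "norm (weighted_sum 1 \<alpha> m b N) \<le> norm (\<Sum>n=1..X. of_real (mangoldt n) * F n)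
           + 2 * sqrt (real X) * (ln (real X))\<^sup>2 + ln (real X)"
    proof (rule norm_weighted_sum_le_mangoldt[OF m(1,3) X_def])
      fix n
      have "[m * n + b = b] (mod m)" by (simp add: cong_def)
      then show "F (m * n + b) = e2pi (phase 1 \<alpha> (real n))" using m by (simp add: F_def phase_def)
    qed (use N Fn in \<open>auto simp: F_def\<close>)
    moreover have "real U * lX \<le> 48 * (P * E) * LL ^ 4"
    proof -
      have "real U * lX \<le> (2 * (P * E)) * (3 * (8 * LL ^ 4))" using U xPE lX L4 by (intro mult_mono) auto
      then show ?thesis by simp
    qed
    moreover have "lX * S1 \<le> 2304 * (P * E) * LL ^ 4"
    proof -
      have "lX * S1 \<le> (3 * LL) * (192 * (P * E) * LL)"
        using lX S1 M0 by (intro mult_mono) (auto simp: S1_def intro: sum_nonneg)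
      also have "\<dots> = 576 * (P * E) * LL\<^sup>2" by (simp add: power2_eq_square)
      also have "\<dots> \<le> 576 * (P * E) * (4 * LL ^ 4)" using L4 PE by (intro mult_left_mono) auto
      finally show ?thesis by simp
    qed
    moreover have "lX * (\<Sum>r=1..U. M r) \<le> lX * S1" using S1' lX by (intro mult_left_mono) auto
    moreover have "(2 * ln (real X) + 1) * Bd \<le> 10560 * (P * E) * LL ^ 4"
    proof -
      have "(2 * ln (real X) + 1) * Bd \<le> (8 * LL) * Bd"
        using lX LL Bd0 by (intro mult_right_mono) (auto simp: lX_def)
      also have "\<dots> = 10560 * (P * E) * LL ^ 4" by (simp add: Bd_def eval_nat_numeral)
      finally show ?thesis .
    qed
    moreover have "2 * sqrt (real X) * (ln (real X))\<^sup>2 \<le> 144 * (P * E) * LL ^ 4"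
    proof -
      have "2 * sqrt (real X) * lX\<^sup>2 \<le> 2 * (2 * (P * E)) * (3 * LL)\<^sup>2"
        using sX lX PE by (intro mult_mono power_mono) auto
      also have "\<dots> = 36 * (P * E) * LL\<^sup>2" by (simp add: power_mult_distrib)
      also have "\<dots> \<le> 36 * (P * E) * (4 * LL ^ 4)" using L4 PE by (intro mult_left_mono) auto
      finally show ?thesis by (simp add: lX_def)
    qed
    moreover have "ln (real X) \<le> 48 * (P * E) * LL ^ 4"
    proof -
      have "1 * lX \<le> (2 * (P * E)) * (3 * (8 * LL ^ 4))" using one lX L4 by (intro mult_mono) auto
      then show ?thesis by (simp add: lX_def)
    qed
    moreover have "0 \<le> (P * E) * LL ^ 4" using PE LL by simp
    ultimately show ?thesis using V T3 T4 by linarith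
  qed
  then show ?thesis by (simp add: P_def E_def E1_def E2_def E3_def LL_def mult_ac)
qed

section \<open>The divisor bound\<close>

lemma tau_prime_power_mult_le:
  assumes p: "prime (p::nat)" and n: "0 < n"
  shows "tau (p ^ a * n) \<le> (a + 1) * tau n"
proof -
  have "{d. d dvd p ^ a * n} \<subseteq> (\<lambda>(i, e). p ^ i * e) ` ({..a} \<times> {e. e dvd n})"
  proof
    fix d assume "d \<in> {d. d dvd p ^ a * n}"
    then obtain b c where bc: "d = b * c" "b dvd p ^ a" "c dvd n"
      using division_decomp[of d "p ^ a" n] by blast
    obtain i where i: "i \<le> a" "b = p ^ i" using bc(2) divides_primepow_nat[OF p] by blast
    have "(i, c) \<in> {..a} \<times> {e. e dvd n}" using i bc by simp
    then have "(\<lambda>(i, e). p ^ i * e) (i, c) \<in> (\<lambda>(i, e). p ^ i * e) ` ({..a} \<times> {e. e dvd n})" by (rule imageI)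
    then show "d \<in> (\<lambda>(i, e). p ^ i * e) ` ({..a} \<times> {e. e dvd n})" by (simp only: bc(1) i(2) prod.case)
  qed
  then have "tau (p ^ a * n) \<le> card ((\<lambda>(i, e). p ^ i * e) ` ({..a} \<times> {e. e dvd n}))"
    unfolding tau_def using n by (intro card_mono) auto
  also have "\<dots> \<le> card ({..a} \<times> {e. e dvd n})" using n by (intro card_image_le) auto
  finally show ?thesis by (simp add: tau_def card_cartesian_product)
qed

text \<open>If p \<ge> 2 powr (1 / \<epsilon>), the factor a + 1 \<le> 2 ^ a of the divisor number
  is at most (p ^ a) powr \<epsilon>; each of the at most Q smaller primes costs a factor A. The
  induction strips off one full prime power at a time, and the exponent of A counts the small primes
  that divide n.\<close>

lemma tau_le_powr:
  fixes \<epsilon> :: real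
  assumes \<epsilon>: "0 < \<epsilon>"
  shows "\<exists>C\<ge>1. \<forall>n\<ge>1. real (tau n) \<le> C * real n powr \<epsilon>"
proof -
  \<comment> \<open>Chosen such that A \<epsilon> ln 2 \<ge> 1, whence 1 + a \<le> A (1 + a
    \<epsilon> ln 2) \<le> A * 2 powr (a \<epsilon>).\<close>
  define A where "A = max 1 (1 / (\<epsilon> * ln 2))"
  define Q where "Q = nat \<lceil>2 powr (1 / \<epsilon>)\<rceil>"
  have A1: "1 \<le> A" by (simp add: A_def)
  have pp: "real (a + 1) \<le> (if p < Q then A else 1) * real (p ^ a) powr \<epsilon>" if p: "2 \<le> p" for p a :: nat
  proof (cases "p < Q")
    case True
    have "1 \<le> A * (\<epsilon> * ln 2)" using \<epsilon> by (simp add: A_def max_def field_simps)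
    then have "real a * 1 \<le> real a * (A * (\<epsilon> * ln 2))" by (intro mult_left_mono) auto
    then have "real (a + 1) \<le> A * (1 + real a * \<epsilon> * ln 2)" using A1 by (simp add: algebra_simps)
    also have "\<dots> \<le> A * exp (real a * \<epsilon> * ln 2)" using A1 by (intro mult_left_mono exp_ge_add_one_self) auto
    also have "exp (real a * \<epsilon> * ln 2) = (2 powr real a) powr \<epsilon>" by (simp add: powr_def mult_ac)
    also have "\<dots> \<le> real (p ^ a) powr \<epsilon>"
    proof (intro powr_mono2)
      have "(2::real) ^ a \<le> real p ^ a" using p by (intro power_mono) auto
      then show "2 powr real a \<le> real (p ^ a)" by (simp add: powr_realpow)
    qed (use \<epsilon> in auto)
    finally show ?thesis using True A1 by simp
  next
    case False
    have "2 powr (1 / \<epsilon>) \<le> real p" using False unfolding Q_def by linarith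
    then have "(2 powr (1 / \<epsilon>)) powr \<epsilon> \<le> real p powr \<epsilon>" using \<epsilon> by (intro powr_mono2) auto
    then have 2: "2 \<le> real p powr \<epsilon>" using \<epsilon> by (simp add: powr_powr)
    have "a + 1 \<le> 2 ^ a" using Suc_leI[OF less_exp[of a]] by simp
    then have "real (a + 1) \<le> real (2 ^ a)" by (rule of_nat_mono)
    also have "real (2 ^ a) = 2 ^ a" by simp
    also have "(2::real) ^ a \<le> (real p powr \<epsilon>) ^ a" using 2 by (intro power_mono) auto
    also have "\<dots> = real (p ^ a) powr \<epsilon>"
      using p by (simp add: powr_powr mult.commute flip: powr_realpow)
    finally show ?thesis using False by simp
  qed
  have main: "real (tau n) \<le> A ^ card {p\<in>prime_factors n. p < Q} * real n powr \<epsilon>" if "1 \<le> n" for n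
    using that
  proof (induction n rule: less_induct)
    case (less n)
    show ?case
    proof (cases "n = 1")
      case False
      then obtain p where p: "prime p" "p dvd n" using prime_factor_nat by auto
      define a where "a = multiplicity p n"
      define n' where "n' = n div p ^ a"
      have n: "n = p ^ a * n'" by (simp add: n'_def a_def multiplicity_dvd)
      have n0: "0 < n'" using less.prems n by (auto intro!: Nat.gr0I)
      have np: "\<not> p dvd n'" unfolding n'_def a_def
        using p less.prems by (intro multiplicity_decompose) (auto simp: prime_elem_not_unit)
      have p2: "2 \<le> p" using p(1) by (rule prime_ge_2_nat)
      have a1: "a \<noteq> 0"
        using p p2 less.prems multiplicity_gt_zero_iff[of n p] unfolding a_def by auto
      have "1 < p ^ a" using p2 a1 by (intro one_less_power) auto
      then have "1 * n' < p ^ a * n'" using n0 by (rule mult_strict_right_mono)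
      then have lt: "n' < n" using n by simp
      have pf: "prime_factors n = insert p (prime_factors n')"
      proof -
        have "prime_factors n = prime_factors (p ^ a) \<union> prime_factors n'"
          unfolding n using n0 p2 by (intro prime_factors_product) auto
        also have "prime_factors (p ^ a) = {p}" using p(1) a1 by (simp add: prime_factors_power prime_prime_factors)
        finally show ?thesis by simp
      qed
      have pn: "p \<notin> prime_factors n'" using np by auto
      have "real (tau n) \<le> real ((a + 1) * tau n')"
        unfolding n by (rule of_nat_mono) (rule tau_prime_power_mult_le[OF p(1) n0])
      also have "\<dots> = real (a + 1) * real (tau n')" by (rule of_nat_mult)
      also have "\<dots> \<le> ((if p < Q then A else 1) * real (p ^ a) powr \<epsilon>) * (A ^ card {p\<in>prime_factors n'. p < Q} * real n' powr \<epsilon>)"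
        using A1 n0 lt by (intro mult_mono pp p2 less.IH) auto
      also have "\<dots> = ((if p < Q then A else 1) * A ^ card {p\<in>prime_factors n'. p < Q}) * real n powr \<epsilon>"
        unfolding n of_nat_mult by (subst powr_mult) (simp_all add: mult_ac)
      also have "(if p < Q then A else 1) * A ^ card {p\<in>prime_factors n'. p < Q} = A ^ card {p\<in>prime_factors n. p < Q}"
      proof (cases "p < Q")
        case True
        then have "{r\<in>prime_factors n. r < Q} = insert p {r\<in>prime_factors n'. r < Q}" using pf by auto
        then show ?thesis using True pn by simp
      next
        case False
        then have "{r\<in>prime_factors n. r < Q} = {r\<in>prime_factors n'. r < Q}" using pf by auto
        then show ?thesis using False by simp
      qed
      finally show ?thesis .
    qed (simp add: tau_def)
  qed
  show ?thesis
  proof (intro exI[of _ "A ^ Q"] conjI allI impI)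
    show "1 \<le> A ^ Q" using A1 by (rule one_le_power)
    fix n :: nat assume n: "1 \<le> n"
    have "card {p\<in>prime_factors n. p < Q} \<le> card {..<Q}" by (intro card_mono) auto
    then have "A ^ card {p\<in>prime_factors n. p < Q} \<le> A ^ Q" using A1 by (intro power_increasing) auto
    then show "real (tau n) \<le> A ^ Q * real n powr \<epsilon>"
      by (intro order_trans[OF main[OF n]] mult_right_mono) auto
  qed
qed

text \<open>Jensen's inequality for the power 2 ^ j, obtained from j applications of Cauchy-Schwarz.
  Exponents of this form are all that repeated squaring produces.\<close>

lemma power_mean_pow2:
  fixes x :: "'a \<Rightarrow> real"
  assumes nonneg: "\<And>i. i \<in> S \<Longrightarrow> 0 \<le> x i"
  shows "(\<Sum>i\<in>S. x i) ^ 2 ^ j \<le> real (card S) ^ (2 ^ j - 1) * (\<Sum>i\<in>S. x i ^ 2 ^ j)"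
proof (induction j)
  case (Suc j)
  have s: "(2::nat) ^ Suc j = 2 ^ j * 2" by simp
  have "(\<Sum>i\<in>S. x i) ^ 2 ^ Suc j = ((\<Sum>i\<in>S. x i) ^ 2 ^ j)\<^sup>2" unfolding s by (rule power_mult)
  also have "\<dots> \<le> (real (card S) ^ (2 ^ j - 1) * (\<Sum>i\<in>S. x i ^ 2 ^ j))\<^sup>2"
    using nonneg by (intro power_mono Suc.IH zero_le_power sum_nonneg)
  also have "\<dots> = (real (card S) ^ (2 ^ j - 1))\<^sup>2 * (\<Sum>i\<in>S. 1 * x i ^ 2 ^ j)\<^sup>2"
    by (simp add: power_mult_distrib)
  also have "\<dots> \<le> (real (card S) ^ (2 ^ j - 1))\<^sup>2 * ((\<Sum>i\<in>S. 1\<^sup>2) * (\<Sum>i\<in>S. (x i ^ 2 ^ j)\<^sup>2))"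
    by (intro mult_left_mono Cauchy_Schwarz_ineq_sum) simp
  also have "\<dots> = ((real (card S) ^ (2 ^ j - 1))\<^sup>2 * real (card S)) * (\<Sum>i\<in>S. x i ^ 2 ^ Suc j)"
    by (simp add: s mult.commute flip: power_mult)
  also have "(real (card S) ^ (2 ^ j - 1))\<^sup>2 * real (card S) = real (card S) ^ (2 ^ Suc j - 1)"
  proof -
    obtain t where "(2::nat) ^ j = Suc t" by (cases "(2::nat) ^ j") auto
    then have "(2 ^ j - 1) * 2 + 1 = 2 ^ Suc j - (1::nat)" by simp
    then have "real (card S) ^ (2 ^ Suc j - 1) = real (card S) ^ ((2 ^ j - 1) * 2 + 1)" by simp
    then show ?thesis by (simp only: power_add power_mult power_one_right)
  qed
  finally show ?case .
qed simp

section \<open>Weyl differencing\<close>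

definition shifts :: "nat \<Rightarrow> nat \<Rightarrow> int list set" where
  "shifts L j = {hs. set hs \<subseteq> {- int L..int L} \<and> length hs = j}"

lemma finite_shifts [simp]: "finite (shifts L j)"
  by (simp add: shifts_def finite_lists_length_eq)

lemma card_shifts: "card (shifts L j) = (2 * L + 1) ^ j"
proof -
  have "card {- int L..int L} = 2 * L + 1" by simp
  then show ?thesis unfolding shifts_def by (subst card_lists_length_eq) auto
qed

lemma shifts_0: "shifts L 0 = {[]}"
  by (auto simp: shifts_def)

lemma sum_shifts_Suc:
  "(\<Sum>hs\<in>shifts L (Suc j). f hs) = (\<Sum>h\<in>{- int L..int L}. \<Sum>hs\<in>shifts L j. f (h # hs))"
proof -
  have "(\<Sum>h\<in>{- int L..int L}. \<Sum>hs\<in>shifts L j. f (h # hs))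
      = (\<Sum>(h, hs)\<in>{- int L..int L} \<times> shifts L j. f (h # hs))"
    by (rule sum.cartesian_product)
  also have "\<dots> = (\<Sum>hs\<in>shifts L (Suc j). f hs)"
    by (rule sum.reindex_bij_witness[of _ "\<lambda>hs. (hd hs, tl hs)" "\<lambda>(h, hs). h # hs"])
       (auto simp: shifts_def length_Suc_conv)
  finally show ?thesis by simp
qed

text \<open>With x = 2 L + 1 the vectors having a zero entry number x ^ j - (x - 1) ^ j, and
  Bernoulli's inequality bounds their share by j / x. For them differencing yields no cancellation,
  so they must be rare.\<close>

lemma card_shifts_with_zero:
  "real (card {hs \<in> shifts L j. 0 \<in> set hs}) * real (2 * L + 1) \<le> real j * real (2 * L + 1) ^ j"
proof -
  have fin: "finite ({- int L..int L} - {0})" by simp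
  have c: "card ({- int L..int L} - {0}) = 2 * L" by simp
  have split: "shifts L j = {hs \<in> shifts L j. 0 \<in> set hs} \<union> {hs. set hs \<subseteq> {- int L..int L} - {0} \<and> length hs = j}"
    by (auto simp: shifts_def)
  have "card (shifts L j) = card {hs \<in> shifts L j. 0 \<in> set hs} + card {hs. set hs \<subseteq> {- int L..int L} - {0} \<and> length hs = j}"
    by (subst split, rule card_Un_disjoint) (auto intro: finite_subset[OF _ finite_shifts[of L j]] simp: shifts_def finite_lists_length_eq)
  then have "(2 * L + 1) ^ j = card {hs \<in> shifts L j. 0 \<in> set hs} + (2 * L) ^ j"
    using card_lists_length_eq[OF fin, of j] by (simp add: card_shifts c)
  then have "real ((2 * L + 1) ^ j) = real (card {hs \<in> shifts L j. 0 \<in> set hs} + (2 * L) ^ j)"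
    by (rule arg_cong[of _ _ real])
  then have "real (2 * L + 1) ^ j = real (card {hs \<in> shifts L j. 0 \<in> set hs}) + real (2 * L) ^ j"
    by (simp only: of_nat_add of_nat_power)
  then have eq: "real (card {hs \<in> shifts L j. 0 \<in> set hs}) = real (2 * L + 1) ^ j - real (2 * L) ^ j"
    by (rule eq_diff_eq[THEN iffD2, OF sym])
  define x where "x = real (2 * L + 1)"
  have x1: "1 \<le> x" by (simp add: x_def)
  have "1 + real j * (- (1 / x)) \<le> (1 + - (1 / x)) ^ j"
    using x1 by (intro Bernoulli_inequality) auto
  then have "x ^ j * (1 - real j / x) \<le> x ^ j * (1 - 1 / x) ^ j"
    using x1 by (intro mult_left_mono) auto
  also have "x ^ j * (1 - 1 / x) ^ j = (x - 1) ^ j"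
    using x1 by (simp add: field_simps flip: power_mult_distrib)
  finally have "(x ^ j - (x - 1) ^ j) * x \<le> (x ^ j * (real j / x)) * x"
    using x1 by (intro mult_right_mono) (auto simp: algebra_simps)
  also have "\<dots> = real j * x ^ j" using x1 by simp
  finally have "(x ^ j - (x - 1) ^ j) * x \<le> real j * x ^ j" .
  moreover have "x - 1 = real (2 * L)" by (simp add: x_def)
  ultimately show ?thesis unfolding eq x_def by simp
qed

text \<open>One step of Weyl differencing: the double sum for the squared norm is sorted by the
  difference g of its two variables.\<close>

lemma norm_sum_squared_shifts:
  fixes \<phi> :: "int \<Rightarrow> complex"
  assumes A: "finite A" "\<And>x y. x \<in> A \<Longrightarrow> y \<in> A \<Longrightarrow> \<bar>x - y\<bar> \<le> int D"
  shows "complex_of_real ((norm (\<Sum>x\<in>A. \<phi> x))\<^sup>2) = (\<Sum>g\<in>{- int D..int D}. \<Sum>x\<in>{x\<in>A. x + g \<in> A}. \<phi> (x + g) * cnj (\<phi> x))"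
proof -
  have "complex_of_real ((norm (\<Sum>x\<in>A. \<phi> x))\<^sup>2) = (\<Sum>x\<in>A. \<Sum>y\<in>A. \<phi> x * cnj (\<phi> y))"
    by (simp add: complex_norm_square sum_product del: of_real_power)
  also have "\<dots> = (\<Sum>(x, y)\<in>A \<times> A. \<phi> x * cnj (\<phi> y))" by (rule sum.cartesian_product)
  also have "\<dots> = (\<Sum>(g, x)\<in>(SIGMA g:{- int D..int D}. {x\<in>A. x + g \<in> A}). \<phi> (x + g) * cnj (\<phi> x))"
  proof (rule sum.reindex_bij_witness[of _ "\<lambda>(g, x). (x + g, x)" "\<lambda>(x, y). (x - y, y)"])
    fix p assume p: "p \<in> A \<times> A"
    obtain x y where xy: "p = (x, y)" "x \<in> A" "y \<in> A" using p by auto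
    have "\<bar>x - y\<bar> \<le> int D" using A(2) xy by auto
    then show "(case p of (x, y) \<Rightarrow> (x - y, y)) \<in> (SIGMA g:{- int D..int D}. {x\<in>A. x + g \<in> A})"
      using xy by auto
  qed auto
  also have "\<dots> = (\<Sum>g\<in>{- int D..int D}. \<Sum>x\<in>{x\<in>A. x + g \<in> A}. \<phi> (x + g) * cnj (\<phi> x))"
    using A(1) by (intro sum.Sigma[symmetric]) auto
  finally show ?thesis .
qed

section \<open>Differences of polynomials and Weyl's inequality\<close>

definition pdiff :: "int \<Rightarrow> real poly \<Rightarrow> real poly" where
  "pdiff h p = pcompose p [:of_int h, 1:] - p"

lemma poly_pdiff [simp]: "poly (pdiff h p) x = poly p (x + of_int h) - poly p x"
  by (simp add: pdiff_def poly_pcompose add.commute)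

text \<open>The difference of x * p(x) is x times the difference of p plus h * p(x + h), and p(x +
  h) is p plus its difference. This drives the induction for the leading coefficient.\<close>

lemma pdiff_pCons:
  "pdiff h (pCons a p) = pCons 0 (pdiff h p) + smult (of_int h) (pdiff h p) + smult (of_int h) p"
  by (rule poly_ext) (simp add: algebra_simps)

lemma pdiff_degree_coeff:
  "degree p \<le> Suc n \<Longrightarrow> degree (pdiff h p) \<le> n \<and> coeff (pdiff h p) n = real (Suc n) * of_int h * coeff p (Suc n)"
proof (induction n arbitrary: p)
  case 0
  obtain a p' where p: "p = pCons a p'" by (cases p) auto
  have "degree p' = 0" using 0 p by (cases "p' = 0") auto
  then obtain c where c: "p' = [:c:]" by (rule degree_eq_zeroE)
  have "pdiff h p' = 0" by (simp add: c pdiff_def)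
  then have "pdiff h p = [:of_int h * c:]" by (simp add: p pdiff_pCons c)
  then show ?case by (simp add: p c)
next
  case (Suc n)
  obtain a p' where p: "p = pCons a p'" by (cases p) auto
  have d': "degree p' \<le> Suc n" using Suc.prems p by (cases "p' = 0") auto
  note IH = Suc.IH[OF d']
  have z: "coeff (pdiff h p') (Suc n) = 0" using IH by (intro coeff_eq_0) auto
  have d1: "degree (pCons 0 (pdiff h p')) \<le> Suc n" using IH by (cases "pdiff h p' = 0") auto
  have d2: "degree (smult (of_int h) (pdiff h p')) \<le> Suc n" using IH degree_smult_le[of "of_int h" "pdiff h p'"] by linarith
  have d3: "degree (smult (of_int h) p') \<le> Suc n" using d' degree_smult_le[of "of_int h" p'] by linarith
  have "degree (pdiff h p) \<le> Suc n" unfolding p pdiff_pCons by (intro degree_add_le d1 d2 d3)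
  moreover have "coeff (pdiff h p) (Suc n) = real (Suc (Suc n)) * of_int h * coeff p (Suc (Suc n))"
    unfolding p pdiff_pCons using IH z by (simp add: algebra_simps)
  ultimately show ?case by simp
qed

lemma two_power_ge_Suc: "Suc j \<le> 2 ^ j"
  by (rule Suc_leI[OF less_exp])

text \<open>Each round replaces the interval by its overlap with a translate, again an interval of
  at most D integers, and lowers the degree by one; after j rounds a geometric sum is left. The
  exponent of 2 D + 1 obeys (2 ^ j - 1) + (2 ^ j - Suc j) = 2 ^ Suc j - Suc (Suc j), where the first
  summand comes from the power mean over the new shift.\<close>

lemma weyl_inequality:
  fixes p :: "real poly" and lo hi :: int
  assumes "degree p \<le> Suc j" "hi - lo < int D"
  shows "norm (\<Sum>d\<in>{lo..hi}. e2pi (poly p (of_int d))) ^ 2 ^ j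
     \<le> real (2 * D + 1) ^ (2 ^ j - Suc j) * (\<Sum>gs\<in>shifts D j. wmin (real D) (fact (Suc j) * of_int (prod_list gs) * coeff p (Suc j)))"
  using assms
proof (induction j arbitrary: p lo hi)
  case 0
  obtain a p' where p: "p = pCons a p'" by (cases p) auto
  have "degree p' = 0" using 0 p by (cases "p' = 0") auto
  then obtain c where c: "p' = [:c:]" by (rule degree_eq_zeroE)
  have "norm (\<Sum>d\<in>{lo..hi}. e2pi (c * of_int d + a)) \<le> wmin (real D) c"
  proof (rule norm_linear_exp_sum)
    have "hi - lo + 1 \<le> int D" using 0 by simp
    then have "real_of_int (hi - lo + 1) \<le> real_of_int (int D)" by (rule of_int_le_iff[THEN iffD2])
    then show "real_of_int (hi - lo + 1) \<le> real D" by simp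
  qed simp
  then show ?case by (simp add: p c shifts_0 algebra_simps)
next
  case (Suc j)
  define S where "S = (\<Sum>d\<in>{lo..hi}. e2pi (poly p (of_int d)))"
  define T where "T = (\<lambda>g. \<Sum>d\<in>{max lo (lo - g)..min hi (hi - g)}. e2pi (poly (pdiff g p) (of_int d)))"
  let ?G = "{- int D..int D}"
  have "complex_of_real ((norm S)\<^sup>2) = (\<Sum>g\<in>?G. T g)"
    unfolding S_def
  proof (subst norm_sum_squared_shifts[where D = D])
    show "(\<Sum>g\<in>?G. \<Sum>x\<in>{x\<in>{lo..hi}. x + g \<in> {lo..hi}}. e2pi (poly p (of_int (x + g))) * cnj (e2pi (poly p (of_int x)))) = (\<Sum>g\<in>?G. T g)"
      unfolding T_def
      by (intro sum.cong) (auto simp: cnj_e2pi simp flip: e2pi_add)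
  qed (use Suc.prems in auto)
  then have "norm (complex_of_real ((norm S)\<^sup>2)) = norm (\<Sum>g\<in>?G. T g)" by (rule arg_cong[of _ _ norm])
  then have "(norm S)\<^sup>2 = norm (\<Sum>g\<in>?G. T g)" unfolding norm_of_real by simp
  also have "\<dots> \<le> (\<Sum>g\<in>?G. norm (T g))" by (rule norm_sum)
  finally have sq: "(norm S)\<^sup>2 \<le> (\<Sum>g\<in>?G. norm (T g))" .
  have cG: "card ?G = 2 * D + 1" by simp
  have IH: "norm (T g) ^ 2 ^ j \<le> real (2 * D + 1) ^ (2 ^ j - Suc j) *
      (\<Sum>gs\<in>shifts D j. wmin (real D) (fact (Suc (Suc j)) * of_int (prod_list (g # gs)) * coeff p (Suc (Suc j))))" for g
  proof -
    have dc: "degree (pdiff g p) \<le> Suc j" "coeff (pdiff g p) (Suc j) = real (Suc (Suc j)) * of_int g * coeff p (Suc (Suc j))"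
      using pdiff_degree_coeff[OF Suc.prems(1), of g] by auto
    have "norm (T g) ^ 2 ^ j \<le> real (2 * D + 1) ^ (2 ^ j - Suc j) *
      (\<Sum>gs\<in>shifts D j. wmin (real D) (fact (Suc j) * of_int (prod_list gs) * coeff (pdiff g p) (Suc j)))"
      unfolding T_def by (rule Suc.IH[OF dc(1)]) (use Suc.prems(2) in auto)
    also have "(\<Sum>gs\<in>shifts D j. wmin (real D) (fact (Suc j) * of_int (prod_list gs) * coeff (pdiff g p) (Suc j)))
        = (\<Sum>gs\<in>shifts D j. wmin (real D) (fact (Suc (Suc j)) * of_int (prod_list (g # gs)) * coeff p (Suc (Suc j))))"
      unfolding dc(2) by (intro sum.cong refl arg_cong[of _ _ "wmin (real D)"]) (simp add: algebra_simps)
    finally show ?thesis .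
  qed
  have pw: "real (2 * D + 1) ^ (2 ^ j - 1) * real (2 * D + 1) ^ (2 ^ j - Suc j) = real (2 * D + 1) ^ (2 ^ Suc j - Suc (Suc j))"
  proof -
    have "(2 ^ j - 1) + (2 ^ j - Suc j) = 2 ^ Suc j - Suc (Suc j)" using two_power_ge_Suc[of j] by simp
    then show ?thesis by (simp only: flip: power_add)
  qed
  define W where "W = (\<lambda>gs. wmin (real D) (fact (Suc (Suc j)) * of_int (prod_list gs) * coeff p (Suc (Suc j))))"
  define c where "c = real (2 * D + 1) ^ (2 ^ j - Suc j)"
  define c' where "c' = real (2 * D + 1) ^ (2 ^ j - 1)"
  have IH': "norm (T g) ^ 2 ^ j \<le> c * (\<Sum>gs\<in>shifts D j. W (g # gs))" for g
    unfolding W_def c_def by (rule IH)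
  have c0: "0 \<le> c'" by (simp add: c'_def)
  have s: "(2::nat) ^ Suc j = 2 * 2 ^ j" by simp
  have "norm S ^ 2 ^ Suc j = ((norm S)\<^sup>2) ^ 2 ^ j" unfolding s by (rule power_mult)
  also have "\<dots> \<le> (\<Sum>g\<in>?G. norm (T g)) ^ 2 ^ j" by (rule power_mono[OF sq]) simp
  also have "\<dots> \<le> c' * (\<Sum>g\<in>?G. norm (T g) ^ 2 ^ j)"
    using power_mean_pow2[of ?G "\<lambda>g. norm (T g)" j] unfolding cG c'_def by simp
  also have "\<dots> \<le> c' * (\<Sum>g\<in>?G. c * (\<Sum>gs\<in>shifts D j. W (g # gs)))"
    by (rule mult_left_mono[OF sum_mono[OF IH'] c0])
  also have "(\<Sum>g\<in>?G. c * (\<Sum>gs\<in>shifts D j. W (g # gs))) = c * (\<Sum>gs\<in>shifts D (Suc j). W gs)"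
    by (subst sum_shifts_Suc) (rule sum_distrib_left[symmetric])
  also have "c' * (c * (\<Sum>gs\<in>shifts D (Suc j). W gs)) = (c' * c) * (\<Sum>gs\<in>shifts D (Suc j). W gs)"
    by (rule mult.assoc[symmetric])
  also have "c' * c = real (2 * D + 1) ^ (2 ^ Suc j - Suc (Suc j))"
    unfolding c_def c'_def by (rule pw)
  finally show ?case by (simp only: S_def W_def)
qed

section \<open>Iterated differencing of weights, phases and cut-offs\<close>

fun cdiffs :: "int list \<Rightarrow> (int \<Rightarrow> complex) \<Rightarrow> int \<Rightarrow> complex" where
  "cdiffs [] \<phi> = \<phi>"
| "cdiffs (h # hs) \<phi> = cdiffs hs (\<lambda>l. \<phi> (l + h) * cnj (\<phi> l))"

fun rdiffs :: "int list \<Rightarrow> (int \<Rightarrow> real) \<Rightarrow> int \<Rightarrow> real" where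
  "rdiffs [] f = f"
| "rdiffs (h # hs) f = rdiffs hs (\<lambda>x. f (x + h) - f x)"

text \<open>The hyperbolic condition reads d \<le> y l with a bound depending on l. A product of
  shifted indicators of this kind is the indicator for the minimum of the bounds, so that d still
  runs over an interval.\<close>

fun ymins :: "int list \<Rightarrow> (int \<Rightarrow> int) \<Rightarrow> int \<Rightarrow> int" where
  "ymins [] y = y"
| "ymins (h # hs) y = ymins hs (\<lambda>l. min (y (l + h)) (y l))"

fun pdiffs :: "int list \<Rightarrow> real poly \<Rightarrow> real poly" where
  "pdiffs [] p = p"
| "pdiffs (h # hs) p = pdiffs hs (pdiff h p)"

lemma norm_cdiffs_le:
  assumes "\<And>l. norm (b l) \<le> B"
  shows "norm (cdiffs hs b l) \<le> B ^ 2 ^ length hs"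
  using assms
proof (induction hs arbitrary: b B l)
  case (Cons h hs)
  have B0: "0 \<le> B" using Cons.prems[of 0] norm_ge_zero[of "b 0"] by linarith
  have "norm (b (l + h) * cnj (b l)) \<le> B\<^sup>2" for l
    unfolding norm_mult complex_mod_cnj power2_eq_square using Cons.prems B0 by (intro mult_mono) auto
  then have "norm (cdiffs (h # hs) b l) \<le> (B\<^sup>2) ^ 2 ^ length hs"
    unfolding cdiffs.simps by (rule Cons.IH)
  also have "\<dots> = B ^ (2 * 2 ^ length hs)" by (rule power_mult[symmetric])
  finally show ?case by simp
qed simp

text \<open>Of the conditions on l, one for every partial sum of shifts, only the two extreme ones
  are kept. For A = {1..L} they make 2 l + sum_list hs positive and at most 2 L; this number later
  multiplies the leading coefficient and must not vanish.\<close>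

lemma cdiffs_support:
  assumes "\<And>l. b l \<noteq> 0 \<Longrightarrow> l \<in> A" "cdiffs hs b l \<noteq> 0"
  shows "l \<in> A \<and> l + sum_list hs \<in> A"
  using assms
proof (induction hs arbitrary: b A l)
  case (Cons h hs)
  have "l \<in> {l. l \<in> A \<and> l + h \<in> A} \<and> l + sum_list hs \<in> {l. l \<in> A \<and> l + h \<in> A}"
  proof (rule Cons.IH)
    show "cdiffs hs (\<lambda>l. b (l + h) * cnj (b l)) l \<noteq> 0" using Cons.prems(2) by simp
  qed (use Cons.prems(1) in auto)
  then show ?case by (simp add: algebra_simps)
qed simp

text \<open>Differencing in l separates the weights, which end in a factor free of d, from the phase
  and the cut-off, which carry the whole dependence on d.\<close>

lemma cdiffs_phase:
  "cdiffs hs (\<lambda>l. b l * (if d \<le> y l then e2pi (p l) else 0)) l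
     = cdiffs hs b l * (if d \<le> ymins hs y l then e2pi (rdiffs hs p l) else 0)"
proof (induction hs arbitrary: b y p l)
  case (Cons h hs)
  have "(\<lambda>l. (b (l + h) * (if d \<le> y (l + h) then e2pi (p (l + h)) else 0)) * cnj (b l * (if d \<le> y l then e2pi (p l) else 0)))
      = (\<lambda>l. (b (l + h) * cnj (b l)) * (if d \<le> min (y (l + h)) (y l) then e2pi (p (l + h) - p l) else 0))"
    by (rule ext) (auto simp: cnj_e2pi e2pi_add[of "p (_ + h)" "- p _", simplified])
  then show ?case unfolding cdiffs.simps ymins.simps rdiffs.simps by (simp only: Cons.IH)
qed simp

text \<open>The last squaring is kept as an identity, so the bound is the real part of something
  linear in the products \<open>cdiffs\<close>, and a sum over d can still be moved inside. Absolute
  values at this point would destroy the cancellation in d.\<close>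

lemma norm_sum_pow_le_cdiffs:
  assumes "\<And>l. \<phi> l \<noteq> 0 \<Longrightarrow> l \<in> {1..int L}"
  shows "norm (\<Sum>l\<in>{1..int L}. \<phi> l) ^ 2 ^ Suc j
    \<le> real (2 * L + 1) ^ (2 ^ Suc j - Suc (Suc j)) * Re (\<Sum>hs\<in>shifts L (Suc j). \<Sum>l\<in>{1..int L}. cdiffs hs \<phi> l)"
  using assms
proof (induction j arbitrary: \<phi>)
  have sq: "complex_of_real ((norm (\<Sum>l\<in>{1..int L}. \<phi> l))\<^sup>2) = (\<Sum>h\<in>{- int L..int L}. \<Sum>l\<in>{1..int L}. \<phi> (l + h) * cnj (\<phi> l))"
    if supp: "\<And>l. \<phi> l \<noteq> 0 \<Longrightarrow> l \<in> {1..int L}" for \<phi>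
  proof -
    have "complex_of_real ((norm (\<Sum>l\<in>{1..int L}. \<phi> l))\<^sup>2)
      = (\<Sum>h\<in>{- int L..int L}. \<Sum>l\<in>{l\<in>{1..int L}. l + h \<in> {1..int L}}. \<phi> (l + h) * cnj (\<phi> l))"
      by (rule norm_sum_squared_shifts) auto
    also have "\<dots> = (\<Sum>h\<in>{- int L..int L}. \<Sum>l\<in>{1..int L}. \<phi> (l + h) * cnj (\<phi> l))"
      using supp by (intro sum.cong refl sum.mono_neutral_left) auto
    finally show ?thesis .
  qed
  {
    case 0
    have "(norm (\<Sum>l\<in>{1..int L}. \<phi> l))\<^sup>2 = Re (complex_of_real ((norm (\<Sum>l\<in>{1..int L}. \<phi> l))\<^sup>2))"
      by (rule Re_complex_of_real[symmetric])
    also have "\<dots> = Re (\<Sum>hs\<in>shifts L (Suc 0). \<Sum>l\<in>{1..int L}. cdiffs hs \<phi> l)"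
      by (subst sq[OF 0]) (simp_all add: sum_shifts_Suc shifts_0)
    finally show ?case by simp
  next
    case (Suc j)
    let ?S = "norm (\<Sum>l\<in>{1..int L}. \<phi> l)"
    let ?G = "{- int L..int L}"
    define T where "T = (\<lambda>h. \<Sum>l\<in>{1..int L}. \<phi> (l + h) * cnj (\<phi> l))"
    define c where "c = real (2 * L + 1) ^ (2 ^ Suc j - Suc (Suc j))"
    define c' where "c' = real (2 * L + 1) ^ (2 ^ Suc j - 1)"
    define W where "W = (\<lambda>hs. \<Sum>l\<in>{1..int L}. cdiffs hs \<phi> l)"
    have "norm (complex_of_real (?S\<^sup>2)) = norm (\<Sum>h\<in>?G. T h)"
      unfolding T_def by (subst sq[OF Suc.prems]) simp_all
    then have "?S\<^sup>2 = norm (\<Sum>h\<in>?G. T h)" unfolding norm_of_real by simp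
    also have "\<dots> \<le> (\<Sum>h\<in>?G. norm (T h))" by (rule norm_sum)
    finally have s2: "?S\<^sup>2 \<le> (\<Sum>h\<in>?G. norm (T h))" .
    have cG: "card ?G = 2 * L + 1" by simp
    have IH: "norm (T h) ^ 2 ^ Suc j \<le> c * Re (\<Sum>hs\<in>shifts L (Suc j). W (h # hs))" for h
      unfolding T_def c_def W_def cdiffs.simps by (rule Suc.IH) (use Suc.prems in auto)
    have c0: "0 \<le> c'" by (simp add: c'_def)
    have s: "(2::nat) ^ Suc (Suc j) = 2 * 2 ^ Suc j" by simp
    have "?S ^ 2 ^ Suc (Suc j) = (?S\<^sup>2) ^ 2 ^ Suc j" unfolding s by (rule power_mult)
    also have "\<dots> \<le> (\<Sum>h\<in>?G. norm (T h)) ^ 2 ^ Suc j" by (rule power_mono[OF s2]) simp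
    also have "\<dots> \<le> c' * (\<Sum>h\<in>?G. norm (T h) ^ 2 ^ Suc j)"
      using power_mean_pow2[of ?G "\<lambda>h. norm (T h)" "Suc j"] unfolding cG c'_def by simp
    also have "\<dots> \<le> c' * (\<Sum>h\<in>?G. c * Re (\<Sum>hs\<in>shifts L (Suc j). W (h # hs)))"
      by (rule mult_left_mono[OF sum_mono[OF IH] c0])
    also have "(\<Sum>h\<in>?G. c * Re (\<Sum>hs\<in>shifts L (Suc j). W (h # hs))) = c * Re (\<Sum>hs\<in>shifts L (Suc (Suc j)). W hs)"
      unfolding sum_shifts_Suc[of _ L "Suc j"] Re_sum sum_distrib_left ..
    also have "c' * (c * Re (\<Sum>hs\<in>shifts L (Suc (Suc j)). W hs)) = (c' * c) * Re (\<Sum>hs\<in>shifts L (Suc (Suc j)). W hs)"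
      by (rule mult.assoc[symmetric])
    also have "c' * c = real (2 * L + 1) ^ (2 ^ Suc (Suc j) - Suc (Suc (Suc j)))"
    proof -
      have "(2 ^ Suc j - 1) + (2 ^ Suc j - Suc (Suc j)) = 2 ^ Suc (Suc j) - Suc (Suc (Suc j))"
        using two_power_ge_Suc[of "Suc j"] by simp
      then show ?thesis unfolding c_def c'_def by (simp only: flip: power_add)
    qed
    finally show ?case by (simp only: W_def)
  }
qed

section \<open>Iterated differences of polynomials and powers\<close>

lemma poly_eq_sum_atMost:
  fixes p :: "'a::comm_ring_1 poly"
  assumes "degree p \<le> n" shows "poly p x = (\<Sum>i\<le>n. coeff p i * x ^ i)"
  unfolding poly_altdef by (rule sum.mono_neutral_left) (use assms in \<open>auto simp: coeff_eq_0\<close>)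

lemma rdiffs_sum:
  "rdiffs hs (\<lambda>x. \<Sum>i\<in>I. a i * f i x) l = (\<Sum>i\<in>I. a i * rdiffs hs (f i) l)"
proof (induction hs arbitrary: f)
  case (Cons h hs)
  have "(\<lambda>x. (\<Sum>i\<in>I. a i * f i (x + h)) - (\<Sum>i\<in>I. a i * f i x)) = (\<lambda>x. \<Sum>i\<in>I. a i * (f i (x + h) - f i x))"
    by (rule ext) (simp add: sum_subtractf right_diff_distrib)
  then show ?case unfolding rdiffs.simps by (simp only: Cons.IH)
qed simp

lemma rdiffs_poly: "rdiffs hs (\<lambda>x. poly p (of_int x)) l = poly (pdiffs hs p) (of_int l)"
proof (induction hs arbitrary: p)
  case (Cons h hs)
  have "(\<lambda>x. poly p (of_int (x + h)) - poly p (of_int x)) = (\<lambda>x. poly (pdiff h p) (of_int x))"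
    by (rule ext) simp
  then show ?case unfolding rdiffs.simps pdiffs.simps by (simp only: Cons.IH)
qed simp

lemma pdiffs_degree_coeff:
  "degree p \<le> n + length hs \<Longrightarrow> degree (pdiffs hs p) \<le> n \<and>
     fact n * coeff (pdiffs hs p) n = fact (n + length hs) * of_int (prod_list hs) * coeff p (n + length hs)"
proof (induction hs arbitrary: p)
  case (Cons h hs)
  have d: "degree (pdiff h p) \<le> n + length hs" "coeff (pdiff h p) (n + length hs) = real (Suc (n + length hs)) * of_int h * coeff p (Suc (n + length hs))"
    using pdiff_degree_coeff[of p "n + length hs" h] Cons.prems by auto
  show ?case using Cons.IH[OF d(1)] d(2) by (simp add: algebra_simps)
qed simp

text \<open>The reflection maps x to - x - s. One difference by h replaces s by s + h, which moves
  the centre by - h / 2, and flips the sign.\<close>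

lemma rdiffs_reflect:
  assumes "\<And>x. f (- x - s) = \<sigma> * f x"
  shows "rdiffs hs f (- x - s - sum_list hs) = (- 1) ^ length hs * \<sigma> * rdiffs hs f x"
  using assms
proof (induction hs arbitrary: f s \<sigma>)
  case (Cons h hs)
  have "f (- x - (s + h) + h) - f (- x - (s + h)) = - \<sigma> * (f (x + h) - f x)" for x
  proof -
    have e: "- x - (s + h) + h = - x - s" "- x - (s + h) = - (x + h) - s" by simp_all
    show ?thesis unfolding e(1) unfolding e(2) Cons.prems by (simp add: right_diff_distrib)
  qed
  then have "rdiffs hs (\<lambda>x. f (x + h) - f x) (- x - (s + h) - sum_list hs)
      = (- 1) ^ length hs * (- \<sigma>) * rdiffs hs (\<lambda>x. f (x + h) - f x) x"
    by (rule Cons.IH)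
  then show ?case by (simp add: algebra_simps)
qed simp

text \<open>The last difference is affine in \<open>l\<close>; parity under \<open>l \<mapsto> - l - sum_list hs\<close> determines its constant term.\<close>

lemma rdiffs_power:
  assumes k: "k = Suc (length hs)"
  shows "2 * rdiffs hs (\<lambda>x. of_int x ^ k) l = fact k * of_int (prod_list hs) * of_int (2 * l + sum_list hs)"
proof -
  let ?f = "\<lambda>x::int. (of_int x :: real) ^ k"
  define p where "p = pdiffs hs (monom (1::real) k)"
  have f: "?f = (\<lambda>x. poly (monom 1 k) (of_int x))" by (simp add: poly_monom)
  have r: "rdiffs hs ?f x = poly p (of_int x)" for x unfolding f rdiffs_poly p_def ..
  have d: "degree p \<le> 1" "coeff p 1 = fact k * of_int (prod_list hs)"
    using pdiffs_degree_coeff[of "monom (1::real) k" 1 hs] k by (auto simp: p_def degree_monom_eq)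
  have pl: "poly p x = coeff p 0 + coeff p 1 * x" for x
  proof -
    have "poly p x = (\<Sum>i\<le>1. coeff p i * x ^ i)" by (rule poly_eq_sum_atMost[OF d(1)])
    then show ?thesis by simp
  qed
  have "rdiffs hs ?f (- 0 - 0 - sum_list hs) = (- 1) ^ length hs * (- 1) ^ k * rdiffs hs ?f 0"
    by (rule rdiffs_reflect) (simp add: power_minus[of "of_int _"])
  moreover have "(- 1 :: real) ^ length hs * (- 1) ^ k = - 1" by (simp add: k flip: power_mult_distrib)
  ultimately have "poly p (of_int (- sum_list hs)) = - poly p 0" by (simp add: r)
  then have "2 * coeff p 0 = coeff p 1 * of_int (sum_list hs)" by (simp add: pl)
  then show ?thesis using d(2) by (simp add: r pl algebra_simps)
qed

text \<open>The sum over d that is left after j differences in l is handed on as an abstract e with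
  a trivial bound, a Weyl bound and its part in the bilinear sum. The two bounds are kept apart
  because degenerate shift vectors can use only the trivial one, while a power mean has to precede
  the other.\<close>

lemma bilinear_weyl:
  fixes a b :: "int \<Rightarrow> complex" and g :: "real poly" and X :: int
  assumes j: "1 \<le> j" and g: "degree g \<le> Suc j" and A: "\<And>d. norm (a d) \<le> A" and B: "\<And>l. norm (b l) \<le> B"
  shows "\<exists>e :: int list \<Rightarrow> int \<Rightarrow> real.
    (\<forall>hs l. 0 \<le> e hs l \<and> e hs l \<le> real D \<and>
       e hs l ^ 2 ^ j \<le> real (2 * D + 1) ^ (2 ^ j - Suc j) * (\<Sum>gs\<in>shifts D j.
          wmin (real D) (fact (Suc j) * of_int (prod_list gs) * (coeff g (Suc j) * rdiffs hs (\<lambda>x. of_int x ^ Suc j) l)))) \<and>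
    norm (\<Sum>d\<in>{1..int D}. a d * (\<Sum>l\<in>{1..int L}. if d * l \<le> X then b l * e2pi (poly g (of_int (d * l))) else 0)) ^ 2 ^ j
    \<le> A ^ 2 ^ j * real D ^ (2 ^ j - 1) * real (2 * L + 1) ^ (2 ^ j - Suc j) * B ^ 2 ^ j *
       (\<Sum>hs\<in>shifts L j. \<Sum>l\<in>{l\<in>{1..int L}. l + sum_list hs \<in> {1..int L}}. e hs l)"
proof -
  define b' where "b' = (\<lambda>l. if l \<in> {1..int L} then b l else 0)"
  define y where "y = (\<lambda>l. X div l)"
  define p where "p = (\<lambda>d l. poly g (of_int (d * l)))"
  define \<phi> where "\<phi> = (\<lambda>d l. b' l * (if d \<le> y l then e2pi (p d l) else 0))"
  define e where "e = (\<lambda>hs l. norm (\<Sum>d\<in>{1..min (int D) (ymins hs y l)}. e2pi (rdiffs hs (p d) l)))"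
  define S where "S = (\<Sum>d\<in>{1..int D}. a d * (\<Sum>l\<in>{1..int L}. if d * l \<le> X then b l * e2pi (poly g (of_int (d * l))) else 0))"
  have A0: "0 \<le> A" and B0: "0 \<le> B" using A[of 0] B[of 0] norm_ge_zero[of "a 0"] norm_ge_zero[of "b 0"] by linarith+
  have inner: "(\<Sum>l\<in>{1..int L}. if d * l \<le> X then b l * e2pi (poly g (of_int (d * l))) else 0) = (\<Sum>l\<in>{1..int L}. \<phi> d l)" for d
  proof (rule sum.cong[OF refl])
    fix l assume l: "l \<in> {1..int L}"
    then have "d \<le> y l \<longleftrightarrow> l * d \<le> X" unfolding y_def by (intro pos_le_zdiv_iff) auto
    then show "(if d * l \<le> X then b l * e2pi (poly g (of_int (d * l))) else 0) = \<phi> d l"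
      using l by (auto simp: \<phi>_def b'_def p_def mult.commute)
  qed
  have supp: "\<phi> d l \<noteq> 0 \<Longrightarrow> l \<in> {1..int L}" for d l by (auto simp: \<phi>_def b'_def split: if_splits)
  obtain i where i: "j = Suc i" using j by (cases j) auto
  have cd: "cdiffs hs (\<phi> d) l = cdiffs hs b' l * (if d \<le> ymins hs y l then e2pi (rdiffs hs (p d) l) else 0)" for hs d l
    unfolding \<phi>_def by (rule cdiffs_phase)
  have nb: "norm (cdiffs hs b' l) \<le> B ^ 2 ^ length hs" for hs l
    by (rule norm_cdiffs_le) (use B B0 in \<open>auto simp: b'_def\<close>)
  have sb: "cdiffs hs b' l \<noteq> 0 \<Longrightarrow> l \<in> {1..int L} \<and> l + sum_list hs \<in> {1..int L}" for hs l
    by (rule cdiffs_support[of b']) (auto simp: b'_def split: if_splits)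
  define c where "c = real (2 * L + 1) ^ (2 ^ j - Suc j)"
  have c0: "0 \<le> c" unfolding c_def by (rule zero_le_power) simp
  have "norm S \<le> (\<Sum>d\<in>{1..int D}. A * norm (\<Sum>l\<in>{1..int L}. \<phi> d l))"
    unfolding S_def
  proof (rule sum_norm_le)
    fix d
    show "norm (a d * (\<Sum>l\<in>{1..int L}. if d * l \<le> X then b l * e2pi (poly g (of_int (d * l))) else 0)) \<le> A * norm (\<Sum>l\<in>{1..int L}. \<phi> d l)"
      by (simp only: inner norm_mult) (rule mult_right_mono[OF A norm_ge_zero])
  qed
  also have "\<dots> = A * (\<Sum>d\<in>{1..int D}. norm (\<Sum>l\<in>{1..int L}. \<phi> d l))" by (rule sum_distrib_left[symmetric])
  finally have "norm S ^ 2 ^ j \<le> (A * (\<Sum>d\<in>{1..int D}. norm (\<Sum>l\<in>{1..int L}. \<phi> d l))) ^ 2 ^ j"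
    by (rule power_mono) simp
  also have "\<dots> = A ^ 2 ^ j * (\<Sum>d\<in>{1..int D}. norm (\<Sum>l\<in>{1..int L}. \<phi> d l)) ^ 2 ^ j" by (rule power_mult_distrib)
  also have "\<dots> \<le> A ^ 2 ^ j * (real D ^ (2 ^ j - 1) * (\<Sum>d\<in>{1..int D}. c * Re (\<Sum>hs\<in>shifts L j. \<Sum>l\<in>{1..int L}. cdiffs hs (\<phi> d) l)))"
  proof (rule mult_left_mono)
    have *: "norm (\<Sum>l\<in>{1..int L}. \<phi> d l) ^ 2 ^ j \<le> c * Re (\<Sum>hs\<in>shifts L j. \<Sum>l\<in>{1..int L}. cdiffs hs (\<phi> d) l)" for d
      unfolding c_def i by (rule norm_sum_pow_le_cdiffs) (rule supp)
    have "(\<Sum>d\<in>{1..int D}. norm (\<Sum>l\<in>{1..int L}. \<phi> d l)) ^ 2 ^ j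
        \<le> real D ^ (2 ^ j - 1) * (\<Sum>d\<in>{1..int D}. norm (\<Sum>l\<in>{1..int L}. \<phi> d l) ^ 2 ^ j)"
      using power_mean_pow2[of "{1..int D}" "\<lambda>d. norm (\<Sum>l\<in>{1..int L}. \<phi> d l)" j] by simp
    also have "\<dots> \<le> real D ^ (2 ^ j - 1) * (\<Sum>d\<in>{1..int D}. c * Re (\<Sum>hs\<in>shifts L j. \<Sum>l\<in>{1..int L}. cdiffs hs (\<phi> d) l))"
      by (rule mult_left_mono[OF sum_mono[OF *]]) simp
    finally show "(\<Sum>d\<in>{1..int D}. norm (\<Sum>l\<in>{1..int L}. \<phi> d l)) ^ 2 ^ j
       \<le> real D ^ (2 ^ j - 1) * (\<Sum>d\<in>{1..int D}. c * Re (\<Sum>hs\<in>shifts L j. \<Sum>l\<in>{1..int L}. cdiffs hs (\<phi> d) l))" .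
  qed (use A0 in simp)
  \<comment> \<open>By linearity the sum over d moves to the inside, where it becomes a Weyl sum
    over an interval.\<close>
  also have "(\<Sum>d\<in>{1..int D}. c * Re (\<Sum>hs\<in>shifts L j. \<Sum>l\<in>{1..int L}. cdiffs hs (\<phi> d) l))
     = c * Re (\<Sum>hs\<in>shifts L j. \<Sum>l\<in>{1..int L}. \<Sum>d\<in>{1..int D}. cdiffs hs (\<phi> d) l)"
  proof -
    have "(\<Sum>hs\<in>shifts L j. \<Sum>l\<in>{1..int L}. \<Sum>d\<in>{1..int D}. cdiffs hs (\<phi> d) l)
        = (\<Sum>hs\<in>shifts L j. \<Sum>d\<in>{1..int D}. \<Sum>l\<in>{1..int L}. cdiffs hs (\<phi> d) l)"
      by (intro sum.cong refl sum.swap)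
    also have "\<dots> = (\<Sum>d\<in>{1..int D}. \<Sum>hs\<in>shifts L j. \<Sum>l\<in>{1..int L}. cdiffs hs (\<phi> d) l)"
      by (rule sum.swap)
    finally show ?thesis by (simp only: Re_sum sum_distrib_left)
  qed
  also have "A ^ 2 ^ j * (real D ^ (2 ^ j - 1) * (c * Re (\<Sum>hs\<in>shifts L j. \<Sum>l\<in>{1..int L}. \<Sum>d\<in>{1..int D}. cdiffs hs (\<phi> d) l)))
     \<le> A ^ 2 ^ j * (real D ^ (2 ^ j - 1) * (c * (B ^ 2 ^ j * (\<Sum>hs\<in>shifts L j. \<Sum>l\<in>{l\<in>{1..int L}. l + sum_list hs \<in> {1..int L}}. e hs l))))"
  proof (intro mult_left_mono)
    have "norm (\<Sum>hs\<in>shifts L j. \<Sum>l\<in>{1..int L}. \<Sum>d\<in>{1..int D}. cdiffs hs (\<phi> d) l)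
      \<le> (\<Sum>hs\<in>shifts L j. B ^ 2 ^ j * (\<Sum>l\<in>{l\<in>{1..int L}. l + sum_list hs \<in> {1..int L}}. e hs l))"
    proof (rule sum_norm_le)
      fix hs assume hs: "hs \<in> shifts L j"
      then have len: "length hs = j" by (simp add: shifts_def)
      have eq: "(\<Sum>d\<in>{1..int D}. cdiffs hs (\<phi> d) l) = cdiffs hs b' l * (\<Sum>d\<in>{1..min (int D) (ymins hs y l)}. e2pi (rdiffs hs (p d) l))" for l
      proof -
        have "(\<Sum>d\<in>{1..int D}. cdiffs hs (\<phi> d) l) = cdiffs hs b' l * (\<Sum>d\<in>{1..int D}. if d \<le> ymins hs y l then e2pi (rdiffs hs (p d) l) else 0)"
          by (simp only: cd sum_distrib_left)
        also have "(\<Sum>d\<in>{1..int D}. if d \<le> ymins hs y l then e2pi (rdiffs hs (p d) l) else 0) = (\<Sum>d\<in>{1..min (int D) (ymins hs y l)}. e2pi (rdiffs hs (p d) l))"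
          by (rule sum.mono_neutral_cong_right) auto
        finally show ?thesis .
      qed
      have eq2: "(\<Sum>l\<in>{1..int L}. \<Sum>d\<in>{1..int D}. cdiffs hs (\<phi> d) l)
          = (\<Sum>l\<in>{l\<in>{1..int L}. l + sum_list hs \<in> {1..int L}}. \<Sum>d\<in>{1..int D}. cdiffs hs (\<phi> d) l)"
        using sb by (intro sum.mono_neutral_right) (auto simp: eq)
      have "norm (\<Sum>l\<in>{1..int L}. \<Sum>d\<in>{1..int D}. cdiffs hs (\<phi> d) l) \<le> (\<Sum>l\<in>{l\<in>{1..int L}. l + sum_list hs \<in> {1..int L}}. B ^ 2 ^ j * e hs l)"
        unfolding eq2
      proof (rule sum_norm_le)
        fix l
        have "norm (cdiffs hs b' l) * e hs l \<le> B ^ 2 ^ j * e hs l"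
          by (rule mult_right_mono[OF nb[of hs l, unfolded len]]) (simp add: e_def)
        then show "norm (\<Sum>d\<in>{1..int D}. cdiffs hs (\<phi> d) l) \<le> B ^ 2 ^ j * e hs l"
          by (simp only: eq norm_mult e_def)
      qed
      also have "\<dots> = B ^ 2 ^ j * (\<Sum>l\<in>{l\<in>{1..int L}. l + sum_list hs \<in> {1..int L}}. e hs l)" by (rule sum_distrib_left[symmetric])
      finally show "norm (\<Sum>l\<in>{1..int L}. \<Sum>d\<in>{1..int D}. cdiffs hs (\<phi> d) l) \<le> B ^ 2 ^ j * (\<Sum>l\<in>{l\<in>{1..int L}. l + sum_list hs \<in> {1..int L}}. e hs l)" .
    qed
    also have "\<dots> = B ^ 2 ^ j * (\<Sum>hs\<in>shifts L j. \<Sum>l\<in>{l\<in>{1..int L}. l + sum_list hs \<in> {1..int L}}. e hs l)"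
      by (rule sum_distrib_left[symmetric])
    finally show "Re (\<Sum>hs\<in>shifts L j. \<Sum>l\<in>{1..int L}. \<Sum>d\<in>{1..int D}. cdiffs hs (\<phi> d) l)
       \<le> B ^ 2 ^ j * (\<Sum>hs\<in>shifts L j. \<Sum>l\<in>{l\<in>{1..int L}. l + sum_list hs \<in> {1..int L}}. e hs l)"
      by (rule order_trans[OF complex_Re_le_cmod])
  qed (use A0 c0 in auto)
  finally have main: "norm S ^ 2 ^ j \<le> A ^ 2 ^ j * real D ^ (2 ^ j - 1) * c * B ^ 2 ^ j *
       (\<Sum>hs\<in>shifts L j. \<Sum>l\<in>{l\<in>{1..int L}. l + sum_list hs \<in> {1..int L}}. e hs l)"
    by (simp only: mult.assoc)
  have eD: "e hs l \<le> real D" for hs l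
  proof -
    have "e hs l \<le> (\<Sum>d\<in>{1..min (int D) (ymins hs y l)}. 1)"
      unfolding e_def by (rule sum_norm_le) simp
    also have "\<dots> \<le> real D" by simp
    finally show ?thesis .
  qed
  have eW: "e hs l ^ 2 ^ j \<le> real (2 * D + 1) ^ (2 ^ j - Suc j) * (\<Sum>gs\<in>shifts D j.
          wmin (real D) (fact (Suc j) * of_int (prod_list gs) * (coeff g (Suc j) * rdiffs hs (\<lambda>x. of_int x ^ Suc j) l)))" for hs l
  proof -
    \<comment> \<open>Seen as a function of d, the differenced phase keeps its degree bound: d ^ i
      is a constant for differences in l and only its coefficient is differenced.\<close>
    define q where "q = (\<Sum>i\<le>Suc j. monom (coeff g i * rdiffs hs (\<lambda>x. of_int x ^ i) l) i)"
    have dq: "degree q \<le> Suc j" unfolding q_def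
      by (intro degree_sum_le) (auto intro: order_trans[OF degree_monom_le])
    have cq: "coeff q (Suc j) = coeff g (Suc j) * rdiffs hs (\<lambda>x. of_int x ^ Suc j) l"
      unfolding q_def by (simp add: coeff_sum)
    have rq: "rdiffs hs (p d) l = poly q (of_int d)" for d
    proof -
      have "p d = (\<lambda>x. \<Sum>i\<le>Suc j. (coeff g i * of_int d ^ i) * of_int x ^ i)"
        unfolding p_def by (rule ext) (simp only: poly_eq_sum_atMost[OF g] of_int_mult power_mult_distrib mult.assoc)
      then have "rdiffs hs (p d) l = (\<Sum>i\<le>Suc j. (coeff g i * of_int d ^ i) * rdiffs hs (\<lambda>x. of_int x ^ i) l)"
        by (simp only: rdiffs_sum)
      also have "\<dots> = poly q (of_int d)"
        unfolding q_def poly_sum by (intro sum.cong refl) (simp add: poly_monom)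
      finally show ?thesis .
    qed
    show ?thesis unfolding e_def rq cq[symmetric] by (rule weyl_inequality[OF dq]) auto
  qed
  have e0: "0 \<le> e hs l" for hs l by (simp add: e_def)
  show ?thesis
    by (rule exI[of _ e]) (use main e0 eD eW in \<open>auto simp: S_def c_def\<close>)
qed

section \<open>Mean values and multiplicities\<close>

text \<open>Only \<alpha> itself is close to a / q. Sorting n by its residue modulo M turns \<alpha>
  / M * n into \<alpha> * t plus an offset, so each of the M classes is an ordinary interval
  sum.\<close>

lemma sum_wmin_quotient:
  assumes \<alpha>: "rat_approx \<alpha> a q" and M: "1 \<le> M" and D: "0 \<le> D"
  shows "(\<Sum>n=1..R. wmin D (\<alpha> / real M * real n))
     \<le> (2 * real R / real q + 3 * real M) * (2 * D + 4 * real q * (1 + ln (real q)))"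
proof -
  have q: "1 \<le> q" using \<alpha> by (simp add: rat_approx_def)
  let ?W = "2 * D + 4 * real q * (1 + ln (real q))"
  have W: "0 \<le> ?W" using D q by simp
  let ?f = "\<lambda>n. wmin D (\<alpha> / real M * real n)"
  have blk: "(\<Sum>n\<in>{n\<in>{1..R}. n mod M = r}. ?f n) \<le> (2 * real (R div M + 1) / real q + 1) * ?W" for r
  proof -
    have "(\<Sum>n\<in>{n\<in>{1..R}. n mod M = r}. ?f n) = (\<Sum>n\<in>{n\<in>{1..R}. n mod M = r}. wmin D (\<alpha> * of_int (int (n div M)) + \<alpha> * real r / real M))"
    proof (rule sum.cong[OF refl])
      fix n assume "n \<in> {n\<in>{1..R}. n mod M = r}"
      then have "n = M * (n div M) + r" by auto
      then have "real n = real (M * (n div M) + r)" by (rule arg_cong[of _ _ real])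
      then have "real n = real M * real (n div M) + real r" by (simp only: of_nat_add of_nat_mult)
      then have "\<alpha> / real M * real n = \<alpha> * of_int (int (n div M)) + \<alpha> * real r / real M"
        using M by (simp add: field_simps)
      then show "?f n = wmin D (\<alpha> * of_int (int (n div M)) + \<alpha> * real r / real M)" by (rule arg_cong[of _ _ "wmin D"])
    qed
    also have "\<dots> = (\<Sum>t\<in>(\<lambda>n. int (n div M)) ` {n\<in>{1..R}. n mod M = r}. wmin D (\<alpha> * of_int t + \<alpha> * real r / real M))"
    proof (subst sum.reindex)
      show "inj_on (\<lambda>n. int (n div M)) {n\<in>{1..R}. n mod M = r}"
      proof (rule inj_onI)
        fix x y assume xy: "x \<in> {n\<in>{1..R}. n mod M = r}" "y \<in> {n\<in>{1..R}. n mod M = r}" "int (x div M) = int (y div M)"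
        then have "x div M = y div M" "x mod M = y mod M" by (auto simp del: of_nat_div)
        then show "x = y" by (metis mult_div_mod_eq)
      qed
    qed simp
    \<comment> \<open>The range is 0..R div M, written in the form A + 1..A + R of the interval
      estimate with A = - 1.\<close>
    also have "\<dots> \<le> (\<Sum>t\<in>{- 1 + 1..- 1 + int (R div M + 1)}. wmin D (\<alpha> * of_int t + \<alpha> * real r / real M))"
      using D by (intro sum_mono2 wmin_nonneg) (auto simp: div_le_mono simp del: of_nat_div)
    also have "\<dots> \<le> (2 * real (R div M + 1) / real q + 1) * ?W"
      by (rule sum_wmin_interval[OF \<alpha> D])
    finally show ?thesis .
  qed
  have "(\<Sum>n=1..R. ?f n) = (\<Sum>r\<in>{..<M}. \<Sum>n\<in>{n\<in>{1..R}. n mod M = r}. ?f n)"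
    using M by (intro sum.group[symmetric]) auto
  also have "\<dots> \<le> (\<Sum>r\<in>{..<M}. (2 * real (R div M + 1) / real q + 1) * ?W)" by (rule sum_mono[OF blk])
  also have "\<dots> = (real M * (2 * real (R div M + 1) / real q + 1)) * ?W" by simp
  also have "\<dots> \<le> (2 * real R / real q + 3 * real M) * ?W"
  proof (rule mult_right_mono[OF _ W])
    have "M * (R div M) \<le> R" by simp
    then have "real M * real (R div M) \<le> real R" by (metis of_nat_le_iff of_nat_mult)
    then have "real M * real (R div M) / real q \<le> real R / real q" by (rule divide_right_mono) simp
    moreover have "real M / real q \<le> real M" using q by (simp add: divide_le_eq mult_le_cancel_left1)
    moreover have "real M * (2 * real (R div M + 1) / real q + 1) = 2 * (real M * real (R div M) / real q) + 2 * (real M / real q) + real M"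
      by (simp add: add_divide_distrib algebra_simps)
    ultimately show "real M * (2 * real (R div M + 1) / real q + 1) \<le> 2 * real R / real q + 3 * real M"
      by simp
  qed
  finally show ?thesis .
qed

text \<open>\<open>wmin\<close> is even, so only the absolute value of \<nu> i matters. \<rho>
  bounds how often a value is taken, and the sum over the values taken is extended to all n up to
  R.\<close>

lemma sum_wmin_multiples:
  fixes \<nu> :: "'a \<Rightarrow> int"
  assumes \<alpha>: "rat_approx \<alpha> a q" and M: "1 \<le> M" and D: "0 \<le> D" and I: "finite I"
    and \<nu>: "\<And>i. i \<in> I \<Longrightarrow> \<nu> i \<noteq> 0" "\<And>i. i \<in> I \<Longrightarrow> \<bar>\<nu> i\<bar> \<le> int R"
    and \<rho>: "0 \<le> \<rho>" "\<And>n. n \<in> {1..R} \<Longrightarrow> real (card {i\<in>I. \<bar>\<nu> i\<bar> = int n}) \<le> \<rho>"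
  shows "(\<Sum>i\<in>I. wmin D (\<alpha> / real M * of_int (\<nu> i)))
     \<le> \<rho> * ((2 * real R / real q + 3 * real M) * (2 * D + 4 * real q * (1 + ln (real q))))"
proof -
  let ?w = "\<lambda>n::nat. wmin D (\<alpha> / real M * real n)"
  have w: "wmin D (\<alpha> / real M * of_int (\<nu> i)) = ?w (nat \<bar>\<nu> i\<bar>)" for i
  proof (cases "0 \<le> \<nu> i")
    case False
    then have "\<alpha> / real M * real (nat \<bar>\<nu> i\<bar>) = - (\<alpha> / real M * of_int (\<nu> i))" by simp
    then show ?thesis by (simp only: wmin_minus)
  qed simp
  have "(\<Sum>i\<in>I. wmin D (\<alpha> / real M * of_int (\<nu> i))) = (\<Sum>i\<in>I. ?w (nat \<bar>\<nu> i\<bar>))" by (simp only: w)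
  also have "\<dots> = (\<Sum>n=1..R. \<Sum>i\<in>{i\<in>I. nat \<bar>\<nu> i\<bar> = n}. ?w (nat \<bar>\<nu> i\<bar>))"
  proof (rule sum.group[symmetric, OF I])
    show "(\<lambda>i. nat \<bar>\<nu> i\<bar>) ` I \<subseteq> {1..R}"
    proof
      fix n assume "n \<in> (\<lambda>i. nat \<bar>\<nu> i\<bar>) ` I"
      then obtain i where i: "i \<in> I" "n = nat \<bar>\<nu> i\<bar>" by auto
      then show "n \<in> {1..R}" using \<nu>[OF i(1)] by auto
    qed
  qed simp
  also have "\<dots> \<le> (\<Sum>n=1..R. \<rho> * ?w n)"
  proof (rule sum_mono)
    fix n assume n: "n \<in> {1..R}"
    have "(\<Sum>i\<in>{i\<in>I. nat \<bar>\<nu> i\<bar> = n}. ?w (nat \<bar>\<nu> i\<bar>)) = real (card {i\<in>I. nat \<bar>\<nu> i\<bar> = n}) * ?w n" by simp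
    also have "\<dots> \<le> \<rho> * ?w n"
    proof (rule mult_right_mono[OF _ wmin_nonneg[OF D]])
      have "{i\<in>I. nat \<bar>\<nu> i\<bar> = n} = {i\<in>I. \<bar>\<nu> i\<bar> = int n}" by auto
      then show "real (card {i\<in>I. nat \<bar>\<nu> i\<bar> = n}) \<le> \<rho>" using \<rho>(2)[OF n] by simp
    qed
    finally show "(\<Sum>i\<in>{i\<in>I. nat \<bar>\<nu> i\<bar> = n}. ?w (nat \<bar>\<nu> i\<bar>)) \<le> \<rho> * ?w n" .
  qed
  also have "\<dots> = \<rho> * (\<Sum>n=1..R. ?w n)" by (rule sum_distrib_left[symmetric])
  also have "\<dots> \<le> \<rho> * ((2 * real R / real q + 3 * real M) * (2 * D + 4 * real q * (1 + ln (real q))))"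
    by (rule mult_left_mono[OF sum_wmin_quotient[OF \<alpha> M D] \<rho>(1)])
  finally show ?thesis .
qed

section \<open>Signed divisors and multiplicities\<close>

definition int_divisors :: "nat \<Rightarrow> int set" where
  "int_divisors n = {z. z dvd int n}"

lemma int_divisors_finite_card:
  assumes n: "0 < n"
  shows "finite (int_divisors n)" "card (int_divisors n) \<le> 2 * tau n"
proof -
  let ?T = "{d. d dvd n}"
  have sub: "int_divisors n \<subseteq> int ` ?T \<union> (\<lambda>d. - int d) ` ?T"
  proof
    fix z assume "z \<in> int_divisors n"
    then have "nat \<bar>z\<bar> dvd n" by (simp add: int_divisors_def nat_abs_dvd_iff)
    moreover have "z = int (nat \<bar>z\<bar>) \<or> z = - int (nat \<bar>z\<bar>)" by linarith
    ultimately show "z \<in> int ` ?T \<union> (\<lambda>d. - int d) ` ?T" by blast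
  qed
  have fin: "finite ?T" using n by simp
  show "finite (int_divisors n)" by (rule finite_subset[OF sub]) (use fin in simp)
  have "card (int_divisors n) \<le> card (int ` ?T \<union> (\<lambda>d. - int d) ` ?T)"
    by (rule card_mono[OF _ sub]) (use fin in simp)
  also have "\<dots> \<le> card (int ` ?T) + card ((\<lambda>d. - int d) ` ?T)" by (rule card_Un_le)
  also have "\<dots> \<le> card ?T + card ?T" by (intro add_mono card_image_le fin)
  finally show "card (int_divisors n) \<le> 2 * tau n" by (simp add: tau_def)
qed

definition divisor_lists :: "nat \<Rightarrow> nat \<Rightarrow> int list set" where
  "divisor_lists n j = {hs. set hs \<subseteq> int_divisors n \<and> length hs = j}"

lemma divisor_lists_finite_card:
  assumes n: "0 < n"
  shows "finite (divisor_lists n j)" "card (divisor_lists n j) \<le> (2 * tau n) ^ j"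
proof -
  note fc = int_divisors_finite_card[OF n]
  show "finite (divisor_lists n j)" unfolding divisor_lists_def by (rule finite_lists_length_eq[OF fc(1)])
  show "card (divisor_lists n j) \<le> (2 * tau n) ^ j"
    unfolding divisor_lists_def card_lists_length_eq[OF fc(1)] by (rule power_mono[OF fc(2)]) simp
qed

lemma dvd_prod_list: "x \<in> set xs \<Longrightarrow> (x::int) dvd prod_list xs"
  by (induction xs) auto

lemma abs_prod_list_le: "set hs \<subseteq> {- int L..int L} \<Longrightarrow> \<bar>prod_list hs\<bar> \<le> int L ^ length hs"
proof (induction hs)
  case (Cons h hs)
  then have "\<bar>h\<bar> * \<bar>prod_list hs\<bar> \<le> int L * int L ^ length hs" by (intro mult_mono) auto
  then show ?case by (simp add: abs_mult)
qed simp

lemma shifts_subset_divisor_lists: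
  assumes "hs \<in> shifts L j" "prod_list hs dvd int n"
  shows "hs \<in> divisor_lists n j"
  using assms dvd_prod_list by (auto simp: shifts_def divisor_lists_def int_divisors_def intro: dvd_trans)

text \<open>A value \<open>n\<close> fixes \<open>hs\<close> and \<open>gs\<close> up to divisors of \<open>n\<close>, and then \<open>l\<close> uniquely.\<close>

lemma card_bilinear_fibre_le:
  assumes c: "1 \<le> c" and n: "0 < n"
  shows "card {(hs, l, gs). hs \<in> shifts L j \<and> gs \<in> shifts D j \<and> l \<in> {1..int L} \<and> l + sum_list hs \<in> {1..int L} \<and>
           \<bar>c * prod_list hs * prod_list gs * (2 * l + sum_list hs)\<bar> = int n} \<le> (2 * tau n) ^ (2 * j)"
    (is "card ?I \<le> _")
proof -
  let ?\<phi> = "\<lambda>(hs, l, gs). (hs :: int list, gs :: int list)"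
  have sub: "?\<phi> ` ?I \<subseteq> divisor_lists n j \<times> divisor_lists n j"
  proof
    fix p assume "p \<in> ?\<phi> ` ?I"
    then obtain t where t: "t \<in> ?I" "p = ?\<phi> t" by blast
    obtain hs l gs where t': "t = (hs, l, gs)" by (cases t)
    have p: "p = (hs, gs)" "hs \<in> shifts L j" "gs \<in> shifts D j"
        "\<bar>c * prod_list hs * prod_list gs * (2 * l + sum_list hs)\<bar> = int n"
      using t unfolding t' mem_Collect_eq prod.case by blast+
    have "prod_list hs dvd \<bar>c * prod_list hs * prod_list gs * (2 * l + sum_list hs)\<bar>"
      "prod_list gs dvd \<bar>c * prod_list hs * prod_list gs * (2 * l + sum_list hs)\<bar>"
      unfolding dvd_abs_iff
      by ((rule dvd_mult2, rule dvd_mult2, rule dvd_triv_right), (rule dvd_mult2, rule dvd_triv_right))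
    then have "prod_list hs dvd int n" "prod_list gs dvd int n" by (simp_all only: p(4))
    then show "p \<in> divisor_lists n j \<times> divisor_lists n j"
      unfolding p(1) using p(2,3) shifts_subset_divisor_lists by blast
  qed
  have inj: "inj_on ?\<phi> ?I"
  proof (rule inj_onI)
    fix x y assume x: "x \<in> ?I" and y: "y \<in> ?I" and e: "?\<phi> x = ?\<phi> y"
    obtain hs l gs where x': "x = (hs, l, gs)" by (cases x) auto
    obtain l' where y': "y = (hs, l', gs)" using e x' by (cases y) auto
    have px: "\<bar>c\<bar> * \<bar>prod_list hs\<bar> * \<bar>prod_list gs\<bar> * \<bar>2 * l + sum_list hs\<bar> = int n" "1 \<le> l" "l \<le> int L" "1 \<le> l + sum_list hs" "l + sum_list hs \<le> int L"
      using x unfolding x' mem_Collect_eq prod.case abs_mult atLeastAtMost_iff by blast+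
    have py: "\<bar>c\<bar> * \<bar>prod_list hs\<bar> * \<bar>prod_list gs\<bar> * \<bar>2 * l' + sum_list hs\<bar> = int n" "1 \<le> l'" "l' \<le> int L" "1 \<le> l' + sum_list hs" "l' + sum_list hs \<le> int L"
      using y unfolding y' mem_Collect_eq prod.case abs_mult atLeastAtMost_iff by blast+
    have "\<bar>c\<bar> * \<bar>prod_list hs\<bar> * \<bar>prod_list gs\<bar> \<noteq> 0"
    proof
      assume "\<bar>c\<bar> * \<bar>prod_list hs\<bar> * \<bar>prod_list gs\<bar> = 0"
      with px(1) have "0 * \<bar>2 * l + sum_list hs\<bar> = int n" by (simp only:)
      with n show False by simp
    qed
    moreover have "\<bar>c\<bar> * \<bar>prod_list hs\<bar> * \<bar>prod_list gs\<bar> * \<bar>2 * l + sum_list hs\<bar>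
        = \<bar>c\<bar> * \<bar>prod_list hs\<bar> * \<bar>prod_list gs\<bar> * \<bar>2 * l' + sum_list hs\<bar>"
      unfolding px(1) py(1) ..
    ultimately have "\<bar>2 * l + sum_list hs\<bar> = \<bar>2 * l' + sum_list hs\<bar>"
      by (rule mult_left_cancel[THEN iffD1])
    moreover have "0 < 2 * l + sum_list hs" "0 < 2 * l' + sum_list hs" using px(2-5) py(2-5) by linarith+
    ultimately have "l = l'" by (simp only: abs_of_pos)
    then show "x = y" by (simp add: x' y')
  qed
  have "card ?I = card (?\<phi> ` ?I)" by (rule card_image[OF inj, symmetric])
  also have "\<dots> \<le> card (divisor_lists n j \<times> divisor_lists n j)"
    by (rule card_mono[OF _ sub]) (simp add: divisor_lists_finite_card[OF n])
  also have "\<dots> = card (divisor_lists n j) * card (divisor_lists n j)" by (rule card_cartesian_product)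
  also have "\<dots> \<le> (2 * tau n) ^ j * (2 * tau n) ^ j" by (intro mult_mono divisor_lists_finite_card[OF n]) auto
  finally show ?thesis by (simp only: mult_2[of j] power_add)
qed

text \<open>Every entry of gs divides n, and gs determines r ^ k and thereby r; hence r itself costs
  no divisor factor.\<close>

lemma card_power_fibre_le:
  assumes c: "1 \<le> c" and n: "0 < n" and k: "1 \<le> k"
  shows "card {(r, gs). r \<in> {Y..<2 * Y :: nat} \<and> gs \<in> shifts T j \<and> \<bar>c * prod_list gs * int r ^ k\<bar> = int n} \<le> (2 * tau n) ^ j"
    (is "card ?I \<le> _")
proof -
  let ?\<phi> = "\<lambda>(r :: nat, gs :: int list). gs"
  have sub: "?\<phi> ` ?I \<subseteq> divisor_lists n j"
  proof
    fix p assume "p \<in> ?\<phi> ` ?I"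
    then obtain r where p: "p \<in> shifts T j" "\<bar>c * prod_list p * int r ^ k\<bar> = int n" by auto
    have "prod_list p dvd \<bar>c * prod_list p * int r ^ k\<bar>" by auto
    then have "prod_list p dvd int n" by (simp only: p(2))
    then show "p \<in> divisor_lists n j" by (rule shifts_subset_divisor_lists[OF p(1)])
  qed
  have inj: "inj_on ?\<phi> ?I"
  proof (rule inj_onI)
    fix x y assume x: "x \<in> ?I" and y: "y \<in> ?I" and e: "?\<phi> x = ?\<phi> y"
    obtain r gs where x': "x = (r, gs)" by (cases x) auto
    obtain r' where y': "y = (r', gs)" using e x' by (cases y) auto
    have px: "\<bar>c * prod_list gs\<bar> * int r ^ k = int n" using x x' by (simp add: abs_mult)
    have py: "\<bar>c * prod_list gs\<bar> * int r' ^ k = int n" using y y' by (simp add: abs_mult)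
    have "\<bar>c * prod_list gs\<bar> \<noteq> 0" using px n by auto
    moreover have "\<bar>c * prod_list gs\<bar> * int r ^ k = \<bar>c * prod_list gs\<bar> * int r' ^ k"
      unfolding px py ..
    ultimately have "int r ^ k = int r' ^ k" by (rule mult_left_cancel[THEN iffD1])
    then have "int r = int r'" using k by (intro power_eq_imp_eq_base[of "int r" k]) auto
    then show "x = y" by (simp add: x' y')
  qed
  have "card ?I = card (?\<phi> ` ?I)" by (rule card_image[OF inj, symmetric])
  also have "\<dots> \<le> card (divisor_lists n j)"
    by (rule card_mono[OF _ sub]) (simp add: divisor_lists_finite_card[OF n])
  also have "\<dots> \<le> (2 * tau n) ^ j" by (rule divisor_lists_finite_card[OF n])
  finally show ?thesis .
qed

section \<open>Combining the two rounds of differencing\<close>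

lemma add_power_le: "0 \<le> x \<Longrightarrow> 0 \<le> y \<Longrightarrow> (x + y) ^ K \<le> 2 ^ K * (x ^ K + y ^ K :: real)"
proof -
  assume xy: "0 \<le> x" "0 \<le> y"
  have "(x + y) ^ K \<le> (2 * max x y) ^ K" using xy by (intro power_mono) auto
  also have "\<dots> = 2 ^ K * max x y ^ K" by (rule power_mult_distrib)
  also have "max x y ^ K \<le> x ^ K + y ^ K" using xy by (cases "x \<le> y") (auto simp: max_def)
  finally show ?thesis by simp
qed

text \<open>The algebra of the two rounds, separated from the sums. It is applied with K = 2 ^ j, s
  = j + 1, x = 2 L + 1 and y = 2 D + 1. Here h1 is the first round, h2 the contribution of the
  degenerate shift vectors, h3 a power mean over the others, and h4 the second round.\<close>

lemma two_stage_combine: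
  fixes S T d x y J bad G V Z :: real and K s :: nat
  assumes pos: "0 < d" "0 < x" "0 < y" "0 \<le> bad" "0 \<le> G" "0 \<le> S" "0 \<le> T"
    and h1: "S ^ K * (d * x ^ s) \<le> T ^ K * (bad + G)"
    and h2: "bad * x \<le> d * (J * x ^ s)"
    and h3: "G ^ K * x ^ s \<le> (x ^ s) ^ K * Z"
    and h4: "Z * y ^ s \<le> y ^ K * V"
  shows "S ^ (K * K) \<le> 2 ^ K * T ^ (K * K) * ((J / x) ^ K + (y / d) ^ K * (V / (x * y) ^ s))"
proof -
  define Q where "Q = d * x ^ s"
  have Q: "0 < Q" using pos by (simp add: Q_def)
  have "S ^ K \<le> T ^ K * ((bad + G) / Q)" using h1 Q by (simp add: Q_def field_simps)
  then have "(S ^ K) ^ K \<le> (T ^ K * ((bad + G) / Q)) ^ K" using pos by (intro power_mono) auto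
  also have "\<dots> = T ^ (K * K) * ((bad + G) ^ K / Q ^ K)" by (simp add: power_mult_distrib power_divide power_mult)
  also have "\<dots> \<le> T ^ (K * K) * ((2 ^ K * (bad ^ K + G ^ K)) / Q ^ K)"
    using pos Q by (intro mult_left_mono divide_right_mono add_power_le) auto
  also have "\<dots> = 2 ^ K * T ^ (K * K) * ((bad / Q) ^ K + G ^ K / Q ^ K)"
    using Q by (simp add: power_divide field_simps)
  also have "\<dots> \<le> 2 ^ K * T ^ (K * K) * ((J / x) ^ K + (y / d) ^ K * (V / (x * y) ^ s))"
  proof (intro mult_left_mono add_mono)
    have "bad / Q \<le> J / x" using h2 pos Q by (simp add: Q_def field_simps)
    then show "(bad / Q) ^ K \<le> (J / x) ^ K" using pos Q by (intro power_mono) auto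
    have xs: "0 < x ^ s" "0 < y ^ s" using pos by auto
    have "G ^ K \<le> (x ^ s) ^ K * Z / x ^ s" using h3 xs by (simp add: field_simps)
    also have "\<dots> \<le> (x ^ s) ^ K * (y ^ K * V / y ^ s) / x ^ s"
      using h4 xs by (intro divide_right_mono mult_left_mono) (auto simp: field_simps)
    finally have "G ^ K / Q ^ K \<le> ((x ^ s) ^ K * (y ^ K * V / y ^ s) / x ^ s) / Q ^ K"
      using Q by (intro divide_right_mono) auto
    also have "\<dots> = (y / d) ^ K * (V / (x * y) ^ s)"
      using pos xs by (simp add: Q_def power_mult_distrib power_divide field_simps)
    finally show "G ^ K / Q ^ K \<le> (y / d) ^ K * (V / (x * y) ^ s)" .
  qed (use pos in auto)
  finally show ?thesis by (simp add: power_mult)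
qed

lemma power_diff_mult: "n \<le> m \<Longrightarrow> (x::real) ^ (m - n) * x ^ n = x ^ m"
  by (simp flip: power_add)

text \<open>A zero shift makes the frequency 0, so only the cap D is available; such lists are rare
  enough for this to cost no more than j (2 D + 1) ^ j.\<close>

lemma sum_split_zero_lists:
  fixes f :: "int list \<Rightarrow> real"
  assumes f: "\<And>gs. f gs \<le> real D"
  shows "(\<Sum>gs\<in>shifts D j. f gs) \<le> real j * real (2 * D + 1) ^ j + (\<Sum>gs\<in>{gs\<in>shifts D j. 0 \<notin> set gs}. f gs)"
proof -
  let ?Z = "{gs\<in>shifts D j. 0 \<in> set gs}"
  have "(\<Sum>gs\<in>shifts D j. f gs) = (\<Sum>gs\<in>?Z \<union> {gs\<in>shifts D j. 0 \<notin> set gs}. f gs)"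
    by (rule sum.cong) auto
  also have "\<dots> = (\<Sum>gs\<in>?Z. f gs) + (\<Sum>gs\<in>{gs\<in>shifts D j. 0 \<notin> set gs}. f gs)"
    by (rule sum.union_disjoint) auto
  also have "(\<Sum>gs\<in>?Z. f gs) \<le> (\<Sum>gs\<in>?Z. real D)" by (rule sum_mono[OF f])
  also have "\<dots> = real (card ?Z) * real D" by simp
  also have "\<dots> \<le> real (card ?Z) * real (2 * D + 1)" by (intro mult_left_mono) auto
  also have "\<dots> \<le> real j * real (2 * D + 1) ^ j" by (rule card_shifts_with_zero)
  finally show ?thesis by simp
qed

lemma prod_list_neq_0: "0 \<notin> set hs \<Longrightarrow> prod_list hs \<noteq> (0::int)"
  by (induction hs) auto

text \<open>One factorial comes from the differencing in d, the other from the j-th difference of l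
  ^ (j + 1). The latter is a multiple of l + sum_list hs / 2; the half is taken from the factorial
  so that an integer remains.\<close>

definition weyl_const :: "nat \<Rightarrow> nat" where
  "weyl_const j = fact (Suc j) * (fact (Suc j) div 2)"

lemma two_fact_div_two: "1 \<le> j \<Longrightarrow> 2 * (fact (Suc j) div 2) = (fact (Suc j) :: nat)"
proof -
  assume "1 \<le> j"
  then have "2 dvd (fact (Suc j) :: nat)" by (intro dvd_fact) auto
  then show ?thesis by simp
qed

lemma weyl_const_pos: "1 \<le> j \<Longrightarrow> 1 \<le> weyl_const j"
proof -
  assume j: "1 \<le> j"
  have f: "0 < (fact (Suc j) :: nat)" by simp
  with two_fact_div_two[OF j] have "0 < (fact (Suc j) div 2 :: nat)" by linarith
  with f have "0 < weyl_const j" unfolding weyl_const_def by (rule mult_pos_pos)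
  then show ?thesis by simp
qed

text \<open>The product (1 / (q d) + \<mu>) (d + q) is exactly the bracket on the right; the rest
  keeps track of constants.\<close>

lemma mean_value_term_le:
  fixes c q d \<mu> ell :: real
  assumes "1 \<le> c" "0 < q" "0 < d" "0 \<le> \<mu>" "1 \<le> ell"
  shows "(4 * c / (q * d) + 3 * \<mu>) * (2 * d + 4 * q * ell) \<le> (16 * c + 12) * ell * (1 / q + 1 / d + \<mu> * (d + q))"
proof -
  have "d * 1 \<le> d * ell" using assms by (intro mult_left_mono) auto
  then have "2 * d + 4 * q * ell \<le> 4 * ell * (d + q)" using assms by (simp add: algebra_simps)
  moreover have "4 * c / (q * d) + 3 * \<mu> \<le> (4 * c + 3) * (1 / (q * d) + \<mu>)"
    using assms by (simp add: algebra_simps)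
  ultimately have "(4 * c / (q * d) + 3 * \<mu>) * (2 * d + 4 * q * ell) \<le> ((4 * c + 3) * (1 / (q * d) + \<mu>)) * (4 * ell * (d + q))"
    using assms by (intro mult_mono) auto
  also have "\<dots> = (16 * c + 12) * ell * (1 / q + 1 / d + \<mu> * (d + q))"
    using assms by (simp add: field_simps)
  finally show ?thesis .
qed

text \<open>In the last bracket the power of L comes from degenerate shifts of l, a first 1 / D from
  degenerate shifts of d, and the spacing sum gives 1 / q, again 1 / D, and the term with M. The
  exponent 2 j of 2 t counts all shifts; once they are fixed, l is determined by the value of the
  product.\<close>

lemma type_II_bound:
  fixes a b :: "int \<Rightarrow> complex" and g :: "real poly" and X :: int
  assumes \<alpha>: "rat_approx \<alpha> h q" and M: "1 \<le> M" and j: "1 \<le> j" and DL: "1 \<le> D" "1 \<le> L"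
    and g: "degree g \<le> Suc j" "coeff g (Suc j) = \<alpha> / real M"
    and AB: "\<And>d. norm (a d) \<le> A" "\<And>l. norm (b l) \<le> B"
    and t: "1 \<le> t" "\<And>n. 1 \<le> n \<Longrightarrow> n \<le> weyl_const j * L ^ j * D ^ j * (2 * L) \<Longrightarrow> real (tau n) \<le> t"
  shows "norm (\<Sum>d\<in>{1..int D}. a d * (\<Sum>l\<in>{1..int L}. if d * l \<le> X then b l * e2pi (poly g (of_int (d * l))) else 0)) ^ (2 ^ j * 2 ^ j)
    \<le> 2 ^ 2 ^ j * (3 * (A * B * real D * real L)) ^ (2 ^ j * 2 ^ j) * (3 ^ 2 ^ j * (real j ^ 2 ^ j + real j + 16 * real (weyl_const j) + 12)) *
       ((2 * t) ^ (2 * j) * (1 + ln (real q))) *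
       (1 / real L ^ 2 ^ j + 1 / real q + 1 / real D + real M / (real D * real L) ^ Suc j * (real D + real q))"
proof -
  define K where "K = (2::nat) ^ j"
  define s where "s = Suc j"
  define c where "c = weyl_const j"
  define R where "R = c * L ^ j * D ^ j * (2 * L)"
  define x where "x = real (2 * L + 1)"
  define y where "y = real (2 * D + 1)"
  define d where "d = real D"
  define l where "l = real L"
  define J where "J = real j"
  define ell where "ell = 1 + ln (real q)"
  define \<rho> where "\<rho> = (2 * t) ^ (2 * j)"
  define S where "S = norm (\<Sum>d\<in>{1..int D}. a d * (\<Sum>l\<in>{1..int L}. if d * l \<le> X then b l * e2pi (poly g (of_int (d * l))) else 0))"
  define w where "w = (\<lambda>hs l gs. wmin d (fact (Suc j) * of_int (prod_list gs) * (coeff g (Suc j) * rdiffs hs (\<lambda>x. of_int x ^ Suc j) l)))"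
  define Ls where "Ls = (\<lambda>hs::int list. {l\<in>{1..int L}. l + sum_list hs \<in> {1..int L}})"
  have q: "1 \<le> q" using \<alpha> by (simp add: rat_approx_def)
  have ell1: "1 \<le> ell" using q by (simp add: ell_def)
  have c1: "1 \<le> c" unfolding c_def by (rule weyl_const_pos[OF j])
  have dl: "1 \<le> d" "1 \<le> l" "d \<le> y" "l \<le> x" "y \<le> 3 * d" "x \<le> 3 * l" "0 < x" "0 < y"
    using DL by (auto simp: d_def l_def x_def y_def)
  have K1: "1 \<le> K" "s \<le> K" unfolding K_def s_def using two_power_ge_Suc by auto
  have \<rho>1: "1 \<le> \<rho>" unfolding \<rho>_def using t(1) by (intro one_le_power) auto
  have A0: "0 \<le> A" and B0: "0 \<le> B"
    using AB(1)[of 0] AB(2)[of 0] norm_ge_zero[of "a 0"] norm_ge_zero[of "b 0"] by linarith+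
  have S0: "0 \<le> S" by (simp add: S_def)
  obtain e where e: "\<And>hs l. 0 \<le> e hs l" "\<And>hs l. e hs l \<le> d" "\<And>hs l. e hs l ^ K \<le> y ^ (K - s) * (\<Sum>gs\<in>shifts D j. w hs l gs)"
    and Se: "S ^ K \<le> A ^ K * d ^ (K - 1) * x ^ (K - s) * B ^ K * (\<Sum>hs\<in>shifts L j. \<Sum>l\<in>Ls hs. e hs l)"
    using bilinear_weyl[where a = a and A = A and b = b and B = B and D = D and L = L and X = X, OF j g(1) AB]
    unfolding K_def s_def x_def y_def d_def S_def w_def Ls_def by blast
  define H0 where "H0 = (SIGMA hs:{hs\<in>shifts L j. 0 \<in> set hs}. Ls hs)"
  define H1 where "H1 = (SIGMA hs:{hs\<in>shifts L j. 0 \<notin> set hs}. Ls hs)"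
  have finL: "finite (Ls hs)" "card (Ls hs) \<le> L" for hs
  proof -
    show "finite (Ls hs)" by (rule finite_subset[of _ "{1..int L}"]) (auto simp: Ls_def)
    have "card (Ls hs) \<le> card {1..int L}" by (rule card_mono) (auto simp: Ls_def)
    then show "card (Ls hs) \<le> L" by simp
  qed
  have finH: "finite H0" "finite H1" unfolding H0_def H1_def by (auto intro!: finite_SigmaI finL(1))
  define bad where "bad = (\<Sum>(hs, l)\<in>H0. e hs l)"
  define G where "G = (\<Sum>(hs, l)\<in>H1. e hs l)"
  have bG: "0 \<le> bad" "0 \<le> G" unfolding bad_def G_def using e(1) by (auto intro!: sum_nonneg)
  have split: "(\<Sum>hs\<in>shifts L j. \<Sum>l\<in>Ls hs. e hs l) = bad + G"
  proof -
    have "(\<Sum>hs\<in>shifts L j. \<Sum>l\<in>Ls hs. e hs l) = (\<Sum>(hs, l)\<in>(SIGMA hs:shifts L j. Ls hs). e hs l)"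
      by (rule sum.Sigma) (auto intro: finL)
    also have "\<dots> = (\<Sum>(hs, l)\<in>H0 \<union> H1. e hs l)"
      by (rule sum.cong) (auto simp: H0_def H1_def)
    also have "\<dots> = bad + G"
      unfolding bad_def G_def by (rule sum.union_disjoint[OF finH]) (auto simp: H0_def H1_def)
    finally show ?thesis .
  qed
  have cards: "card H0 \<le> card {hs\<in>shifts L j. 0 \<in> set hs} * L" "card H1 \<le> (2 * L + 1) ^ s"
  proof -
    have "card H0 = (\<Sum>hs\<in>{hs\<in>shifts L j. 0 \<in> set hs}. card (Ls hs))"
      unfolding H0_def by (rule card_SigmaI) (auto intro: finL)
    also have "\<dots> \<le> (\<Sum>hs\<in>{hs\<in>shifts L j. 0 \<in> set hs}. L)" by (rule sum_mono[OF finL(2)])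
    finally show "card H0 \<le> card {hs\<in>shifts L j. 0 \<in> set hs} * L" by simp
    have "card H1 = (\<Sum>hs\<in>{hs\<in>shifts L j. 0 \<notin> set hs}. card (Ls hs))"
      unfolding H1_def by (rule card_SigmaI) (auto intro: finL)
    also have "\<dots> \<le> (\<Sum>hs\<in>{hs\<in>shifts L j. 0 \<notin> set hs}. L)" by (rule sum_mono[OF finL(2)])
    also have "\<dots> = card {hs\<in>shifts L j. 0 \<notin> set hs} * L" by simp
    also have "\<dots> \<le> card (shifts L j) * (2 * L + 1)" by (intro mult_mono card_mono) auto
    finally show "card H1 \<le> (2 * L + 1) ^ s" by (simp add: card_shifts s_def mult.commute)
  qed
  define T where "T = A * B * d * x"
  have T0: "0 \<le> T" unfolding T_def using A0 B0 dl by auto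
  have h1: "S ^ K * (d * x ^ s) \<le> T ^ K * (bad + G)"
  proof -
    have "S ^ K * (d * x ^ s) \<le> (A ^ K * d ^ (K - 1) * x ^ (K - s) * B ^ K * (bad + G)) * (d * x ^ s)"
      using Se[unfolded split] dl by (intro mult_right_mono) auto
    also have "\<dots> = A ^ K * B ^ K * (d ^ (K - 1) * d ^ 1) * (x ^ (K - s) * x ^ s) * (bad + G)" by simp
    also have "\<dots> = A ^ K * B ^ K * d ^ K * x ^ K * (bad + G)"
      using power_diff_mult[OF K1(1), of d] power_diff_mult[OF K1(2), of x] by (simp only:)
    finally show ?thesis by (simp only: T_def power_mult_distrib)
  qed
  have h2: "bad * x \<le> d * (J * x ^ s)"
  proof -
    have "bad \<le> (\<Sum>(hs, l)\<in>H0. d)" unfolding bad_def using e(2) by (intro sum_mono) auto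
    also have "\<dots> = real (card H0) * d" by (simp add: case_prod_unfold)
    also have "real (card H0) * d \<le> (real (card {hs\<in>shifts L j. 0 \<in> set hs}) * l) * d"
    proof (rule mult_right_mono)
      have "real (card H0) \<le> real (card {hs\<in>shifts L j. 0 \<in> set hs} * L)" by (rule of_nat_mono[OF cards(1)])
      then show "real (card H0) \<le> real (card {hs\<in>shifts L j. 0 \<in> set hs}) * l" by (simp add: l_def)
    qed (use dl in simp)
    finally have "bad * x \<le> ((real (card {hs\<in>shifts L j. 0 \<in> set hs}) * l) * d) * x" using dl by (intro mult_right_mono) auto
    also have "\<dots> = (real (card {hs\<in>shifts L j. 0 \<in> set hs}) * x) * (l * d)" by simp
    also have "\<dots> \<le> (J * x ^ j) * (x * d)"
    proof (rule mult_mono)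
      show "real (card {hs\<in>shifts L j. 0 \<in> set hs}) * x \<le> J * x ^ j"
        unfolding J_def x_def by (rule card_shifts_with_zero)
    qed (use dl in \<open>auto simp: J_def\<close>)
    also have "\<dots> = d * (J * x ^ s)" by (simp add: s_def)
    finally show ?thesis .
  qed
  define Z where "Z = (\<Sum>(hs, l)\<in>H1. e hs l ^ K)"
  have Z0: "0 \<le> Z" unfolding Z_def using e(1) by (auto intro!: sum_nonneg)
  have cH1: "real (card H1) \<le> x ^ s"
    using of_nat_mono[OF cards(2), where 'a = real] by (simp only: x_def of_nat_power)
  have h3: "G ^ K * x ^ s \<le> (x ^ s) ^ K * Z"
  proof -
    have "G ^ K \<le> real (card H1) ^ (K - 1) * Z"
      using power_mean_pow2[of H1 "\<lambda>(hs, l). e hs l" j] e(1) unfolding G_def Z_def K_def by (simp add: case_prod_unfold)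
    also have "\<dots> \<le> (x ^ s) ^ (K - 1) * Z" using cH1 Z0 by (intro mult_right_mono power_mono) auto
    finally have "G ^ K * x ^ s \<le> ((x ^ s) ^ (K - 1) * Z) * x ^ s" using dl by (intro mult_right_mono) auto
    also have "\<dots> = ((x ^ s) ^ (K - 1) * (x ^ s) ^ 1) * Z" by simp
    also have "\<dots> = (x ^ s) ^ K * Z" using power_diff_mult[OF K1(1), of "x ^ s"] by (simp only:)
    finally show ?thesis .
  qed
  define W where "W = 2 * d + 4 * real q * ell"
  define N1 where "N1 = (2 * real R / real q + 3 * real M) * W"
  define V where "V = x ^ s * (J * y ^ j) + \<rho> * N1"
  have wd: "w hs l gs \<le> d" for hs l gs unfolding w_def using dl by (intro wmin_le) auto
  have h4: "Z * y ^ s \<le> y ^ K * V"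
  proof -
    have "Z \<le> (\<Sum>(hs, l)\<in>H1. y ^ (K - s) * (\<Sum>gs\<in>shifts D j. w hs l gs))"
      unfolding Z_def using e(3) by (intro sum_mono) auto
    also have "\<dots> = y ^ (K - s) * (\<Sum>(hs, l)\<in>H1. \<Sum>gs\<in>shifts D j. w hs l gs)"
      unfolding sum_distrib_left case_prod_unfold ..
    also have "\<dots> \<le> y ^ (K - s) * V"
    proof (rule mult_left_mono)
      have "(\<Sum>(hs, l)\<in>H1. \<Sum>gs\<in>shifts D j. w hs l gs)
         \<le> (\<Sum>(hs, l)\<in>H1. J * y ^ j + (\<Sum>gs\<in>{gs\<in>shifts D j. 0 \<notin> set gs}. w hs l gs))"
      proof (rule sum_mono)
        fix p assume "p \<in> H1"
        show "(case p of (hs, l) \<Rightarrow> \<Sum>gs\<in>shifts D j. w hs l gs) \<le> (case p of (hs, l) \<Rightarrow> J * y ^ j + (\<Sum>gs\<in>{gs\<in>shifts D j. 0 \<notin> set gs}. w hs l gs))"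
          unfolding case_prod_unfold J_def y_def by (rule sum_split_zero_lists) (use wd in \<open>simp add: d_def\<close>)
      qed
      also have "\<dots> = real (card H1) * (J * y ^ j) + (\<Sum>(hs, l)\<in>H1. \<Sum>gs\<in>{gs\<in>shifts D j. 0 \<notin> set gs}. w hs l gs)"
        by (simp add: case_prod_unfold sum.distrib)
      also have "\<dots> \<le> x ^ s * (J * y ^ j) + \<rho> * N1"
      proof (rule add_mono)
        show "real (card H1) * (J * y ^ j) \<le> x ^ s * (J * y ^ j)"
          using cH1 dl by (intro mult_right_mono) (auto simp: J_def)
        define I where "I = H1 \<times> {gs\<in>shifts D j. 0 \<notin> set gs}"
        define \<nu> where "\<nu> = (\<lambda>((hs, l), gs). int c * prod_list hs * prod_list gs * (2 * l + sum_list hs))"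
        have "(\<Sum>(hs, l)\<in>H1. \<Sum>gs\<in>{gs\<in>shifts D j. 0 \<notin> set gs}. w hs l gs)
            = (\<Sum>p\<in>H1. \<Sum>gs\<in>{gs\<in>shifts D j. 0 \<notin> set gs}. w (fst p) (snd p) gs)"
          by (simp only: case_prod_unfold)
        also have "\<dots> = (\<Sum>(p, gs)\<in>I. w (fst p) (snd p) gs)"
          unfolding I_def by (rule sum.cartesian_product)
        also have "\<dots> = (\<Sum>i\<in>I. wmin d (\<alpha> / real M * of_int (\<nu> i)))"
        proof (rule sum.cong[OF refl])
          fix i assume "i \<in> I"
          then obtain hs l gs where i: "i = ((hs, l), gs)" "hs \<in> shifts L j" by (auto simp: I_def H1_def)
          have len: "Suc j = Suc (length hs)" using i(2) by (simp add: shifts_def)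
          \<comment> \<open>A factor 2 is split off from the factorial because
            \<open>rdiffs_power\<close> evaluates twice the iterated difference.\<close>
          have "real (2 * (fact (Suc j) div 2)) = real (fact (Suc j))" by (simp only: two_fact_div_two[OF j])
          then have f2: "(fact (Suc j) :: real) = 2 * real (fact (Suc j) div 2)" by (simp del: fact_Suc)
          have "fact (Suc j) * of_int (prod_list gs) * (coeff g (Suc j) * rdiffs hs (\<lambda>x. of_int x ^ Suc j) l)
             = real (fact (Suc j) div 2) * of_int (prod_list gs) * coeff g (Suc j) * (2 * rdiffs hs (\<lambda>x. of_int x ^ Suc j) l)"
            by (subst f2) simp
          also have "\<dots> = real (fact (Suc j) div 2) * of_int (prod_list gs) * coeff g (Suc j) * (fact (Suc j) * of_int (prod_list hs) * of_int (2 * l + sum_list hs))"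
            by (simp only: rdiffs_power[OF len])
          also have "\<dots> = \<alpha> / real M * of_int (\<nu> i)"
            unfolding g(2) \<nu>_def i c_def weyl_const_def by (simp del: fact_Suc)
          finally show "(case i of (p, gs) \<Rightarrow> w (fst p) (snd p) gs) = wmin d (\<alpha> / real M * of_int (\<nu> i))"
            by (simp only: i w_def prod.case fst_conv snd_conv)
        qed
        also have "\<dots> \<le> \<rho> * ((2 * real R / real q + 3 * real M) * (2 * d + 4 * real q * (1 + ln (real q))))"
        proof (rule sum_wmin_multiples[OF \<alpha> M])
          show "0 \<le> d" using dl by simp
          show "finite I" unfolding I_def by (intro finite_cartesian_product finH(2)) simp
          show "0 \<le> \<rho>" using \<rho>1 by simp
          fix i assume iI: "i \<in> I"
          then obtain hs l gs where i: "i = ((hs, l), gs)" "hs \<in> shifts L j" "0 \<notin> set hs" "gs \<in> shifts D j" "0 \<notin> set gs"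
              "1 \<le> l" "l \<le> int L" "1 \<le> l + sum_list hs" "l + sum_list hs \<le> int L"
            by (auto simp: I_def H1_def Ls_def)
          have p: "0 < 2 * l + sum_list hs" "2 * l + sum_list hs \<le> int (2 * L)" using i by linarith+
          have "prod_list hs \<noteq> 0" "prod_list gs \<noteq> 0" using i by (auto simp: prod_list_neq_0)
          then show "\<nu> i \<noteq> 0" using p c1 by (simp add: \<nu>_def i)
          have ah: "\<bar>prod_list hs\<bar> \<le> int L ^ j" "\<bar>prod_list gs\<bar> \<le> int D ^ j"
            using abs_prod_list_le[of hs L] abs_prod_list_le[of gs D] i by (auto simp: shifts_def)
          have "\<bar>\<nu> i\<bar> = int c * \<bar>prod_list hs\<bar> * \<bar>prod_list gs\<bar> * (2 * l + sum_list hs)"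
            using p by (simp add: \<nu>_def i abs_mult)
          also have "\<dots> \<le> int c * int L ^ j * int D ^ j * int (2 * L)"
            using ah p by (intro mult_mono mult_nonneg_nonneg) auto
          also have "\<dots> = int R" by (simp add: R_def)
          finally show "\<bar>\<nu> i\<bar> \<le> int R" .
        next
          fix n assume n: "n \<in> {1..R}"
          let ?B = "{(hs, l, gs). hs \<in> shifts L j \<and> gs \<in> shifts D j \<and> l \<in> {1..int L} \<and> l + sum_list hs \<in> {1..int L} \<and>
           \<bar>int c * prod_list hs * prod_list gs * (2 * l + sum_list hs)\<bar> = int n}"
          have finB: "finite ?B"
            by (rule finite_subset[of _ "shifts L j \<times> {1..int L} \<times> shifts D j"]) auto
          have "card {i\<in>I. \<bar>\<nu> i\<bar> = int n} \<le> card ?B"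
          proof (rule card_inj_on_le[where f = "\<lambda>((hs, l), gs). (hs, l, gs)", OF _ _ finB])
            show "inj_on (\<lambda>((hs, l), gs). (hs, l, gs)) {i\<in>I. \<bar>\<nu> i\<bar> = int n}" by (rule inj_onI) auto
            show "(\<lambda>((hs, l), gs). (hs, l, gs)) ` {i\<in>I. \<bar>\<nu> i\<bar> = int n} \<subseteq> ?B"
            proof
              fix z assume "z \<in> (\<lambda>((hs, l), gs). (hs, l, gs)) ` {i\<in>I. \<bar>\<nu> i\<bar> = int n}"
              then obtain i where i: "i \<in> I" "\<bar>\<nu> i\<bar> = int n" "z = (\<lambda>((hs, l), gs). (hs, l, gs)) i" by blast
              obtain hs l gs where i': "i = ((hs, l), gs)" by (metis surj_pair)
              show "z \<in> ?B"
                using i unfolding i' \<nu>_def I_def H1_def Ls_def by simp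
            qed
          qed
          also have "\<dots> \<le> (2 * tau n) ^ (2 * j)"
            by (rule card_bilinear_fibre_le) (use c1 n in auto)
          finally have "real (card {i\<in>I. \<bar>\<nu> i\<bar> = int n}) \<le> real ((2 * tau n) ^ (2 * j))" by (rule of_nat_mono)
          also have "\<dots> = (2 * real (tau n)) ^ (2 * j)" by simp
          also have "\<dots> \<le> \<rho>" unfolding \<rho>_def
            using t(2)[of n] n by (intro power_mono mult_left_mono) (auto simp: R_def c_def)
          finally show "real (card {i\<in>I. \<bar>\<nu> i\<bar> = int n}) \<le> \<rho>" .
        qed
        finally show "(\<Sum>(hs, l)\<in>H1. \<Sum>gs\<in>{gs\<in>shifts D j. 0 \<notin> set gs}. w hs l gs) \<le> \<rho> * N1"
          by (simp only: N1_def W_def ell_def)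
      qed
      finally show "(\<Sum>(hs, l)\<in>H1. \<Sum>gs\<in>shifts D j. w hs l gs) \<le> V" by (simp only: V_def)
    qed (use dl in simp)
    finally have "Z * y ^ s \<le> (y ^ (K - s) * V) * y ^ s" using dl by (intro mult_right_mono) auto
    also have "\<dots> = (y ^ (K - s) * y ^ s) * V" by simp
    also have "\<dots> = y ^ K * V" by (simp only: power_diff_mult[OF K1(2)])
    finally show ?thesis .
  qed
  have main: "S ^ (K * K) \<le> 2 ^ K * T ^ (K * K) * ((J / x) ^ K + (y / d) ^ K * (V / (x * y) ^ s))"
    by (rule two_stage_combine[OF _ _ _ bG S0 T0 h1 h2 h3 h4]) (use dl in auto)
  define \<mu> where "\<mu> = real M / (d * l) ^ s"
  have \<mu>0: "0 \<le> \<mu>" using dl by (simp add: \<mu>_def)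
  define E where "E = 1 / l ^ K + 1 / real q + 1 / d + \<mu> * (d + real q)"
  have E0: "0 \<le> E" using dl \<mu>0 by (simp add: E_def)
  have N10: "0 \<le> N1" unfolding N1_def W_def using dl ell1 by (intro mult_nonneg_nonneg add_nonneg_nonneg) auto
  have p1: "(J / x) ^ K \<le> J ^ K * E"
  proof -
    have "(J / x) ^ K \<le> (J / l) ^ K" using dl by (intro power_mono divide_left_mono) (auto simp: J_def)
    also have "\<dots> = J ^ K * (1 / l ^ K)" by (simp add: power_divide)
    also have "\<dots> \<le> J ^ K * E" using dl \<mu>0 by (intro mult_left_mono) (auto simp: E_def J_def)
    finally show ?thesis .
  qed
  have p2: "(y / d) ^ K \<le> 3 ^ K" using dl by (intro power_mono) (auto simp: divide_le_eq)
  have p3: "V / (x * y) ^ s \<le> (J + 16 * real c + 12) * (\<rho> * ell) * E"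
  proof -
    have "V / (x * y) ^ s = J / y + \<rho> * (N1 / (x * y) ^ s)"
      using dl by (simp add: V_def power_mult_distrib s_def field_simps)
    also have "\<dots> \<le> J * E + \<rho> * ((16 * real c + 12) * ell * E)"
    proof (intro add_mono mult_left_mono)
      have "J / y \<le> J * (1 / d)" using dl by (simp add: J_def divide_left_mono)
      also have "\<dots> \<le> J * E" using dl \<mu>0 by (intro mult_left_mono) (auto simp: E_def J_def)
      finally show "J / y \<le> J * E" .
      have "N1 / (x * y) ^ s \<le> N1 / (d * l) ^ s"
      proof (rule divide_left_mono[OF _ N10])
        show "(d * l) ^ s \<le> (x * y) ^ s"
          using mult_mono[of d y l x] dl by (intro power_mono) (auto simp: mult.commute)
      qed (use dl in auto)
      also have "\<dots> = (4 * real c / (real q * d) + 3 * \<mu>) * (2 * d + 4 * real q * ell)"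
      proof -
        have "real R / (d * l) ^ s = 2 * real c / d"
          using dl by (simp add: R_def d_def[symmetric] l_def[symmetric] s_def power_mult_distrib field_simps)
        moreover have "2 * real R / real q / (d * l) ^ s = 2 / real q * (real R / (d * l) ^ s)"
          by simp
        ultimately have "2 * real R / real q / (d * l) ^ s = 4 * real c / (real q * d)"
          by simp
        then have "(2 * real R / real q + 3 * real M) / (d * l) ^ s = 4 * real c / (real q * d) + 3 * \<mu>"
          by (simp add: add_divide_distrib \<mu>_def)
        then show ?thesis by (simp add: N1_def W_def flip: times_divide_eq_left)
      qed
      also have "\<dots> \<le> (16 * real c + 12) * ell * (1 / real q + 1 / d + \<mu> * (d + real q))"
        by (rule mean_value_term_le) (use c1 q dl \<mu>0 ell1 in auto)
      also have "\<dots> \<le> (16 * real c + 12) * ell * E"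
        using ell1 dl by (intro mult_left_mono) (auto simp: E_def)
      finally show "N1 / (x * y) ^ s \<le> (16 * real c + 12) * ell * E" .
    qed (use \<rho>1 in auto)
    also have "J * E \<le> J * ((\<rho> * ell) * E)"
    proof -
      have "1 * 1 \<le> \<rho> * ell" using \<rho>1 ell1 by (intro mult_mono) auto
      then have "1 * E \<le> (\<rho> * ell) * E" using E0 by (intro mult_right_mono) auto
      then show ?thesis by (intro mult_left_mono) (auto simp: J_def)
    qed
    finally show ?thesis by (simp add: algebra_simps)
  qed
  have "1 \<le> \<rho> * ell" using mult_mono[OF \<rho>1 ell1] \<rho>1 by simp
  have "(J / x) ^ K + (y / d) ^ K * (V / (x * y) ^ s) \<le> J ^ K * E + 3 ^ K * ((J + 16 * real c + 12) * (\<rho> * ell) * E)"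
    using p1 p2 p3 dl N10 \<rho>1 by (intro add_mono mult_mono) (auto simp: V_def J_def)
  also have "J ^ K * E \<le> 3 ^ K * (J ^ K * (\<rho> * ell) * E)"
  proof -
    have "1 * (1 * (J ^ K * E)) \<le> 3 ^ K * ((\<rho> * ell) * (J ^ K * E))"
      using \<open>1 \<le> \<rho> * ell\<close> E0 by (intro mult_mono) (auto simp: J_def)
    then show ?thesis by (simp add: mult_ac)
  qed
  finally have comb: "(J / x) ^ K + (y / d) ^ K * (V / (x * y) ^ s) \<le> (3 ^ K * (J ^ K + J + 16 * real c + 12)) * (\<rho> * ell) * E"
    by (simp add: algebra_simps)
  have TT: "T ^ (K * K) \<le> (3 * (A * B * d * l)) ^ (K * K)"
  proof (rule power_mono[OF _ T0])
    have "A * B * d * x \<le> A * B * d * (3 * l)" using dl A0 B0 by (intro mult_left_mono) auto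
    then show "T \<le> 3 * (A * B * d * l)" by (simp add: T_def)
  qed
  have "S ^ (K * K) \<le> 2 ^ K * (3 * (A * B * d * l)) ^ (K * K) * ((3 ^ K * (J ^ K + J + 16 * real c + 12)) * (\<rho> * ell) * E)"
  proof (rule order_trans[OF main mult_mono])
    show "2 ^ K * T ^ (K * K) \<le> 2 ^ K * (3 * (A * B * d * l)) ^ (K * K)" using TT by simp
    show "0 \<le> 2 ^ K * (3 * (A * B * d * l)) ^ (K * K)" using A0 B0 dl by simp
    show "0 \<le> (J / x) ^ K + (y / d) ^ K * (V / (x * y) ^ s)"
      using dl \<rho>1 N10 by (intro add_nonneg_nonneg mult_nonneg_nonneg divide_nonneg_nonneg zero_le_power) (auto simp: J_def V_def)
  qed (rule comb)
  then show ?thesis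
    unfolding S_def K_def J_def c_def \<rho>_def ell_def E_def \<mu>_def s_def d_def l_def by (simp only: mult.assoc)
qed

text \<open>With absolute values inside the sum over r, only l can be differenced, and r enters as
  the factor r ^ (j + 1) of the frequency. The frequencies are spread over a range of order T ^ j *
  Y ^ (j + 1), although only about Y * T ^ j of them occur: this is the loss Y ^ j. The intervals
  may depend on r in any way, so that extremal ones can be inserted.\<close>

lemma type_I_bound:
  fixes g :: "real poly" and lo hi :: "nat \<Rightarrow> int"
  assumes \<alpha>: "rat_approx \<alpha> h q" and M: "1 \<le> M" and YT: "1 \<le> Y" "1 \<le> T"
    and g: "degree g \<le> Suc j" "coeff g (Suc j) = \<alpha> / real M"
    and I: "\<And>r. r \<in> {Y..<2 * Y} \<Longrightarrow> 1 \<le> lo r \<and> hi r \<le> int T"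
    and t: "1 \<le> t" "\<And>n. 1 \<le> n \<Longrightarrow> n \<le> fact (Suc j) * T ^ j * (2 * Y) ^ Suc j \<Longrightarrow> real (tau n) \<le> t"
  shows "(\<Sum>r\<in>{Y..<2 * Y}. norm (\<Sum>l\<in>{lo r..hi r}. e2pi (poly g (of_int (int r * l))))) ^ 2 ^ j
    \<le> (3 * (real Y * real T)) ^ 2 ^ j * (real j + 16 * (fact (Suc j) * 2 ^ Suc j) + 12) * ((2 * t) ^ j * (1 + ln (real q))) * real Y ^ j *
      (1 / real q + 1 / real T + real M / (real Y * real T) ^ Suc j * (real T + real q))"
proof -
  define K where "K = (2::nat) ^ j"
  define s where "s = Suc j"
  define c where "c = (fact s * 2 ^ s :: nat)"
  define R where "R = fact s * T ^ j * (2 * Y) ^ s"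
  define x where "x = real Y"
  define y where "y = real (2 * T + 1)"
  define d where "d = real T"
  define J where "J = real j"
  define ell where "ell = 1 + ln (real q)"
  define \<rho> where "\<rho> = (2 * t) ^ j"
  define S where "S = (\<lambda>r. norm (\<Sum>l\<in>{lo r..hi r}. e2pi (poly g (of_int (int r * l)))))"
  define w where "w = (\<lambda>(r::nat) gs. wmin d (fact s * of_int (prod_list gs) * (\<alpha> / real M * real r ^ s)))"
  let ?Y = "{Y..<2 * Y}"
  have q: "1 \<le> q" using \<alpha> by (simp add: rat_approx_def)
  have ell1: "1 \<le> ell" using q by (simp add: ell_def)
  have xd: "1 \<le> x" "1 \<le> d" "d \<le> y" "y \<le> 3 * d" "0 < y" using YT by (auto simp: x_def d_def y_def)
  have K1: "1 \<le> K" "s \<le> K" unfolding K_def s_def using two_power_ge_Suc by auto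
  have \<rho>1: "1 \<le> \<rho>" unfolding \<rho>_def using t(1) by (intro one_le_power) auto
  have c1: "1 \<le> c" unfolding c_def by (simp add: Suc_le_eq)
  have wd: "w r gs \<le> d" for r gs unfolding w_def using xd by (intro wmin_le) auto
  have Sr: "S r ^ K \<le> y ^ (K - s) * (\<Sum>gs\<in>shifts T j. w r gs)" if r: "r \<in> ?Y" for r
  proof -
    define p where "p = pcompose g [:0, real r:]"
    have dp: "degree p \<le> Suc j" unfolding p_def
      using degree_pcompose_le[of g "[:0, real r:]"] g(1) by (auto simp: degree_pCons_eq_if split: if_splits intro: order_trans)
    have cp: "coeff p (Suc j) = \<alpha> / real M * real r ^ s"
      unfolding p_def coeff_pcompose_linear g(2) by (simp add: s_def)
    have "S r = norm (\<Sum>l\<in>{lo r..hi r}. e2pi (poly p (of_int l)))"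
      by (simp add: S_def p_def poly_pcompose mult.commute)
    then show ?thesis
      unfolding K_def s_def y_def w_def d_def
      using weyl_inequality[OF dp, of "hi r" "lo r" T] I[OF r] unfolding cp s_def by simp
  qed
  define W where "W = 2 * d + 4 * real q * ell"
  define N1 where "N1 = (2 * real R / real q + 3 * real M) * W"
  define V where "V = x * (J * y ^ j) + \<rho> * N1"
  have V: "(\<Sum>r\<in>?Y. \<Sum>gs\<in>shifts T j. w r gs) \<le> V"
  proof -
    have "(\<Sum>r\<in>?Y. \<Sum>gs\<in>shifts T j. w r gs) \<le> (\<Sum>r\<in>?Y. J * y ^ j + (\<Sum>gs\<in>{gs\<in>shifts T j. 0 \<notin> set gs}. w r gs))"
      unfolding J_def y_def by (intro sum_mono sum_split_zero_lists) (use wd in \<open>simp add: d_def\<close>)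
    also have "\<dots> = x * (J * y ^ j) + (\<Sum>r\<in>?Y. \<Sum>gs\<in>{gs\<in>shifts T j. 0 \<notin> set gs}. w r gs)"
      by (simp add: sum.distrib x_def)
    also have "\<dots> \<le> x * (J * y ^ j) + \<rho> * N1"
    proof (rule add_left_mono)
      define I where "I = ?Y \<times> {gs\<in>shifts T j. 0 \<notin> set gs}"
      define \<nu> where "\<nu> = (\<lambda>(r::nat, gs). int (fact s) * prod_list gs * int r ^ s)"
      have "(\<Sum>r\<in>?Y. \<Sum>gs\<in>{gs\<in>shifts T j. 0 \<notin> set gs}. w r gs) = (\<Sum>(r, gs)\<in>I. w r gs)"
        unfolding I_def by (rule sum.cartesian_product)
      also have "\<dots> = (\<Sum>i\<in>I. wmin d (\<alpha> / real M * of_int (\<nu> i)))"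
        by (rule sum.cong[OF refl]) (auto simp: w_def \<nu>_def mult_ac)
      also have "\<dots> \<le> \<rho> * ((2 * real R / real q + 3 * real M) * (2 * d + 4 * real q * (1 + ln (real q))))"
      proof (rule sum_wmin_multiples[OF \<alpha> M])
        show "0 \<le> d" using xd by simp
        show "finite I" unfolding I_def by (intro finite_cartesian_product) auto
        show "0 \<le> \<rho>" using \<rho>1 by simp
        fix i assume "i \<in> I"
        then obtain r gs where i: "i = (r, gs)" "r \<in> ?Y" "gs \<in> shifts T j" "0 \<notin> set gs" by (auto simp: I_def)
        show "\<nu> i \<noteq> 0" using i YT prod_list_neq_0[of gs] by (simp add: \<nu>_def)
        have ah: "\<bar>prod_list gs\<bar> \<le> int T ^ j"
          using abs_prod_list_le[of gs T] i by (auto simp: shifts_def)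
        have "\<bar>\<nu> i\<bar> = int (fact s) * \<bar>prod_list gs\<bar> * int r ^ s" by (simp add: \<nu>_def i abs_mult)
        also have "\<dots> \<le> int (fact s) * int T ^ j * int (2 * Y) ^ s"
          using ah i by (intro mult_mono power_mono mult_nonneg_nonneg) auto
        also have "\<dots> = int R" by (simp add: R_def)
        finally show "\<bar>\<nu> i\<bar> \<le> int R" .
      next
        fix n assume n: "n \<in> {1..R}"
        let ?B = "{(r, gs). r \<in> {Y..<2 * Y} \<and> gs \<in> shifts T j \<and> \<bar>int (fact s) * prod_list gs * int r ^ s\<bar> = int n}"
        have finB: "finite ?B" by (rule finite_subset[of _ "?Y \<times> shifts T j"]) auto
        have "card {i\<in>I. \<bar>\<nu> i\<bar> = int n} \<le> card ?B"
          by (rule card_mono[OF finB]) (auto simp: I_def \<nu>_def)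
        also have "\<dots> \<le> (2 * tau n) ^ j"
          by (rule card_power_fibre_le) (use n in \<open>auto simp: s_def Suc_le_eq simp del: fact_Suc\<close>)
        finally have "real (card {i\<in>I. \<bar>\<nu> i\<bar> = int n}) \<le> real ((2 * tau n) ^ j)" by (rule of_nat_mono)
        also have "\<dots> = (2 * real (tau n)) ^ j" by simp
        also have "\<dots> \<le> \<rho>" unfolding \<rho>_def
          using t(2)[of n] n unfolding R_def s_def by (intro power_mono mult_left_mono) auto
        finally show "real (card {i\<in>I. \<bar>\<nu> i\<bar> = int n}) \<le> \<rho>" .
      qed
      finally show "(\<Sum>r\<in>?Y. \<Sum>gs\<in>{gs\<in>shifts T j. 0 \<notin> set gs}. w r gs) \<le> \<rho> * N1"
        by (simp only: N1_def W_def ell_def)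
    qed
    finally show ?thesis by (simp only: V_def)
  qed
  have N10: "0 \<le> N1" unfolding N1_def W_def using xd ell1 by (intro mult_nonneg_nonneg add_nonneg_nonneg) auto
  have V0: "0 \<le> V" unfolding V_def using xd \<rho>1 N10 by (auto simp: J_def)
  have S0: "0 \<le> S r" for r by (simp add: S_def)
  have "(\<Sum>r\<in>?Y. S r) ^ K \<le> x ^ (K - 1) * (\<Sum>r\<in>?Y. S r ^ K)"
    using power_mean_pow2[of ?Y S j] S0 unfolding K_def x_def by simp
  also have "\<dots> \<le> x ^ (K - 1) * (\<Sum>r\<in>?Y. y ^ (K - s) * (\<Sum>gs\<in>shifts T j. w r gs))"
    using xd by (intro mult_left_mono sum_mono Sr) auto
  also have "(\<Sum>r\<in>?Y. y ^ (K - s) * (\<Sum>gs\<in>shifts T j. w r gs)) = y ^ (K - s) * (\<Sum>r\<in>?Y. \<Sum>gs\<in>shifts T j. w r gs)"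
    by (rule sum_distrib_left[symmetric])
  also have "x ^ (K - 1) * (y ^ (K - s) * (\<Sum>r\<in>?Y. \<Sum>gs\<in>shifts T j. w r gs)) \<le> x ^ (K - 1) * (y ^ (K - s) * V)"
    using V xd by (intro mult_left_mono) auto
  also have "\<dots> = (x * y) ^ K * (V / (x * y ^ s))"
  proof -
    have "x ^ (K - 1) = x ^ K / x" using power_diff_mult[OF K1(1), of x] xd by (simp add: field_simps)
    moreover have "y ^ (K - s) = y ^ K / y ^ s" using power_diff_mult[OF K1(2), of y] xd by (simp add: field_simps)
    ultimately show ?thesis by (simp add: power_mult_distrib)
  qed
  finally have main: "(\<Sum>r\<in>?Y. S r) ^ K \<le> (x * y) ^ K * (V / (x * y ^ s))" .
  define \<mu> where "\<mu> = real M / (x * d) ^ s"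
  have \<mu>0: "0 \<le> \<mu>" using xd by (simp add: \<mu>_def)
  define E where "E = 1 / real q + 1 / d + \<mu> * (d + real q)"
  have E0: "0 \<le> E" "1 / d \<le> E" using xd \<mu>0 by (auto simp: E_def)
  have xj: "1 \<le> x ^ j" using xd by (intro one_le_power) auto
  have re: "1 \<le> \<rho> * ell" using mult_mono[OF \<rho>1 ell1] \<rho>1 by simp
  have p3: "V / (x * y ^ s) \<le> (J + 16 * real c + 12) * (\<rho> * ell) * x ^ j * E"
  proof -
    have "V / (x * y ^ s) = J / y + \<rho> * (N1 / (x * y ^ s))"
      using xd by (simp add: V_def s_def field_simps)
    also have "\<dots> \<le> J * E + \<rho> * (x ^ j * ((16 * real c + 12) * ell * E))"
    proof (intro add_mono mult_left_mono)
      have "J / y \<le> J * (1 / d)" using xd by (simp add: J_def divide_left_mono)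
      also have "\<dots> \<le> J * E" using E0 by (intro mult_left_mono) (auto simp: J_def)
      finally show "J / y \<le> J * E" .
      have "N1 / (x * y ^ s) \<le> N1 / (x * d ^ s)"
        using xd by (intro divide_left_mono[OF _ N10] mult_left_mono power_mono) auto
      also have "\<dots> = x ^ j * ((2 * real c / (real q * d) + 3 * \<mu>) * (2 * d + 4 * real q * ell))"
      proof -
        have R: "real R = real c * d ^ j * (x * x ^ j)"
          unfolding R_def c_def s_def x_def d_def by (simp add: power_mult_distrib del: fact_Suc)
        have "real R / (x * d ^ s) = x ^ j * (real c / d)"
          unfolding R s_def using xd by (simp add: field_simps)
        moreover have "2 * real R / real q / (x * d ^ s) = 2 / real q * (real R / (x * d ^ s))" by simp
        ultimately have "2 * real R / real q / (x * d ^ s) = x ^ j * (2 * real c / (real q * d))" by simp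
        moreover have "real M / (x * d ^ s) = x ^ j * \<mu>"
          unfolding \<mu>_def s_def using xd by (simp add: power_mult_distrib)
        then have "3 * real M / (x * d ^ s) = x ^ j * (3 * \<mu>)" by simp
        ultimately have "(2 * real R / real q + 3 * real M) / (x * d ^ s) = x ^ j * (2 * real c / (real q * d) + 3 * \<mu>)"
          by (simp only: add_divide_distrib distrib_left)
        then show ?thesis by (simp add: N1_def W_def flip: times_divide_eq_left)
      qed
      also have "\<dots> \<le> x ^ j * ((16 * real c + 12) * ell * E)"
      proof (rule mult_left_mono)
        have "(2 * real c / (real q * d) + 3 * \<mu>) * (2 * d + 4 * real q * ell) \<le> (4 * real c / (real q * d) + 3 * \<mu>) * (2 * d + 4 * real q * ell)"
          using xd ell1 by (intro mult_right_mono add_right_mono divide_right_mono) auto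
        also have "\<dots> \<le> (16 * real c + 12) * ell * (1 / real q + 1 / d + \<mu> * (d + real q))"
          by (rule mean_value_term_le) (use c1 q xd \<mu>0 ell1 in auto)
        finally show "(2 * real c / (real q * d) + 3 * \<mu>) * (2 * d + 4 * real q * ell) \<le> (16 * real c + 12) * ell * E"
          by (simp only: E_def)
      qed (use xd in simp)
      finally show "N1 / (x * y ^ s) \<le> x ^ j * ((16 * real c + 12) * ell * E)" .
    qed (use \<rho>1 in auto)
    also have "J * E \<le> J * ((\<rho> * ell) * (x ^ j * E))"
    proof -
      have "1 * (1 * E) \<le> (\<rho> * ell) * (x ^ j * E)" using re xj E0 by (intro mult_mono) auto
      then show ?thesis by (intro mult_left_mono) (auto simp: J_def)
    qed
    finally show ?thesis by (simp add: algebra_simps)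
  qed
  have "(\<Sum>r\<in>?Y. S r) ^ K \<le> (3 * (x * d)) ^ K * ((J + 16 * real c + 12) * (\<rho> * ell) * x ^ j * E)"
  proof (rule order_trans[OF main mult_mono[OF _ p3]])
    have "x * y \<le> x * (3 * d)" using xd by (intro mult_left_mono) auto
    then show "(x * y) ^ K \<le> (3 * (x * d)) ^ K" using xd by (intro power_mono) auto
  qed (use V0 xd in auto)
  moreover have "real c = fact (Suc j) * 2 ^ Suc j" by (simp add: c_def s_def del: fact_Suc)
  ultimately show ?thesis
    unfolding S_def K_def J_def \<rho>_def ell_def E_def \<mu>_def s_def d_def x_def by (simp only: mult.assoc)
qed

section \<open>Sums over von Mangoldt weights with a polynomial phase\<close>

text \<open>The data of one twisted sum, for k = Suc j and a bracket below 1. The single number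
  \<Lambda> dominates all logarithms and divisor numbers that occur, so that they are converted into
  a power of N m only at the very end.\<close>

locale weyl_setting =
  fixes j N m q X :: nat and a :: int and \<alpha> \<Lambda> :: real and g :: "real poly"
  assumes j: "1 \<le> j" and \<alpha>: "rat_approx \<alpha> a q" and N: "2 \<le> N" and m: "1 \<le> m" "m ^ 3 \<le> N"
    and X: "real N * real m \<le> real X" "real X \<le> 2 * (real N * real m)"
    and g: "degree g \<le> Suc j" "coeff g (Suc j) = \<alpha> / real (m ^ Suc j)"
    and B_less: "1 / real q + (real N * real m) powr (- 1 / 2) + real q / real N ^ Suc j < 1"
    and \<Lambda>: "2 * ln (real X) + 1 \<le> \<Lambda>" "1 + ln (real q) \<le> \<Lambda>"
      "\<And>n. 1 \<le> n \<Longrightarrow> real n \<le> (real (weyl_const j) + fact (Suc j)) * (4 * (real N * real m)) ^ (2 * Suc j) \<Longrightarrow> real (tau n) \<le> \<Lambda>"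
begin

definition "P = real N * real m"
definition "B = 1 / real q + P powr (- 1 / 2) + real q / real N ^ Suc j"
definition "K = (2::nat) ^ j"
definition "u = B powr (- 1 / real K)"
definition "U = nat \<lfloor>u\<rfloor>"
text \<open>The saving in the claim: the estimates in this context have the form of a constant times
  a power of \<Lambda> times P * \<beta>.\<close>

definition "\<beta> = B powr (1 / (real K * real K))"
definition "F n = e2pi (poly g (real n))"

lemma q: "1 \<le> q" using \<alpha> by (simp add: rat_approx_def)

lemma K: "2 \<le> K" "Suc j \<le> K"
  unfolding K_def using power_increasing[OF j, of "2::nat"] two_power_ge_Suc by auto

lemma P: "2 \<le> P" "real N \<le> P" "P \<le> real X" "real X \<le> 2 * P"
proof -
  show "real N \<le> P" using m mult_left_mono[of 1 "real m" "real N"] by (simp add: P_def)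
  then show "2 \<le> P" using N by linarith
  show "P \<le> real X" "real X \<le> 2 * P" using X by (auto simp: P_def)
qed

lemma X2: "2 \<le> X"
  using P(1,3) by linarith

text \<open>Here m ^ 3 \<le> N enters: it gives P powr (3 / 2) \<le> N ^ 2, and N ^ 2 \<le> N ^ Suc
  j.\<close>

lemma P_le: "P / real N ^ Suc j \<le> P powr (- 1 / 2)"
proof -
  have "real (m ^ 3) \<le> real N" by (rule of_nat_mono[OF m(2)])
  then have "real N ^ 3 * real m ^ 3 \<le> real N ^ 3 * real N" by (intro mult_left_mono) auto
  moreover have "P ^ 3 = real N ^ 3 * real m ^ 3" by (simp add: P_def power_mult_distrib)
  moreover have "real N ^ 3 * real N = (real N ^ 2) ^ 2" by (simp add: eval_nat_numeral)
  ultimately have "P ^ 3 \<le> (real N ^ 2) ^ 2" by (simp only:)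
  then have "P powr 3 \<le> (real N ^ 2) powr 2" using P N by (simp add: powr_realpow)
  then have "(P powr 3) powr (1 / 2) \<le> ((real N ^ 2) powr 2) powr (1 / 2)" by (intro powr_mono2) auto
  moreover have "((real N ^ 2) powr 2) powr (1 / 2) = real N ^ 2" unfolding powr_powr using N by simp
  moreover have "(P powr 3) powr (1 / 2) = P powr (3 / 2)" by (simp add: powr_powr)
  ultimately have "P powr (3 / 2) \<le> real N ^ 2" by (simp only:)
  also have "\<dots> \<le> real N ^ Suc j" using N j by (intro power_increasing) auto
  finally have "P powr (3 / 2) \<le> real N ^ Suc j" .
  moreover have "P = P powr (3 / 2) * P powr (- 1 / 2)" using P by (simp flip: powr_add)
  ultimately have "P \<le> real N ^ Suc j * P powr (- 1 / 2)" by (metis mult_right_mono powr_ge_zero)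
  then show ?thesis using N by (simp add: divide_le_eq mult.commute)
qed

lemma B: "0 < B" "B < 1" "1 / real q \<le> B" "P powr (- 1 / 2) \<le> B" "real q / real N ^ Suc j \<le> B" "P / real N ^ Suc j \<le> B"
proof -
  have p: "0 < P powr (- 1 / 2)" using P by simp
  show "B < 1" using B_less by (simp add: B_def P_def)
  show "P powr (- 1 / 2) \<le> B" by (simp add: B_def)
  then show "0 < B" using p by linarith
  show "1 / real q \<le> B" "real q / real N ^ Suc j \<le> B" by (simp_all add: B_def)
  show "P / real N ^ Suc j \<le> B" using P_le \<open>P powr (- 1 / 2) \<le> B\<close> by linarith
qed

text \<open>B \<ge> P powr (- 1 / 2) and K \<ge> 2 keep the cut-off below P powr (1 / 4). Hence U ^
  2 stays below the square root of P.\<close>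

lemma u: "1 \<le> u" "u ^ K = 1 / B" "u \<le> P powr (1 / 4)"
proof -
  have K0: "0 < real K" using K by simp
  have "B powr 0 \<le> B powr (- 1 / real K)" using B K0 by (intro powr_mono') (auto simp: divide_nonpos_pos)
  then show "1 \<le> u" using B by (simp add: u_def)
  have "u ^ K = u powr real K" using \<open>1 \<le> u\<close> by (simp add: powr_realpow)
  also have "\<dots> = B powr (- 1)" using K0 by (simp add: u_def powr_powr)
  finally show "u ^ K = 1 / B" using B by (simp add: powr_minus_divide)
  have "u \<le> (P powr (- 1 / 2)) powr (- 1 / real K)"
    unfolding u_def using B P K0 by (intro powr_mono2') (auto simp: divide_nonpos_pos)
  also have "\<dots> = P powr (1 / (2 * real K))" by (simp add: powr_powr)
  also have "\<dots> \<le> P powr (1 / 4)" using P K by (intro powr_mono) (auto simp: field_simps)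
  finally show "u \<le> P powr (1 / 4)" .
qed

lemma U: "1 \<le> U" "real U \<le> u" "u < real U + 1" "U\<^sup>2 \<le> X" "real (U\<^sup>2) \<le> P powr (1 / 2)" "U \<le> U\<^sup>2"
proof -
  show 1: "1 \<le> U" "real U \<le> u" "u < real U + 1" using u(1) unfolding U_def by linarith+
  have "real (U\<^sup>2) \<le> (P powr (1 / 4))\<^sup>2" using 1 u by (simp add: power_mono)
  also have "\<dots> = P powr (1 / 2)" by (simp add: power2_eq_square flip: powr_add)
  finally show s: "real (U\<^sup>2) \<le> P powr (1 / 2)" .
  also have "\<dots> \<le> P powr 1" using P by (intro powr_mono) auto
  also have "\<dots> \<le> real X" using P by simp
  finally have "real (U\<^sup>2) \<le> real X" .
  then show "U\<^sup>2 \<le> X" by (simp only: of_nat_le_iff)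
  show "U \<le> U\<^sup>2" using 1 by (simp add: power2_eq_square)
qed

lemma \<Lambda>1: "1 \<le> \<Lambda>" "ln (real X) \<le> \<Lambda>"
proof -
  have "0 \<le> ln (real X)" using X2 by simp
  then show "1 \<le> \<Lambda>" "ln (real X) \<le> \<Lambda>" using \<Lambda>(1) by linarith+
qed

text \<open>Since K * K \<ge> 4 the saving is never better than P powr (- 1 / 8), so that errors of
  order P powr (7 / 8) are free.\<close>

lemma \<beta>: "0 < \<beta>" "\<beta> ^ (K * K) = B" "\<beta> ^ K = B powr (1 / real K)" "\<beta> \<le> 1" "P powr (- 1 / 8) \<le> \<beta>"
proof -
  have K0: "0 < real K" using K by simp
  show b0: "0 < \<beta>" using B by (simp add: \<beta>_def)
  have "\<beta> ^ (K * K) = \<beta> powr real (K * K)" by (rule powr_realpow[OF b0, symmetric])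
  also have "\<dots> = B" using B K0 by (simp add: \<beta>_def powr_powr)
  finally show "\<beta> ^ (K * K) = B" .
  have "\<beta> ^ K = \<beta> powr real K" by (rule powr_realpow[OF b0, symmetric])
  also have "\<dots> = B powr (1 / real K)" using K0 by (simp add: \<beta>_def powr_powr)
  finally show "\<beta> ^ K = B powr (1 / real K)" .
  show "\<beta> \<le> 1" unfolding \<beta>_def using B by (intro powr_le1) auto
  have "2 * 2 \<le> K * K" using K by (intro mult_le_mono) auto
  then have "real (2 * 2) \<le> real (K * K)" by (rule of_nat_mono)
  then have KK: "4 \<le> real K * real K" by simp
  have "P powr (- 1 / 8) \<le> P powr ((- 1 / 2) * (1 / (real K * real K)))"
    using P KK by (intro powr_mono) (auto simp: field_simps)
  also have "\<dots> = (P powr (- 1 / 2)) powr (1 / (real K * real K))" by (simp add: powr_powr)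
  also have "\<dots> \<le> \<beta>" unfolding \<beta>_def using B by (intro powr_mono2) auto
  finally show "P powr (- 1 / 8) \<le> \<beta>" .
qed

lemma m_power: "1 \<le> m ^ Suc j" "real (m ^ Suc j) / P ^ Suc j = 1 / real N ^ Suc j"
  using m N by (auto simp: P_def power_mult_distrib field_simps)

text \<open>The outer variable is long enough for 1 / D to be of order B, and the inner range
  exceeds u, so 1 / L ^ K is at most 1 / u ^ K = B. As D * L has the order of P, the term with m ^
  Suc j becomes (D + q) / N ^ Suc j, again of order B.\<close>

lemma box_sum_bound:
  fixes c v :: "nat \<Rightarrow> complex"
  assumes DL: "X \<le> D * L" "D * L \<le> 2 * X" and D: "1 / real D \<le> 2 * B" and L: "U < L"
    and c: "\<And>d. norm (c d) \<le> \<Lambda>" and v: "\<And>l. norm (v l) \<le> \<Lambda>"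
  shows "norm (\<Sum>d=1..D. c d * (\<Sum>l=1..L. if d * l \<le> X then v l * F (d * l) else 0))
    \<le> (24 * (2 ^ K * (3 ^ K * (real j ^ K + real j + 16 * real (weyl_const j) + 12)) * 2 ^ (2 * j) * 9)) * \<Lambda> ^ (2 * j + 3) * (P * \<beta>)"
proof -
  define C where "C = 3 ^ K * (real j ^ K + real j + 16 * real (weyl_const j) + 12)"
  define S where "S = norm (\<Sum>d=1..D. c d * (\<Sum>l=1..L. if d * l \<le> X then v l * F (d * l) else 0))"
  have DL0: "1 \<le> D" "1 \<le> L"
  proof -
    show "1 \<le> L" using L by simp
    have "0 < D * L" using DL(1) X2 by linarith
    then show "1 \<le> D" by (simp add: Suc_le_eq)
  qed
  have DLr: "P \<le> real D * real L" "real D * real L \<le> 4 * P"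
  proof -
    have "real X \<le> real D * real L" using of_nat_mono[OF DL(1), where 'a = real] by simp
    then show "P \<le> real D * real L" using P by linarith
    have "real D * real L \<le> 2 * real X" using of_nat_mono[OF DL(2), where 'a = real] by simp
    then show "real D * real L \<le> 4 * P" using P by linarith
  qed
  have Dle: "real D \<le> 4 * P" "real L \<le> 4 * P"
  proof -
    have "real D * 1 \<le> real D * real L" "1 * real L \<le> real D * real L"
      using DL0 by (intro mult_left_mono mult_right_mono; simp)+
    then show "real D \<le> 4 * P" "real L \<le> 4 * P" using DLr(2) by linarith+
  qed
  have \<Lambda>0: "0 \<le> \<Lambda>" using \<Lambda>1 by simp
  have "S = norm (\<Sum>d\<in>{1..int D}. c (nat d) * (\<Sum>l\<in>{1..int L}. if d * l \<le> int X then v (nat l) * e2pi (poly g (of_int (d * l))) else 0))"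
  proof -
    have "(\<Sum>d=1..D. c d * (\<Sum>l=1..L. if d * l \<le> X then v l * F (d * l) else 0))
        = (\<Sum>d\<in>{1..int D}. c (nat d) * (\<Sum>l=1..L. if nat d * l \<le> X then v l * F (nat d * l) else 0))"
      by (rule sum.reindex_bij_witness[of _ nat int]) (auto cong: if_cong)
    also have "\<dots> = (\<Sum>d\<in>{1..int D}. c (nat d) * (\<Sum>l\<in>{1..int L}. if d * l \<le> int X then v (nat l) * e2pi (poly g (of_int (d * l))) else 0))"
    proof (rule sum.cong[OF refl])
      fix d assume d: "d \<in> {1..int D}"
      have "(\<Sum>l=1..L. if nat d * l \<le> X then v l * F (nat d * l) else 0)
         = (\<Sum>l\<in>{1..int L}. if d * l \<le> int X then v (nat l) * e2pi (poly g (of_int (d * l))) else 0)"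
      proof (rule sum.reindex_bij_witness[of _ nat int])
        fix l assume l: "l \<in> {1..L}"
        have dn: "int (nat d) = d" using d by simp
        have "nat d * l \<le> X \<longleftrightarrow> int (nat d) * int l \<le> int X" by (simp only: flip: of_nat_mult of_nat_le_iff[where 'a = int])
        then have "nat d * l \<le> X \<longleftrightarrow> d * int l \<le> int X" by (simp only: dn)
        moreover have "real (nat d * l) = of_int (int (nat d) * int l)" by simp
        then have "real (nat d * l) = of_int (d * int l)" by (simp only: dn)
        then have "F (nat d * l) = e2pi (poly g (of_int (d * int l)))" by (simp only: F_def)
        ultimately show "(if d * int l \<le> int X then v (nat (int l)) * e2pi (poly g (of_int (d * int l))) else 0)
            = (if nat d * l \<le> X then v l * F (nat d * l) else 0)"
          by (simp only: nat_int)
      qed auto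
      then show "c (nat d) * (\<Sum>l=1..L. if nat d * l \<le> X then v l * F (nat d * l) else 0)
         = c (nat d) * (\<Sum>l\<in>{1..int L}. if d * l \<le> int X then v (nat l) * e2pi (poly g (of_int (d * l))) else 0)" by simp
    qed
    finally show ?thesis by (simp only: S_def)
  qed
  also have "\<dots> ^ (2 ^ j * 2 ^ j) \<le> 2 ^ 2 ^ j * (3 * (\<Lambda> * \<Lambda> * real D * real L)) ^ (2 ^ j * 2 ^ j) * (3 ^ 2 ^ j * (real j ^ 2 ^ j + real j + 16 * real (weyl_const j) + 12)) *
       ((2 * \<Lambda>) ^ (2 * j) * (1 + ln (real q))) *
       (1 / real L ^ 2 ^ j + 1 / real q + 1 / real D + real (m ^ Suc j) / (real D * real L) ^ Suc j * (real D + real q))"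
  proof (rule type_II_bound[OF \<alpha> m_power(1) j DL0 g])
    fix n assume n: "1 \<le> n" "n \<le> weyl_const j * L ^ j * D ^ j * (2 * L)"
    have "real n \<le> real (weyl_const j * L ^ j * D ^ j * (2 * L))" using n(2) by (rule of_nat_mono)
    then have n': "real n \<le> real (weyl_const j) * ((real D * real L) ^ j * (2 * real L))" by (simp add: power_mult_distrib mult_ac)
    have 1: "(real D * real L) ^ j \<le> (4 * P) ^ j" by (rule power_mono[OF DLr(2)]) simp
    have "2 * real L \<le> (4 * P) * real L" using P by (intro mult_right_mono) auto
    also have "\<dots> \<le> (4 * P) * (4 * P)" using Dle P by (intro mult_left_mono) auto
    finally have 2: "2 * real L \<le> (4 * P) * (4 * P)" .
    have "(real D * real L) ^ j * (2 * real L) \<le> (4 * P) ^ j * ((4 * P) * (4 * P))"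
      by (rule mult_mono[OF 1 2]) (use P in auto)
    also have "\<dots> = (4 * P) ^ (j + 2)" by (simp add: power_add power2_eq_square)
    also have "\<dots> \<le> (4 * P) ^ (2 * Suc j)" using P by (intro power_increasing) auto
    finally have 3: "(real D * real L) ^ j * (2 * real L) \<le> (4 * P) ^ (2 * Suc j)" .
    have "real (weyl_const j) * ((real D * real L) ^ j * (2 * real L)) \<le> (real (weyl_const j) + fact (Suc j)) * (4 * P) ^ (2 * Suc j)"
      by (rule mult_mono[OF _ 3]) auto
    with n' have "real n \<le> (real (weyl_const j) + fact (Suc j)) * (4 * P) ^ (2 * Suc j)" by (rule order_trans)
    then show "real (tau n) \<le> \<Lambda>" using n(1) unfolding P_def by (intro \<Lambda>(3))
  qed (use c v \<Lambda>1 in auto)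
  also have "\<dots> = 2 ^ K * (3 * (\<Lambda> * \<Lambda> * real D * real L)) ^ (K * K) * C * ((2 * \<Lambda>) ^ (2 * j) * (1 + ln (real q))) *
       (1 / real L ^ K + 1 / real q + 1 / real D + real (m ^ Suc j) / (real D * real L) ^ Suc j * (real D + real q))"
    by (simp only: K_def C_def)
  also have "\<dots> \<le> 2 ^ K * (12 * (\<Lambda> * \<Lambda> * P)) ^ (K * K) * C * ((2 * \<Lambda>) ^ (2 * j) * \<Lambda>) * (9 * B)"
  proof -
    have C0: "0 \<le> C" by (simp add: C_def)
    have 1: "(3 * (\<Lambda> * \<Lambda> * real D * real L)) ^ (K * K) \<le> (12 * (\<Lambda> * \<Lambda> * P)) ^ (K * K)"
    proof (rule power_mono)
      have "\<Lambda> * \<Lambda> * (real D * real L) \<le> \<Lambda> * \<Lambda> * (4 * P)" using DLr \<Lambda>0 by (intro mult_left_mono) auto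
      then show "3 * (\<Lambda> * \<Lambda> * real D * real L) \<le> 12 * (\<Lambda> * \<Lambda> * P)" by (simp add: mult.assoc)
    qed (use \<Lambda>0 in auto)
    \<comment> \<open>The 9 is 1 + 1 + 2 + 5; the last part is 4 P / N ^ Suc j + q / N ^ Suc j, with
      4 P bounding D.\<close>
    have 2: "1 / real L ^ K + 1 / real q + 1 / real D + real (m ^ Suc j) / (real D * real L) ^ Suc j * (real D + real q) \<le> 9 * B"
    proof -
      have "u \<le> real L" using U(3) L by linarith
      then have "u ^ K \<le> real L ^ K" using u by (intro power_mono) auto
      then have "1 / real L ^ K \<le> 1 / u ^ K" using u(1) DL0 by (intro divide_left_mono mult_pos_pos zero_less_power) auto
      also have "\<dots> = B" using B by (simp add: u)
      finally have a1: "1 / real L ^ K \<le> B" .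
      have "real (m ^ Suc j) / (real D * real L) ^ Suc j \<le> real (m ^ Suc j) / P ^ Suc j"
        using DLr P DL0 by (intro divide_left_mono power_mono mult_pos_pos) auto
      also have "\<dots> = 1 / real N ^ Suc j" by (rule m_power(2))
      finally have "real (m ^ Suc j) / (real D * real L) ^ Suc j * (real D + real q) \<le> 1 / real N ^ Suc j * (4 * P + real q)"
        using Dle by (intro mult_mono) auto
      also have "\<dots> = 4 * (P / real N ^ Suc j) + real q / real N ^ Suc j" by (simp add: add_divide_distrib)
      also have "\<dots> \<le> 5 * B" using B by linarith
      finally have a2: "real (m ^ Suc j) / (real D * real L) ^ Suc j * (real D + real q) \<le> 5 * B" .
      show ?thesis using a1 a2 B D by linarith
    qed
    have 3: "0 \<le> 1 / real L ^ K + 1 / real q + 1 / real D + real (m ^ Suc j) / (real D * real L) ^ Suc j * (real D + real q)"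
      by simp
    have lq: "0 \<le> 1 + ln (real q)" using q by simp
    show ?thesis
      using 1 2 3 C0 \<Lambda>(2) \<Lambda>0 lq P by (intro mult_mono mult_nonneg_nonneg) auto
  qed
  also have "\<dots> = (12 * (\<Lambda> * \<Lambda> * P) * \<beta>) ^ (K * K) * ((2 ^ K * C * 2 ^ (2 * j) * 9) * \<Lambda> ^ (2 * j + 1))"
    by (simp add: \<beta>(2)[symmetric] power_mult_distrib power_add mult_ac)
  \<comment> \<open>The second factor is at least 1 and may be replaced by its own power. Both sides
    are then perfect powers and the root is taken without fractional exponents; the excess in
    constants and in \<Lambda> is harmless.\<close>
  also have "\<dots> \<le> (12 * (\<Lambda> * \<Lambda> * P) * \<beta>) ^ (K * K) * ((2 ^ K * C * 2 ^ (2 * j) * 9) * \<Lambda> ^ (2 * j + 1)) ^ (K * K)"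
  proof (intro mult_left_mono self_le_power)
    have "1 * 1 \<le> 3 ^ K * (real j ^ K + real j + 16 * real (weyl_const j) + 12)" by (intro mult_mono) auto
    then have C1: "1 \<le> C" by (simp add: C_def)
    have "1 * 1 * 1 * 1 \<le> 2 ^ K * C * 2 ^ (2 * j) * (9::real)" using C1 by (intro mult_mono mult_nonneg_nonneg) auto
    moreover have "1 \<le> \<Lambda> ^ (2 * j + 1)" using \<Lambda>1 by (intro one_le_power)
    ultimately have "1 * 1 \<le> (2 ^ K * C * 2 ^ (2 * j) * 9) * \<Lambda> ^ (2 * j + 1)" by (intro mult_mono) auto
    then show "1 \<le> (2 ^ K * C * 2 ^ (2 * j) * 9) * \<Lambda> ^ (2 * j + 1)" by simp
    show "0 < K * K" using K by simp
  qed (use \<Lambda>0 P \<beta> in auto)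
  also have "\<dots> = ((12 * (2 ^ K * C * 2 ^ (2 * j) * 9)) * \<Lambda> ^ (2 * j + 3) * (P * \<beta>)) ^ (K * K)"
    unfolding power_mult_distrib[symmetric]
    by (rule arg_cong[of _ _ "\<lambda>z. z ^ (K * K)"]) (simp add: power_add power3_eq_cube mult_ac)
  finally have "S ^ (K * K) \<le> ((12 * (2 ^ K * C * 2 ^ (2 * j) * 9)) * \<Lambda> ^ (2 * j + 3) * (P * \<beta>)) ^ (K * K)"
    by (simp only: K_def)
  moreover have "0 \<le> (12 * (2 ^ K * C * 2 ^ (2 * j) * 9)) * \<Lambda> ^ (2 * j + 3) * (P * \<beta>)"
    using \<Lambda>0 P \<beta> by (intro mult_nonneg_nonneg) (auto simp: C_def)
  ultimately have "S \<le> (12 * (2 ^ K * C * 2 ^ (2 * j) * 9)) * \<Lambda> ^ (2 * j + 3) * (P * \<beta>)"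
    using K by (intro power_le_imp_le_base[of S "K * K - 1"]) auto
  also have "\<dots> \<le> (24 * (2 ^ K * C * 2 ^ (2 * j) * 9)) * \<Lambda> ^ (2 * j + 3) * (P * \<beta>)"
    using \<Lambda>0 P \<beta> by (intro mult_right_mono) (auto simp: C_def)
  finally show ?thesis by (simp only: S_def C_def)
qed

text \<open>The loss Y ^ j of the type I estimate is paid by the bracket: Y \<le> u and j \<le> K -
  1 give Y ^ j * B \<le> u ^ (K - 1) * B = 1 / u = \<beta> ^ K.\<close>

lemma block_type_I:
  fixes lo hi :: "nat \<Rightarrow> nat"
  assumes Y: "1 \<le> Y" "Y \<le> U"
    and I: "\<And>r. r \<in> {Y..<2 * Y} \<Longrightarrow> 1 \<le> lo r \<and> hi r \<le> X div r"
  shows "(\<Sum>r\<in>{Y..<2 * Y}. norm (\<Sum>l=lo r..hi r. F (r * l)))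
    \<le> 6 * ((real j + 16 * (fact (Suc j) * 2 ^ Suc j) + 12) * 2 ^ j * (3 + 3 * 2 ^ Suc j)) * \<Lambda> ^ (j + 1) * (P * \<beta>)"
proof -
  define T where "T = X div Y"
  define C where "C = real j + 16 * (fact (Suc j) * 2 ^ Suc j) + 12"
  define S where "S = (\<Sum>r\<in>{Y..<2 * Y}. norm (\<Sum>l=lo r..hi r. F (r * l)))"
  have \<Lambda>0: "0 \<le> \<Lambda>" using \<Lambda>1 by simp
  have YX: "Y \<le> X" using Y U by linarith
  have T1: "1 \<le> T" using Y YX by (simp add: T_def less_eq_div_iff_mult_less_eq)
  have "Y * T \<le> X" by (simp add: T_def)
  have "X = Y * T + X mod Y" unfolding T_def by simp
  moreover have "X mod Y < Y" using Y by simp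
  ultimately have "X < Y * T + Y" by linarith
  also have "\<dots> \<le> Y * T + Y * T" using T1 by simp
  finally have "X \<le> 2 * (Y * T)" by simp
  then have YT: "real X \<le> 2 * (real Y * real T)" using of_nat_mono[of X "2 * (Y * T)", where 'a = real] by simp
  have YT2: "real Y * real T \<le> 2 * P"
    using of_nat_mono[OF \<open>Y * T \<le> X\<close>, where 'a = real] P by simp
  have PYT: "P / 2 \<le> real Y * real T" using YT P by linarith
  have Tle: "real T \<le> 2 * P" "real Y \<le> 2 * P"
  proof -
    have "1 * real T \<le> real Y * real T" "real Y * 1 \<le> real Y * real T"
      using Y T1 by (intro mult_left_mono mult_right_mono; simp)+
    then show "real T \<le> 2 * P" "real Y \<le> 2 * P" using YT2 by linarith+
  qed
  have "S = (\<Sum>r\<in>{Y..<2 * Y}. norm (\<Sum>l\<in>{int (lo r)..int (hi r)}. e2pi (poly g (of_int (int r * l)))))"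
    unfolding S_def
  proof (intro sum.cong refl arg_cong[of _ _ norm])
    fix r
    show "(\<Sum>l=lo r..hi r. F (r * l)) = (\<Sum>l\<in>{int (lo r)..int (hi r)}. e2pi (poly g (of_int (int r * l))))"
      by (rule sum.reindex_bij_witness[of _ nat int]) (auto simp: F_def)
  qed
  also have "\<dots> ^ 2 ^ j \<le> (3 * (real Y * real T)) ^ 2 ^ j * (real j + 16 * (fact (Suc j) * 2 ^ Suc j) + 12) * ((2 * \<Lambda>) ^ j * (1 + ln (real q))) * real Y ^ j *
      (1 / real q + 1 / real T + real (m ^ Suc j) / (real Y * real T) ^ Suc j * (real T + real q))"
  proof (rule type_I_bound[OF \<alpha> m_power(1) Y(1) T1 g])
    fix r assume r: "r \<in> {Y..<2 * Y}"
    then have "X div r \<le> T" unfolding T_def using Y by (intro div_le_mono2) auto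
    then show "1 \<le> int (lo r) \<and> int (hi r) \<le> int T" using I[OF r] by auto
  next
    fix n assume n: "1 \<le> n" "n \<le> fact (Suc j) * T ^ j * (2 * Y) ^ Suc j"
    have "real n \<le> real (fact (Suc j) * T ^ j * (2 * Y) ^ Suc j)" using n(2) by (rule of_nat_mono)
    then have n': "real n \<le> fact (Suc j) * (real T ^ j * (2 * real Y) ^ Suc j)" by (simp add: mult_ac del: fact_Suc power_Suc)
    have 1: "real T ^ j \<le> (4 * P) ^ j" "(2 * real Y) ^ Suc j \<le> (4 * P) ^ Suc j"
      using Tle P by (intro power_mono; simp)+
    have "real T ^ j * (2 * real Y) ^ Suc j \<le> (4 * P) ^ j * (4 * P) ^ Suc j"
      by (rule mult_mono[OF 1]) (use P in auto)
    also have "\<dots> = (4 * P) ^ (j + Suc j)" by (rule power_add[symmetric])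
    also have "\<dots> \<le> (4 * P) ^ (2 * Suc j)" using P by (intro power_increasing) auto
    finally have 2: "real T ^ j * (2 * real Y) ^ Suc j \<le> (4 * P) ^ (2 * Suc j)" .
    have "fact (Suc j) * (real T ^ j * (2 * real Y) ^ Suc j) \<le> (real (weyl_const j) + fact (Suc j)) * (4 * P) ^ (2 * Suc j)"
      by (rule mult_mono[OF _ 2]) auto
    with n' have "real n \<le> (real (weyl_const j) + fact (Suc j)) * (4 * P) ^ (2 * Suc j)" by (rule order_trans)
    then show "real (tau n) \<le> \<Lambda>" using n(1) unfolding P_def by (intro \<Lambda>(3))
  qed (use \<Lambda>1 in auto)
  also have "\<dots> = (3 * (real Y * real T)) ^ K * C * ((2 * \<Lambda>) ^ j * (1 + ln (real q))) *
      (real Y ^ j * (1 / real q + 1 / real T + real (m ^ Suc j) / (real Y * real T) ^ Suc j * (real T + real q)))"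
    by (simp only: K_def C_def mult.assoc)
  also have "\<dots> \<le> (6 * P) ^ K * C * ((2 * \<Lambda>) ^ j * \<Lambda>) * ((3 + 3 * 2 ^ Suc j) * \<beta> ^ K)"
  proof -
    have C0: "0 \<le> C" by (simp add: C_def)
    have lq: "0 \<le> 1 + ln (real q)" using q by simp
    have 1: "(3 * (real Y * real T)) ^ K \<le> (6 * P) ^ K"
    proof (rule power_mono)
      show "3 * (real Y * real T) \<le> 6 * P" using YT2 by linarith
    qed simp
    have 2: "1 / real q + 1 / real T + real (m ^ Suc j) / (real Y * real T) ^ Suc j * (real T + real q) \<le> (3 + 3 * 2 ^ Suc j) * B"
    proof -
      \<comment> \<open>Y is at most P powr (1 / 4), so T has at least the order P powr (3 / 4),
        more than the square root asked for.\<close>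
      have "P powr (1 / 2) \<le> 2 * real T"
      proof -
        have "P powr (1 / 4) * P powr (1 / 2) \<le> P powr (1 / 4) * P powr (3 / 4)"
          using P by (intro mult_left_mono powr_mono) auto
        also have "\<dots> = P" using P by (simp flip: powr_add)
        also have "\<dots> \<le> 2 * (real Y * real T)" using PYT by simp
        also have "\<dots> \<le> 2 * (P powr (1 / 4) * real T)"
          using Y U(2) u(3) by (intro mult_left_mono mult_right_mono) auto
        finally have "P powr (1 / 4) * P powr (1 / 2) \<le> P powr (1 / 4) * (2 * real T)" by simp
        then show ?thesis using P by simp
      qed
      then have "1 / (2 * real T) \<le> 1 / P powr (1 / 2)" using P T1 by (intro divide_left_mono mult_pos_pos) auto
      also have "\<dots> = P powr (- 1 / 2)" using P by (simp add: powr_minus_divide)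
      also have "\<dots> \<le> B" by (rule B)
      finally have a1: "1 / real T \<le> 2 * B" by simp
      have "real (m ^ Suc j) / (real Y * real T) ^ Suc j \<le> real (m ^ Suc j) / (P / 2) ^ Suc j"
        using PYT P T1 Y by (intro divide_left_mono power_mono mult_pos_pos) auto
      also have "\<dots> = 2 ^ Suc j * (real (m ^ Suc j) / P ^ Suc j)" by (simp add: power_divide)
      also have "\<dots> = 2 ^ Suc j * (1 / real N ^ Suc j)" by (simp only: m_power(2))
      finally have "real (m ^ Suc j) / (real Y * real T) ^ Suc j * (real T + real q) \<le> 2 ^ Suc j * (1 / real N ^ Suc j) * (2 * P + real q)"
        using Tle by (intro mult_mono) auto
      also have "\<dots> = 2 ^ Suc j * (2 * (P / real N ^ Suc j) + real q / real N ^ Suc j)"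
      proof -
        have "c * (1 / n) * (2 * p + r) = c * (2 * (p / n) + r / n)" for c n p r :: real
          by (simp add: algebra_simps add_divide_distrib)
        then show ?thesis .
      qed
      also have "\<dots> \<le> 2 ^ Suc j * (3 * B)"
      proof (rule mult_left_mono)
        show "2 * (P / real N ^ Suc j) + real q / real N ^ Suc j \<le> 3 * B" using B(5,6) by linarith
      qed simp
      finally have a2: "real (m ^ Suc j) / (real Y * real T) ^ Suc j * (real T + real q) \<le> 2 ^ Suc j * (3 * B)" .
      have "(3 + 3 * 2 ^ Suc j) * B = 3 * B + 2 ^ Suc j * (3 * B)" by (simp add: algebra_simps)
      then show ?thesis using a1 a2 B(3) by linarith
    qed
    have 3: "real Y ^ j * ((3 + 3 * 2 ^ Suc j) * B) \<le> (3 + 3 * 2 ^ Suc j) * \<beta> ^ K"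
    proof -
      have "real Y \<le> u" using Y U(2) by linarith
      then have "real Y ^ j \<le> u ^ j" by (intro power_mono) auto
      also have "\<dots> \<le> u ^ (K - 1)" using u K by (intro power_increasing) auto
      finally have "real Y ^ j * B \<le> u ^ (K - 1) * B" using B by (intro mult_right_mono) auto
      also have "u ^ (K - 1) = u ^ K / u"
      proof (rule eq_divide_imp)
        show "u ^ (K - 1) * u = u ^ K" using power_diff_mult[of 1 K u] K by (simp only: power_one_right)
      qed (use u(1) in simp)
      also have "u ^ K / u * B = 1 / u" using B by (simp add: u(2))
      also have "\<dots> = \<beta> ^ K" unfolding \<beta>(3) u_def using B by (simp add: powr_minus_divide)
      finally have "(3 + 3 * 2 ^ Suc j) * (real Y ^ j * B) \<le> (3 + 3 * 2 ^ Suc j) * \<beta> ^ K" by (intro mult_left_mono) auto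
      then show ?thesis by (simp only: mult.left_commute)
    qed
    have 4: "real Y ^ j * (1 / real q + 1 / real T + real (m ^ Suc j) / (real Y * real T) ^ Suc j * (real T + real q)) \<le> (3 + 3 * 2 ^ Suc j) * \<beta> ^ K"
      by (rule order_trans[OF mult_left_mono[OF 2] 3]) simp
    have 5: "0 \<le> real Y ^ j * (1 / real q + 1 / real T + real (m ^ Suc j) / (real Y * real T) ^ Suc j * (real T + real q))"
      by simp
    have 6: "(2 * \<Lambda>) ^ j * (1 + ln (real q)) \<le> (2 * \<Lambda>) ^ j * \<Lambda>"
      using \<Lambda>0 \<Lambda>(2) by (intro mult_left_mono) auto
    show ?thesis
      by (rule mult_mono[OF mult_mono[OF mult_right_mono[OF 1 C0] 6] 4])
         (use C0 lq \<Lambda>0 P 5 in \<open>auto intro!: mult_nonneg_nonneg\<close>)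
  qed
  also have "\<dots> = (6 * P * \<beta>) ^ K * ((C * 2 ^ j * (3 + 3 * 2 ^ Suc j)) * \<Lambda> ^ (j + 1))"
    by (simp add: power_mult_distrib power_add mult_ac)
  also have "\<dots> \<le> (6 * P * \<beta>) ^ K * ((C * 2 ^ j * (3 + 3 * 2 ^ Suc j)) * \<Lambda> ^ (j + 1)) ^ K"
  proof (intro mult_left_mono self_le_power)
    have "1 * 1 * 1 \<le> C * 2 ^ j * (3 + 3 * 2 ^ Suc j)"
      by (intro mult_mono mult_nonneg_nonneg) (auto simp: C_def intro: add_nonneg_nonneg)
    moreover have "1 \<le> \<Lambda> ^ (j + 1)" using \<Lambda>1 by (intro one_le_power)
    ultimately have "1 * 1 \<le> (C * 2 ^ j * (3 + 3 * 2 ^ Suc j)) * \<Lambda> ^ (j + 1)" by (intro mult_mono) auto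
    then show "1 \<le> (C * 2 ^ j * (3 + 3 * 2 ^ Suc j)) * \<Lambda> ^ (j + 1)" by simp
    show "0 < K" using K by simp
  qed (use P \<beta> in auto)
  also have "\<dots> = (6 * (C * 2 ^ j * (3 + 3 * 2 ^ Suc j)) * \<Lambda> ^ (j + 1) * (P * \<beta>)) ^ K"
    unfolding power_mult_distrib[symmetric]
    by (rule arg_cong[of _ _ "\<lambda>z. z ^ K"]) (simp add: mult_ac)
  finally have "S ^ K \<le> (6 * (C * 2 ^ j * (3 + 3 * 2 ^ Suc j)) * \<Lambda> ^ (j + 1) * (P * \<beta>)) ^ K"
    by (simp only: K_def)
  moreover have "0 \<le> 6 * (C * 2 ^ j * (3 + 3 * 2 ^ Suc j)) * \<Lambda> ^ (j + 1) * (P * \<beta>)"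
    using \<Lambda>0 P \<beta> by (intro mult_nonneg_nonneg) (auto simp: C_def)
  ultimately have "S \<le> 6 * (C * 2 ^ j * (3 + 3 * 2 ^ Suc j)) * \<Lambda> ^ (j + 1) * (P * \<beta>)"
    using K by (intro power_le_imp_le_base[of S "K - 1"]) auto
  then show ?thesis by (simp only: S_def C_def)
qed

end

section \<open>Dyadic blocks under the hyperbola as boxes\<close>

definition type_I_const :: "nat \<Rightarrow> real" where
  "type_I_const j = 6 * ((real j + 16 * (fact (Suc j) * 2 ^ Suc j) + 12) * 2 ^ j * (3 + 3 * 2 ^ Suc j))"

definition type_II_const :: "nat \<Rightarrow> real" where
  "type_II_const j = 24 * (2 ^ 2 ^ j * (3 ^ 2 ^ j * (real j ^ 2 ^ j + real j + 16 * real (weyl_const j) + 12)) * 2 ^ (2 * j) * 9)"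

lemma hyperbola_row:
  fixes G :: "nat \<Rightarrow> complex"
  assumes "1 \<le> Y" "Y \<le> k"
  shows "(\<Sum>l=1..X div k. G l) = (\<Sum>l=1..X div Y. if k * l \<le> X then G l else 0)"
proof (rule sum.mono_neutral_cong_left)
  have "X div k \<le> X div Y" using assms by (intro div_le_mono2) auto
  then show "{1..X div k} \<subseteq> {1..X div Y}" by auto
qed (use assms in \<open>auto simp: less_eq_div_iff_mult_less_eq mult.commute\<close>)

text \<open>Zero coefficients and the condition d * l \<le> X pad the block to a full box; for Y
  \<le> X its area lies between X and 2 X.\<close>

lemma dyadic_block_as_box:
  fixes c v F :: "nat \<Rightarrow> complex"
  assumes Y: "1 \<le> Y"
  shows "(\<Sum>k\<in>{Y..<2 * Y}. c k * (\<Sum>l=1..X div k. v l * F (k * l)))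
    = (\<Sum>d=1..2 * Y. (if d \<in> {Y..<2 * Y} then c d else 0) * (\<Sum>l=1..X div Y. if d * l \<le> X then v l * F (d * l) else 0))"
proof (rule sum.mono_neutral_cong_left)
  fix k assume k: "k \<in> {Y..<2 * Y}"
  then have "Y \<le> k" by simp
  from hyperbola_row[OF Y this, where G = "\<lambda>l. v l * F (k * l)"] k
  show "c k * (\<Sum>l=1..X div k. v l * F (k * l))
    = (if k \<in> {Y..<2 * Y} then c k else 0) * (\<Sum>l=1..X div Y. if k * l \<le> X then v l * F (k * l) else 0)"
    by (simp only: if_True)
qed (use Y in auto)

text \<open>The same block with the dyadic variable as the inner one. Both forms are needed, since
  the outer variable of a box has to be the long one.\<close>

lemma dyadic_block_as_box':
  fixes c v F :: "nat \<Rightarrow> complex"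
  assumes Y: "1 \<le> Y"
  shows "(\<Sum>k\<in>{Y..<2 * Y}. c k * (\<Sum>l=1..X div k. v l * F (k * l)))
    = (\<Sum>d=1..X div Y. v d * (\<Sum>l=1..2 * Y. if d * l \<le> X then (if l \<in> {Y..<2 * Y} then c l else 0) * F (d * l) else 0))"
proof -
  let ?c = "\<lambda>d. if d \<in> {Y..<2 * Y} then c d else 0"
  have "(\<Sum>k\<in>{Y..<2 * Y}. c k * (\<Sum>l=1..X div k. v l * F (k * l)))
      = (\<Sum>k=1..2 * Y. ?c k * (\<Sum>d=1..X div Y. if k * d \<le> X then v d * F (k * d) else 0))"
    by (rule dyadic_block_as_box[OF Y])
  also have "\<dots> = (\<Sum>k=1..2 * Y. \<Sum>d=1..X div Y. ?c k * (if k * d \<le> X then v d * F (k * d) else 0))"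
    by (simp only: sum_distrib_left)
  also have "\<dots> = (\<Sum>d=1..X div Y. \<Sum>k=1..2 * Y. ?c k * (if k * d \<le> X then v d * F (k * d) else 0))"
    by (rule sum.swap)
  also have "\<dots> = (\<Sum>d=1..X div Y. v d * (\<Sum>l=1..2 * Y. if d * l \<le> X then ?c l * F (d * l) else 0))"
    unfolding sum_distrib_left by (intro sum.cong refl) (auto simp: mult.commute mult.left_commute)
  finally show ?thesis .
qed

context weyl_setting
begin

lemma box_bound:
  fixes c v :: "nat \<Rightarrow> complex"
  assumes "X \<le> D * L" "D * L \<le> 2 * X" "1 / real D \<le> 2 * B" "U < L"
    and "\<And>d. norm (c d) \<le> \<Lambda>" "\<And>l. norm (v l) \<le> \<Lambda>"
  shows "norm (\<Sum>d=1..D. c d * (\<Sum>l=1..L. if d * l \<le> X then v l * F (d * l) else 0)) \<le> type_II_const j * \<Lambda> ^ (2 * j + 3) * (P * \<beta>)"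
  using box_sum_bound[OF assms] by (simp only: type_II_const_def K_def)

text \<open>For every r, Vaughan's inequality wants one bound for all intervals, whereas the type I
  estimate accepts one interval. An interval with the largest sum, which exists because only
  finitely many compete, serves both.\<close>

lemma exists_maximal_intervals:
  "\<exists>lo hi :: nat \<Rightarrow> nat. \<forall>r\<ge>1. 1 \<le> lo r \<and> hi r \<le> X div r \<and>
     (\<forall>i i'. 1 \<le> i \<longrightarrow> i' * r \<le> X \<longrightarrow> norm (\<Sum>l=i..i'. F (r * l)) \<le> norm (\<Sum>l=lo r..hi r. F (r * l)))"
proof -
  define Q where "Q = (\<lambda>r p. 1 \<le> fst p \<and> snd p \<le> X div r \<and>
     (\<forall>i i'. 1 \<le> i \<longrightarrow> i' * r \<le> X \<longrightarrow> norm (\<Sum>l=i..i'. F (r * l)) \<le> norm (\<Sum>l=fst p..snd p. F (r * l))))"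
  have ex: "\<exists>p. 1 \<le> r \<longrightarrow> Q r p" for r
  proof (cases "1 \<le> r")
    case True
    define A where "A = {1..X div r + 1} \<times> {0..X div r}"
    define f where "f = (\<lambda>p. norm (\<Sum>l=fst p..snd p. F (r * l)))"
    have A: "finite (f ` A)" "f ` A \<noteq> {}" by (auto simp: A_def)
    obtain p where p: "p \<in> A" "f p = Max (f ` A)" using Max_in[OF A] by (metis (no_types, lifting) imageE)
    have "Q r p"
      unfolding Q_def
    proof (intro conjI allI impI)
      show "1 \<le> fst p" "snd p \<le> X div r" using p(1) by (auto simp: A_def)
      fix i i' :: nat assume i: "1 \<le> i" "i' * r \<le> X"
      have r0: "0 < r" using True by linarith
      have ile: "i' \<le> X div r" by (rule less_eq_div_iff_mult_less_eq[OF r0, THEN iffD2]) (rule i(2))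
      show "norm (\<Sum>l=i..i'. F (r * l)) \<le> norm (\<Sum>l=fst p..snd p. F (r * l))"
      proof (cases "i \<le> X div r + 1")
        case le: True
        then have "(i, i') \<in> A" using i(1) ile unfolding A_def by simp
        then have "f (i, i') \<le> Max (f ` A)" by (intro Max_ge[OF A(1)] imageI)
        also have "\<dots> = f p" by (rule p(2)[symmetric])
        finally show ?thesis by (simp only: f_def fst_conv snd_conv)
      next
        case False
        then have "{i..i'} = {}" using ile by simp
        then have "(\<Sum>l=i..i'. F (r * l)) = 0" by (simp only: sum.empty)
        then show ?thesis by (simp only: norm_zero norm_ge_zero)
      qed
    qed
    then show ?thesis by (intro exI impI)
  qed simp
  have ex': "\<forall>r. \<exists>p. 1 \<le> r \<longrightarrow> Q r p" using ex by blast
  obtain \<phi> where \<phi>: "\<forall>r. 1 \<le> r \<longrightarrow> Q r (\<phi> r)" using choice[OF ex'] by blast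
  show ?thesis
    by (rule exI[of _ "\<lambda>r. fst (\<phi> r)"], rule exI[of _ "\<lambda>r. snd (\<phi> r)"]) (use \<phi> in \<open>simp add: Q_def\<close>)
qed

lemma type_consts: "0 \<le> type_I_const j" "0 \<le> type_II_const j"
  by (simp_all add: type_I_const_def type_II_const_def)

end

section \<open>Assembling the pieces of Vaughan's decomposition\<close>

context weyl_setting
begin

text \<open>In the sum with \<open>vaughan_w\<close>, type I is affordable only for r \<le> U; for U
  < r \<le> U ^ 2 the dyadic variable is at most the square root of P and becomes the inner variable
  of a box. In the sum with \<open>vaughan_c\<close> the orientation is chosen block by
  block.\<close>

lemma mangoldt_sum_bound:
  "norm (\<Sum>n=1..X. of_real (mangoldt n) * F n) \<le> (1 + 2 * type_I_const j + 2 * type_II_const j) * \<Lambda> ^ (2 * j + 4) * (P * \<beta>)"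
proof -
  have \<Lambda>0: "0 \<le> \<Lambda>" using \<Lambda>1 by simp
  have P\<beta>: "0 \<le> P * \<beta>" using P \<beta> by simp
  have Fn: "norm (F n) \<le> 1" for n by (simp add: F_def)
  have UX: "U \<le> X" using U by linarith
  obtain lo hi :: "nat \<Rightarrow> nat" where lohi: "\<forall>r\<ge>1. 1 \<le> lo r \<and> hi r \<le> X div r \<and>
     (\<forall>i i'. 1 \<le> i \<longrightarrow> i' * r \<le> X \<longrightarrow> norm (\<Sum>l=i..i'. F (r * l)) \<le> norm (\<Sum>l=lo r..hi r. F (r * l)))"
    using exists_maximal_intervals by blast
  define M where "M = (\<lambda>r. norm (\<Sum>l=lo r..hi r. F (r * l)))"
  have MI: "norm (\<Sum>l=i..i'. F (r * l)) \<le> M r" if "1 \<le> r" "1 \<le> i" "i' * r \<le> X" for r i i'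
    using lohi that unfolding M_def by blast
  have M0: "0 \<le> M r" for r by (simp add: M_def)
  define BI where "BI = type_I_const j * \<Lambda> ^ (j + 1) * (P * \<beta>)"
  define BII where "BII = type_II_const j * \<Lambda> ^ (2 * j + 3) * (P * \<beta>)"
  have B0: "0 \<le> BI" "0 \<le> BII" unfolding BI_def BII_def using type_consts \<Lambda>0 P\<beta> by auto
  have SM: "(\<Sum>r=1..U. M r) \<le> \<Lambda> * BI"
  proof -
    have "norm (\<Sum>r=1..U. if r \<le> U then complex_of_real (M r) else 0) \<le> (2 * ln (real U) + 1) * BI"
    proof (rule norm_dyadic_sum_le[OF U(1) _ B0(1)])
      fix i assume i: "2 ^ i \<le> U"
      have "norm (\<Sum>k\<in>{2 ^ i..<2 * 2 ^ i}. if k \<le> U then complex_of_real (M k) else 0) \<le> (\<Sum>k\<in>{2 ^ i..<2 * 2 ^ i}. M k)"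
        by (rule sum_norm_le) (use M0 in auto)
      also have "\<dots> \<le> BI"
        unfolding M_def BI_def type_I_const_def
        by (rule block_type_I[OF _ i]) (use lohi in \<open>auto intro: order_trans[OF one_le_power]\<close>)
      finally show "norm (\<Sum>k\<in>{2 ^ i..<2 * 2 ^ i}. if k \<le> U then complex_of_real (M k) else 0) \<le> BI" .
    qed simp
    also have "\<dots> \<le> \<Lambda> * BI"
    proof (rule mult_right_mono[OF _ B0(1)])
      have "ln (real U) \<le> ln (real X)" using U(1) UX by (intro ln_mono) auto
      then show "2 * ln (real U) + 1 \<le> \<Lambda>" using \<Lambda>(1) by linarith
    qed
    also have "(\<Sum>r=1..U. if r \<le> U then complex_of_real (M r) else 0) = of_real (\<Sum>r=1..U. M r)"
      unfolding of_real_sum by (rule sum.cong) auto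
    finally show ?thesis unfolding norm_of_real by linarith
  qed
  let ?T3 = "\<Sum>r=1..U\<^sup>2. of_real (vaughan_w U r) * (\<Sum>l=1..X div r. F (r * l))"
  let ?t4 = "\<lambda>k. of_real (vaughan_c U k) * (\<Sum>l=1..X div k. of_real (beyond U mangoldt l) * F (k * l))"
  have w: "\<bar>vaughan_w U r\<bar> \<le> \<Lambda>" if "1 \<le> r" "r \<le> U\<^sup>2" for r
  proof -
    have "\<bar>vaughan_w U r\<bar> \<le> ln (real r)" using that by (intro abs_vaughan_w_le) auto
    also have "\<dots> \<le> ln (real X)" using that U by (intro ln_mono) auto
    finally show ?thesis using \<Lambda>1 by linarith
  qed
  have halfX: "X \<le> (X div Y) * (2 * Y)" "(X div Y) * (2 * Y) \<le> 2 * X" "1 \<le> X div Y" if Y: "1 \<le> Y" "Y \<le> X" for Y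
  proof -
    show D1: "1 \<le> X div Y" using Y by (simp add: less_eq_div_iff_mult_less_eq)
    have "X = Y * (X div Y) + X mod Y" by simp
    moreover have "X mod Y < Y" using Y by simp
    moreover have "Y * 1 \<le> Y * (X div Y)" using D1 by (intro mult_left_mono) auto
    moreover have "(X div Y) * (2 * Y) = 2 * (Y * (X div Y))" by simp
    ultimately show "X \<le> (X div Y) * (2 * Y)" "(X div Y) * (2 * Y) \<le> 2 * X" by linarith+
  qed
  have sqrtP: "1 / P powr (1 / 2) \<le> B" using B(4) P by (simp add: powr_minus_divide)
  have T3: "norm ?T3 \<le> \<Lambda> * (\<Lambda> * BI) + \<Lambda> * BII"
  proof -
    define t where "t = (\<lambda>r. of_real (if U < r \<and> r \<le> U\<^sup>2 then vaughan_w U r else 0) * (\<Sum>l=1..X div r. 1 * F (r * l)))"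
    have "?T3 = (\<Sum>r=1..U\<^sup>2. of_real (if r \<le> U then vaughan_w U r else 0) * (\<Sum>l=1..X div r. F (r * l)) + t r)"
      by (rule sum.cong) (auto simp: t_def)
    also have "\<dots> = (\<Sum>r=1..U\<^sup>2. of_real (if r \<le> U then vaughan_w U r else 0) * (\<Sum>l=1..X div r. F (r * l))) + (\<Sum>r=1..U\<^sup>2. t r)"
      by (rule sum.distrib)
    also have "(\<Sum>r=1..U\<^sup>2. of_real (if r \<le> U then vaughan_w U r else 0) * (\<Sum>l=1..X div r. F (r * l)))
        = (\<Sum>r=1..U. of_real (vaughan_w U r) * (\<Sum>l=1..X div r. F (r * l)))"
      by (rule sum.mono_neutral_cong_right) (use U(6) in auto)
    finally have eq: "?T3 = (\<Sum>r=1..U. of_real (vaughan_w U r) * (\<Sum>l=1..X div r. F (r * l))) + (\<Sum>r=1..U\<^sup>2. t r)" .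
    have "norm (\<Sum>r=1..U. of_real (vaughan_w U r) * (\<Sum>l=1..X div r. F (r * l))) \<le> (\<Sum>r=1..U. \<Lambda> * M r)"
    proof (rule sum_norm_le)
      fix r assume r: "r \<in> {1..U}"
      have "r \<le> U\<^sup>2" using r U(6) by auto
      then show "norm (of_real (vaughan_w U r) * (\<Sum>l=1..X div r. F (r * l))) \<le> \<Lambda> * M r"
        unfolding norm_mult norm_of_real using r \<Lambda>0 by (intro mult_mono w MI) auto
    qed
    also have "\<dots> = \<Lambda> * (\<Sum>r=1..U. M r)" by (rule sum_distrib_left[symmetric])
    also have "\<dots> \<le> \<Lambda> * (\<Lambda> * BI)" by (rule mult_left_mono[OF SM \<Lambda>0])
    finally have p1: "norm (\<Sum>r=1..U. of_real (vaughan_w U r) * (\<Sum>l=1..X div r. F (r * l))) \<le> \<Lambda> * (\<Lambda> * BI)" .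
    have U21: "1 \<le> U\<^sup>2" using U by linarith
    have "norm (\<Sum>r=1..U\<^sup>2. t r) \<le> (2 * ln (real (U\<^sup>2)) + 1) * BII"
    proof (rule norm_dyadic_sum_le[OF U21 _ B0(2)])
      fix i assume i: "2 ^ i \<le> U\<^sup>2"
      define Y where "Y = (2::nat) ^ i"
      have Y: "1 \<le> Y" "Y \<le> U\<^sup>2" "Y \<le> X" using i U(4) by (auto simp: Y_def)
      have "norm (\<Sum>r\<in>{Y..<2 * Y}. t r) \<le> BII"
      proof (cases "U < 2 * Y")
        case False
        then have "(\<Sum>r\<in>{Y..<2 * Y}. t r) = 0" by (intro sum.neutral) (auto simp: t_def)
        then show ?thesis using B0 by simp
      next
        case True
        \<comment> \<open>Y \<le> U ^ 2 is at most the square root of P, which makes the outer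
          length at least half of that root.\<close>
        have D: "1 / real (X div Y) \<le> 2 * B"
        proof -
          have "P \<le> real (X div Y) * (2 * real Y)"
            using of_nat_mono[OF halfX(1)[OF Y(1,3)], where 'a = real] P by simp
          also have "\<dots> \<le> real (X div Y) * (2 * P powr (1 / 2))"
          proof (intro mult_left_mono)
            have "real Y \<le> real (U\<^sup>2)" by (rule of_nat_mono[OF Y(2)])
            also note U(5)
            finally show "real Y \<le> P powr (1 / 2)" .
          qed auto
          finally have "P powr (1 / 2) * P powr (1 / 2) \<le> P powr (1 / 2) * (2 * real (X div Y))"
            using P by (simp add: mult_ac flip: powr_add)
          then have "P powr (1 / 2) \<le> 2 * real (X div Y)" using P by simp
          then have "1 / (2 * real (X div Y)) \<le> 1 / P powr (1 / 2)"
            using P halfX(3)[OF Y(1,3)] by (intro divide_left_mono mult_pos_pos) auto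
          then show ?thesis using sqrtP by simp
        qed
        show ?thesis
          unfolding t_def BII_def
            dyadic_block_as_box'[OF Y(1), where c = "\<lambda>r. of_real (if U < r \<and> r \<le> U\<^sup>2 then vaughan_w U r else 0)" and v = "\<lambda>_. 1" and F = F]
          by (rule box_bound[OF halfX(1,2)[OF Y(1,3)] D True]) (use w Y(1) \<Lambda>1 \<Lambda>0 in auto)
      qed
      then show "norm (\<Sum>k\<in>{2 ^ i..<2 * 2 ^ i}. t k) \<le> BII" by (simp only: Y_def)
    qed (simp add: t_def)
    also have "\<dots> \<le> \<Lambda> * BII"
    proof (rule mult_right_mono[OF _ B0(2)])
      have "ln (real (U\<^sup>2)) \<le> ln (real X)" using U(1) U21 U(4) by (intro ln_mono) (auto simp del: of_nat_power)
      then show "2 * ln (real (U\<^sup>2)) + 1 \<le> \<Lambda>" using \<Lambda>(1) by linarith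
    qed
    finally have p2: "norm (\<Sum>r=1..U\<^sup>2. t r) \<le> \<Lambda> * BII" .
    show ?thesis unfolding eq by (rule order_trans[OF norm_triangle_ineq add_mono[OF p1 p2]])
  qed
  have T4: "norm (\<Sum>k=1..X. ?t4 k) \<le> \<Lambda> * BII"
  proof -
    \<comment> \<open>The box estimate demands bounds for all indices, while divisor numbers and
      logarithms are under control only in a limited range; cutting at X settles this.\<close>
    define c where "c = (\<lambda>k. complex_of_real (if k \<le> X then vaughan_c U k else 0))"
    define v where "v = (\<lambda>l. complex_of_real (if l \<le> X then beyond U mangoldt l else 0))"
    have cb: "norm (if k \<in> {Y..<2 * Y} then c k else 0) \<le> \<Lambda>" if Y: "1 \<le> Y" for k Y
    proof (cases "k \<in> {Y..<2 * Y} \<and> k \<le> X")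
      case True
      have k1: "1 \<le> k" using True Y by auto
      have "\<bar>vaughan_c U k\<bar> \<le> real (tau k)" using k1 by (intro abs_vaughan_c_le) auto
      also have "\<dots> \<le> \<Lambda>"
      proof (rule \<Lambda>(3)[OF k1])
        have "real k \<le> real X" using True by simp
        also have "\<dots> \<le> 1 * (4 * P) ^ 1" using P by simp
        also have "\<dots> \<le> (real (weyl_const j) + fact (Suc j)) * (4 * P) ^ (2 * Suc j)"
        proof (intro mult_mono power_increasing)
          have "(1::real) \<le> fact (Suc j)" by (rule fact_ge_1)
          then show "1 \<le> real (weyl_const j) + fact (Suc j)" by linarith
        qed (use P in \<open>auto simp del: fact_Suc\<close>)
        finally show "real k \<le> (real (weyl_const j) + fact (Suc j)) * (4 * (real N * real m)) ^ (2 * Suc j)" by (simp only: P_def)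
      qed
      finally show ?thesis using True by (simp add: c_def)
    qed (use \<Lambda>0 in \<open>auto simp: c_def\<close>)
    have vb: "norm (v l) \<le> \<Lambda>" for l
    proof (cases "1 \<le> l \<and> l \<le> X \<and> U < l")
      case True
      then have "mangoldt l \<le> ln (real l)" by (intro mangoldt_le) auto
      also have "\<dots> \<le> ln (real X)" using True by (intro ln_mono) auto
      finally show ?thesis using True \<Lambda>1 by (simp add: v_def beyond_def)
    qed (use \<Lambda>0 in \<open>auto simp: v_def beyond_def not_le\<close>)
    have "norm (\<Sum>k=1..X. c k * (\<Sum>l=1..X div k. v l * F (k * l))) \<le> (2 * ln (real X) + 1) * BII"
    proof (rule norm_dyadic_sum_le)
      show "1 \<le> X" using X2 by simp
      show "0 \<le> BII" by (rule B0)
      fix i assume i: "2 ^ i \<le> X"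
      define Y where "Y = (2::nat) ^ i"
      have Y: "1 \<le> Y" "Y \<le> X" using i by (auto simp: Y_def)
      have "norm (\<Sum>k\<in>{Y..<2 * Y}. c k * (\<Sum>l=1..X div k. v l * F (k * l))) \<le> BII"
      proof (cases "U < 2 * Y \<and> U < X div Y")
        case False
        have "(\<Sum>k\<in>{Y..<2 * Y}. c k * (\<Sum>l=1..X div k. v l * F (k * l))) = 0"
        proof (rule sum.neutral, rule ballI)
          fix k assume k: "k \<in> {Y..<2 * Y}"
          show "c k * (\<Sum>l=1..X div k. v l * F (k * l)) = 0"
          proof (cases "U < 2 * Y")
            case True
            then have LU: "X div Y \<le> U" using False by simp
            have "X div k \<le> X div Y" using k Y by (intro div_le_mono2) auto
            then have "(\<Sum>l=1..X div k. v l * F (k * l)) = 0"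
              using LU by (intro sum.neutral) (auto simp: v_def beyond_def)
            then show ?thesis by simp
          next
            case False
            then have "vaughan_c U k = 0" using k Y by (intro vaughan_c_eq_0) auto
            then show ?thesis by (simp add: c_def)
          qed
        qed
        then show ?thesis using B0 by simp
      next
        case True
        show ?thesis
        \<comment> \<open>The comparison tells which of the two ranges, 2 Y or X div Y, is at least
          the square root of P and can be the outer one.\<close>
        proof (cases "X \<le> (2 * Y)\<^sup>2")
          case big: True
          have "P powr (1 / 2) \<le> real (2 * Y)"
          proof -
            have "P \<le> (real (2 * Y))\<^sup>2" using P(3) of_nat_mono[OF big, where 'a = real] by simp
            then have "P powr (1 / 2) \<le> ((real (2 * Y)) powr 2) powr (1 / 2)"
              using P Y by (intro powr_mono2) auto
            moreover have "((real (2 * Y)) powr 2) powr (1 / 2) = real (2 * Y)" unfolding powr_powr using Y by simp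
            ultimately show ?thesis by (simp only:)
          qed
          then have "1 / real (2 * Y) \<le> 1 / P powr (1 / 2)" using P Y by (intro divide_left_mono mult_pos_pos) auto
          then have D: "1 / real (2 * Y) \<le> 2 * B" using sqrtP B by linarith
          have DL: "X \<le> 2 * Y * (X div Y)" "2 * Y * (X div Y) \<le> 2 * X"
            using halfX(1,2)[OF Y] by (simp_all add: mult_ac)
          show ?thesis
            unfolding dyadic_block_as_box[OF Y(1), where c = c and v = v and F = F] BII_def
            by (rule box_bound[OF DL D conjunct2[OF True] cb[OF Y(1)] vb])
        next
          case small: False
          have "P powr (1 / 2) \<le> real (X div Y)"
          proof -
            define y where "y = real (2 * Y)"
            define z where "z = real (X div Y)"
            have "(2 * Y)\<^sup>2 \<le> X" using small by linarith
            then have "real ((2 * Y)\<^sup>2) \<le> real X" by (rule of_nat_mono)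
            then have y1: "y * y \<le> real X" by (simp add: y_def power2_eq_square)
            have y2: "real X \<le> z * y"
              using of_nat_mono[OF halfX(1)[OF Y], where 'a = real] by (simp only: of_nat_mult y_def z_def)
            have y0: "0 < y" "0 \<le> z" using Y by (auto simp: y_def z_def)
            have "y * y \<le> z * y" using y1 y2 by linarith
            then have "y \<le> z" using y0 by simp
            then have "z * y \<le> z * z" using y0 by (intro mult_left_mono) auto
            then have "P \<le> z\<^sup>2" using y2 P(3) by (simp add: power2_eq_square)
            then have "P \<le> (real (X div Y))\<^sup>2" by (simp only: z_def)
            then have "P powr (1 / 2) \<le> ((real (X div Y)) powr 2) powr (1 / 2)"
              using P halfX(3)[OF Y] by (intro powr_mono2) auto
            then show ?thesis using halfX(3)[OF Y] by (simp add: powr_powr)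
          qed
          then have "1 / real (X div Y) \<le> 1 / P powr (1 / 2)" using P halfX(3)[OF Y] by (intro divide_left_mono mult_pos_pos) auto
          then have D: "1 / real (X div Y) \<le> 2 * B" using sqrtP B by linarith
          show ?thesis
            unfolding dyadic_block_as_box'[OF Y(1), where c = c and v = v and F = F] BII_def
            by (rule box_bound[OF halfX(1,2)[OF Y] D conjunct1[OF True] vb cb[OF Y(1)]])
        qed
      qed
      then show "norm (\<Sum>k\<in>{2 ^ i..<2 * 2 ^ i}. c k * (\<Sum>l=1..X div k. v l * F (k * l))) \<le> BII" by (simp only: Y_def)
    qed simp
    also have "\<dots> \<le> \<Lambda> * BII" by (rule mult_right_mono[OF \<Lambda>(1) B0(2)])
    finally have le: "norm (\<Sum>k=1..X. c k * (\<Sum>l=1..X div k. v l * F (k * l))) \<le> \<Lambda> * BII" .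
    have eq: "(\<Sum>k=1..X. c k * (\<Sum>l=1..X div k. v l * F (k * l))) = (\<Sum>k=1..X. ?t4 k)"
    proof (rule sum.cong[OF refl])
      fix k assume k: "k \<in> {1..X}"
      have "(\<Sum>l=1..X div k. v l * F (k * l)) = (\<Sum>l=1..X div k. of_real (beyond U mangoldt l) * F (k * l))"
      proof (rule sum.cong[OF refl])
        fix l assume "l \<in> {1..X div k}"
        then have "l \<le> X" by (auto intro: order_trans[OF _ div_le_dividend])
        then show "v l * F (k * l) = of_real (beyond U mangoldt l) * F (k * l)" by (simp add: v_def)
      qed
      then show "c k * (\<Sum>l=1..X div k. v l * F (k * l)) = ?t4 k" using k by (simp add: c_def)
    qed
    show ?thesis using le unfolding eq .
  qed
  have V: "norm (\<Sum>n=1..X. of_real (mangoldt n) * F n) \<le>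
      real U * ln (real X) + ln (real X) * (\<Sum>r=1..U. M r) + norm ?T3 + norm (\<Sum>k=1..X. ?t4 k)"
    by (rule vaughan_inequality[OF Fn U(1) UX MI])
  \<comment> \<open>A box costs 2 j + 3 factors \<Lambda>, and the number of dyadic blocks one
    more.\<close>
  define e where "e = 2 * j + 4"
  have Q: "\<Lambda> \<le> \<Lambda> ^ e" "\<Lambda> * (\<Lambda> * BI) \<le> type_I_const j * \<Lambda> ^ e * (P * \<beta>)" "\<Lambda> * BII = type_II_const j * \<Lambda> ^ e * (P * \<beta>)"
  proof -
    show "\<Lambda> \<le> \<Lambda> ^ e" using \<Lambda>1 by (intro self_le_power) (auto simp: e_def)
    have "\<Lambda> * (\<Lambda> * BI) = type_I_const j * \<Lambda> ^ (j + 3) * (P * \<beta>)"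
      by (simp add: BI_def power_add power3_eq_cube mult_ac)
    also have "\<dots> \<le> type_I_const j * \<Lambda> ^ e * (P * \<beta>)"
      using \<Lambda>1 type_consts P\<beta> by (intro mult_right_mono mult_left_mono power_increasing) (auto simp: e_def)
    finally show "\<Lambda> * (\<Lambda> * BI) \<le> type_I_const j * \<Lambda> ^ e * (P * \<beta>)" .
    have "\<Lambda> ^ e = \<Lambda> * \<Lambda> ^ (2 * j + 3)" by (simp add: e_def power_add eval_nat_numeral)
    then show "\<Lambda> * BII = type_II_const j * \<Lambda> ^ e * (P * \<beta>)" by (simp add: BII_def)
  qed
  have "real U * ln (real X) \<le> \<Lambda> ^ e * (P * \<beta>)"
  proof -
    have P0: "0 \<le> P" "1 \<le> P" using P(1) by linarith+
    have "P powr (1 / 4) \<le> P powr (7 / 8)" by (rule powr_mono[OF _ P0(2)]) simp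
    moreover have "P powr (7 / 8) = P * P powr (- 1 / 8)" using P0 powr_add[of P 1 "- 1 / 8"] by simp
    moreover have "P * P powr (- 1 / 8) \<le> P * \<beta>" by (rule mult_left_mono[OF \<beta>(5) P0(1)])
    ultimately have u1: "real U \<le> P * \<beta>" using U(2) u(3) by linarith
    have l1: "ln (real X) \<le> \<Lambda> ^ e" using \<Lambda>1(2) Q(1) by linarith
    have l0: "0 \<le> ln (real X)" using X2 by simp
    have "real U * ln (real X) \<le> (P * \<beta>) * \<Lambda> ^ e" by (rule mult_mono[OF u1 l1 P\<beta> l0])
    then show ?thesis by (subst mult.commute)
  qed
  moreover have "ln (real X) * (\<Sum>r=1..U. M r) \<le> type_I_const j * \<Lambda> ^ e * (P * \<beta>)"
  proof -
    have "ln (real X) * (\<Sum>r=1..U. M r) \<le> \<Lambda> * (\<Lambda> * BI)"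
    proof (rule mult_mono[OF \<Lambda>1(2) SM \<Lambda>0])
      show "0 \<le> (\<Sum>r=1..U. M r)" by (intro sum_nonneg M0)
    qed
    then show ?thesis using Q(2) by linarith
  qed
  ultimately have "norm (\<Sum>n=1..X. of_real (mangoldt n) * F n) \<le> \<Lambda> ^ e * (P * \<beta>) + type_I_const j * \<Lambda> ^ e * (P * \<beta>)
      + (type_I_const j * \<Lambda> ^ e * (P * \<beta>) + type_II_const j * \<Lambda> ^ e * (P * \<beta>)) + type_II_const j * \<Lambda> ^ e * (P * \<beta>)"
    using V T3 T4 Q(2,3) by linarith
  then show ?thesis by (simp add: e_def algebra_simps)
qed

end

section \<open>Primes in a residue class\<close>

lemma e2pi_of_nat_mult: "e2pi (real r * y) = e2pi y ^ r"
  by (induction r) (simp_all add: algebra_simps e2pi_add)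

text \<open>A geometric sum over m-th roots of unity. Its ratio differs from 1 unless t / m has
  distance 0 to the nearest integer, which means that m divides t.\<close>

lemma sum_e2pi_residues:
  assumes m: "1 \<le> m"
  shows "(\<Sum>r<m. e2pi (real r * (of_int t / real m))) = (if int m dvd t then of_nat m else 0)"
proof (cases "int m dvd t")
  case True
  then obtain n where "t = int m * n" by (elim dvdE)
  then have "of_int t / real m = of_int n" using m by simp
  then have "e2pi (of_int t / real m) = 1" by simp
  then show ?thesis using True by (simp only: e2pi_of_nat_mult) simp
next
  case False
  let ?z = "e2pi (of_int t / real m)"
  have "?z \<noteq> 1"
  proof
    assume "?z = 1"
    then have "dni (of_int t / real m) = 0"
      using norm_e2pi_minus_1[of "of_int t / real m"] dni_nonneg[of "of_int t / real m"] by simp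
    then have "of_int t / real m = of_int (round (of_int t / real m))" by (simp add: dni_def)
    then obtain n :: int where "of_int t / real m = of_int n" by blast
    then have "real_of_int t = real_of_int (int m * n)" using m by (simp add: field_simps)
    then have "t = int m * n" by (simp only: of_int_eq_iff)
    then show False using False by simp
  qed
  moreover have "?z ^ m = 1"
  proof -
    have "?z ^ m = e2pi (real m * (of_int t / real m))" by (rule e2pi_of_nat_mult[symmetric])
    also have "real m * (of_int t / real m) = of_int t" using m by simp
    finally show ?thesis by simp
  qed
  ultimately have "(\<Sum>r<m. ?z ^ r) = 0" by (simp add: geometric_sum)
  then show ?thesis using False by (simp only: e2pi_of_nat_mult if_False)
qed

definition phase_poly :: "nat \<Rightarrow> (nat \<Rightarrow> real) \<Rightarrow> real poly" where
  "phase_poly k \<alpha> = (\<Sum>i=1..k. monom (\<alpha> i) i)"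

lemma poly_phase_poly: "poly (phase_poly k \<alpha>) x = phase k \<alpha> x"
  by (simp add: phase_poly_def phase_def poly_sum poly_monom)

lemma phase_poly_degree_coeff:
  assumes "1 \<le> k" "\<alpha> k \<noteq> 0"
  shows "degree (phase_poly k \<alpha>) = k" "coeff (phase_poly k \<alpha>) k = \<alpha> k"
proof -
  show c: "coeff (phase_poly k \<alpha>) k = \<alpha> k"
    unfolding phase_poly_def coeff_sum using assms(1) by (simp add: sum.delta)
  have "degree (phase_poly k \<alpha>) \<le> k" unfolding phase_poly_def
    by (intro degree_sum_le) (auto intro: order_trans[OF degree_monom_le])
  moreover have "k \<le> degree (phase_poly k \<alpha>)" using c assms(2) by (intro le_degree) simp
  ultimately show "degree (phase_poly k \<alpha>) = k" by simp
qed

text \<open>The phase f ((x - b) / m) plus the linear phase r (x - b) / m of a character modulo m,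
  as one polynomial in x. For degree at least 2 the twist leaves the leading coefficient
  alone.\<close>

definition twisted_poly :: "nat \<Rightarrow> (nat \<Rightarrow> real) \<Rightarrow> nat \<Rightarrow> nat \<Rightarrow> nat \<Rightarrow> real poly" where
  "twisted_poly k \<alpha> m b r = pcompose (phase_poly k \<alpha>) [:- real b / real m, 1 / real m:] + [:- (real r * real b) / real m, real r / real m:]"

lemma poly_twisted_poly:
  "poly (twisted_poly k \<alpha> m b r) x = phase k \<alpha> ((x - real b) / real m) + real r * ((x - real b) / real m)"
  by (simp add: twisted_poly_def poly_pcompose poly_phase_poly diff_divide_distrib algebra_simps)

lemma twisted_poly_degree_coeff:
  assumes j: "1 \<le> j" and \<alpha>: "\<alpha> (Suc j) \<noteq> 0" and m: "1 \<le> m"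
  shows "degree (twisted_poly (Suc j) \<alpha> m b r) \<le> Suc j"
    "coeff (twisted_poly (Suc j) \<alpha> m b r) (Suc j) = \<alpha> (Suc j) / real (m ^ Suc j)"
proof -
  let ?f = "phase_poly (Suc j) \<alpha>" and ?l = "[:- real b / real m, 1 / real m:]"
  let ?t = "[:- (real r * real b) / real m, real r / real m:]"
  have f: "degree ?f = Suc j" "coeff ?f (Suc j) = \<alpha> (Suc j)" using phase_poly_degree_coeff[of "Suc j" \<alpha>] \<alpha> by auto
  have dl: "degree ?l = 1" using m by simp
  have dp: "degree (pcompose ?f ?l) = Suc j" by (simp only: degree_pcompose f dl mult_1_right)
  have "lead_coeff (pcompose ?f ?l) = lead_coeff ?f * lead_coeff ?l ^ degree ?f"
    by (rule lead_coeff_comp) (simp only: dl)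
  then have cp: "coeff (pcompose ?f ?l) (Suc j) = \<alpha> (Suc j) * (1 / real m) ^ Suc j"
    unfolding dp f dl using m by simp
  have dt: "degree ?t \<le> 1" by simp
  show "degree (twisted_poly (Suc j) \<alpha> m b r) \<le> Suc j"
    unfolding twisted_poly_def using dt dp by (intro degree_add_le) auto
  have "coeff ?t (Suc j) = 0" using dt j by (intro coeff_eq_0) linarith
  then show "coeff (twisted_poly (Suc j) \<alpha> m b r) (Suc j) = \<alpha> (Suc j) / real (m ^ Suc j)"
    unfolding twisted_poly_def coeff_add cp by (simp add: power_divide)
qed

text \<open>Outside the class f is evaluated at points that are not integers; this does no harm
  because the value is multiplied by a vanishing character sum.\<close>

lemma progression_phase_eq_average:
  assumes m: "1 \<le> m"
  shows "(if [x = b] (mod m) then e2pi (phase k \<alpha> ((real x - real b) / real m)) else 0)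
     = (\<Sum>r<m. e2pi (poly (twisted_poly k \<alpha> m b r) (real x))) / of_nat m"
proof -
  let ?y = "of_int (int x - int b) / real m"
  have y: "(real x - real b) / real m = ?y" by simp
  have "(\<Sum>r<m. e2pi (poly (twisted_poly k \<alpha> m b r) (real x))) = e2pi (phase k \<alpha> ?y) * (\<Sum>r<m. e2pi (real r * ?y))"
    unfolding poly_twisted_poly y e2pi_add sum_distrib_left ..
  also have "\<dots> = e2pi (phase k \<alpha> ?y) * (if int m dvd int x - int b then of_nat m else 0)"
    by (simp only: sum_e2pi_residues[OF m])
  also have "int m dvd int x - int b \<longleftrightarrow> [x = b] (mod m)"
    by (simp only: cong_iff_dvd_diff[symmetric] cong_int_iff)
  finally show ?thesis using m unfolding y by simp
qed

text \<open>For N \<le> P * \<beta> the trivial bound is enough. Otherwise B < 1, since B \<ge> 1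
  would give \<beta> \<ge> 1. Moreover m ^ 3 \<le> N, since N < m ^ 3 \<le> m ^ 7 would give N ^ 8
  \<le> P ^ 7 and so N \<le> P powr (7 / 8) \<le> P * \<beta>.\<close>

lemma theorem5_polynomial:
  fixes \<epsilon> :: real
  assumes j: "1 \<le> j" and \<epsilon>: "0 < \<epsilon>"
  shows "\<exists>C>0. \<forall>\<alpha> N m b a q. admissible (Suc j) \<alpha> N m b a q \<longrightarrow>
     norm (weighted_sum (Suc j) \<alpha> m b N) \<le> C * ((real N * real m) powr (1 + \<epsilon>) *
       (1 / real q + (real N * real m) powr (- 1 / 2) + real q / real N ^ Suc j) powr (1 / (2 ^ j * 2 ^ j)))"
proof -
  define e where "e = 2 * j + 4"
  define k where "k = Suc j"
  \<comment> \<open>The power e of \<Lambda> may cost P powr \<epsilon>, so one \<Lambda> may cost P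
    powr \<eta>. The divisor bound is applied to numbers up to the order of P ^ (2 k), whence the
    further division by 2 k.\<close>
  define \<eta> where "\<eta> = \<epsilon> / real e"
  define \<eta>' where "\<eta>' = \<eta> / real (2 * k)"
  define C3 where "C3 = real (weyl_const j) + fact k"
  define C1 where "C1 = 1 + 2 * type_I_const j + 2 * type_II_const j"
  define \<delta> :: real where "\<delta> = 1 / (2 ^ j * 2 ^ j)"
  have \<eta>: "0 < \<eta>" "0 < \<eta>'" using \<epsilon> by (auto simp: \<eta>_def \<eta>'_def e_def k_def)
  obtain C0 where C0: "1 \<le> C0" "\<forall>n\<ge>1. real (tau n) \<le> C0 * real n powr \<eta>'"
    using tau_le_powr[OF \<eta>(2)] by blast
  \<comment> \<open>One summand for each of the three demands on \<Lambda>: the logarithm of X, the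
    logarithm of q, and the divisor numbers.\<close>
  define D where "D = (4 + 2 / \<eta>) + (1 + real k / \<eta>) + C0 * (C3 powr \<eta>' * 4 powr \<eta>)"
  have Dpos: "0 \<le> 2 / \<eta>" "0 \<le> real k / \<eta>" "0 \<le> C0 * (C3 powr \<eta>' * 4 powr \<eta>)" using \<eta> C0 by auto
  have D1: "1 \<le> D" using Dpos by (simp add: D_def)
  have C1: "1 \<le> C1" by (simp add: C1_def type_I_const_def type_II_const_def)
  have C3: "0 \<le> C3" by (simp add: C3_def)
  have \<delta>4: "0 < \<delta>" "\<delta> \<le> 1 / 4"
  proof -
    have "(2::real) ^ 1 \<le> 2 ^ j" using j by (intro power_increasing) auto
    then have "(2::real) * 2 \<le> 2 ^ j * 2 ^ j" by (intro mult_mono) auto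
    then show "\<delta> \<le> 1 / 4" unfolding \<delta>_def by (intro divide_left_mono) auto
    show "0 < \<delta>" by (simp add: \<delta>_def)
  qed
  show ?thesis
  proof (intro exI[of _ "(C1 + 6) * D ^ e"] conjI allI impI)
    show "0 < (C1 + 6) * D ^ e" using C1 D1 by simp
    fix \<alpha> :: "nat \<Rightarrow> real" and N m b q :: nat and a :: int
    assume adm: "admissible (Suc j) \<alpha> N m b a q"
    have N: "2 \<le> N" and m: "1 \<le> m" "m \<le> N" "b < m" "coprime b m" and q: "1 \<le> q" and \<alpha>0: "\<alpha> (Suc j) \<noteq> 0"
      using adm by (auto simp: admissible_def)
    have ra: "rat_approx (\<alpha> (Suc j)) a q" by (rule admissible_rat_approx[OF adm])
    define P where "P = real N * real m"
    define X where "X = m * N + b"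
    define B where "B = 1 / real q + P powr (- 1 / 2) + real q / real N ^ Suc j"
    define \<beta> where "\<beta> = B powr \<delta>"
    define \<Lambda> where "\<Lambda> = D * P powr \<eta>"
    have NP: "real N \<le> P" using m mult_left_mono[of 1 "real m" "real N"] by (simp add: P_def)
    have mP: "real m \<le> P" using N mult_right_mono[of 1 "real N" "real m"] by (simp add: P_def)
    have P2: "2 \<le> P" using NP N by linarith
    have Xr: "real X = P + real b" by (simp add: X_def P_def mult.commute)
    have XP: "P \<le> real X" "real X \<le> 2 * P" using m mP by (simp_all add: Xr)
    have X2: "2 \<le> X" using XP(1) P2 by linarith
    have Pe: "1 \<le> P powr \<eta>" using P2 \<eta> by (intro ge_one_powr_ge_zero) auto
    have lnP: "ln P \<le> P powr \<eta> / \<eta>" using P2 \<eta> by (intro ln_powr_bound) auto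
    have \<Lambda>D: "D \<le> \<Lambda>" using mult_left_mono[OF Pe, of D] D1 by (simp add: \<Lambda>_def)
    have \<Lambda>1: "1 \<le> \<Lambda>" using \<Lambda>D D1 by linarith
    have L1: "2 * ln (real X) + 1 \<le> \<Lambda>"
    proof -
      have "ln (real X) \<le> ln (2 * P)" using XP X2 by (intro ln_mono) auto
      also have "\<dots> = ln 2 + ln P" using P2 by (simp add: ln_mult)
      also have "\<dots> \<le> 1 + P powr \<eta> / \<eta>" using lnP ln_le_minus_one[of "2::real"] by simp
      finally have "2 * ln (real X) + 1 \<le> 3 * 1 + (2 / \<eta>) * P powr \<eta>" by simp
      also have "\<dots> \<le> 4 * P powr \<eta> + (2 / \<eta>) * P powr \<eta>" using Pe by simp
      also have "\<dots> = (4 + 2 / \<eta>) * P powr \<eta>" by (simp only: distrib_right)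
      also have "\<dots> \<le> D * P powr \<eta>"
        using Dpos by (intro mult_right_mono) (auto simp: D_def)
      finally show ?thesis by (simp only: \<Lambda>_def)
    qed
    have lnX: "0 \<le> ln (real X)" "ln (real X) \<le> \<Lambda>"
    proof -
      show "0 \<le> ln (real X)" using X2 by simp
      then show "ln (real X) \<le> \<Lambda>" using L1 by linarith
    qed
    have Pm: "0 < P powr (- 1 / 2)" using P2 by simp
    have B0: "P powr (- 1 / 2) \<le> B" "0 < B" "0 \<le> B"
    proof -
      show "P powr (- 1 / 2) \<le> B" by (simp add: B_def)
      then show "0 < B" "0 \<le> B" using Pm by linarith+
    qed
    have \<beta>8: "P powr (- 1 / 8) \<le> \<beta>"
    proof -
      have "P powr (- 1 / 8) \<le> P powr ((- 1 / 2) * \<delta>)" using P2 \<delta>4 by (intro powr_mono) auto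
      also have "\<dots> = (P powr (- 1 / 2)) powr \<delta>" by (simp add: powr_powr)
      also have "\<dots> \<le> \<beta>" unfolding \<beta>_def using B0(1) \<delta>4 by (intro powr_mono2) auto
      finally show ?thesis .
    qed
    have \<beta>0: "0 \<le> \<beta>" by (simp add: \<beta>_def)
    have P78: "P powr (7 / 8) \<le> P * \<beta>"
    proof -
      have "P powr (7 / 8) = P * P powr (- 1 / 8)" using P2 powr_add[of P 1 "- 1 / 8"] by simp
      also have "\<dots> \<le> P * \<beta>" using \<beta>8 P2 by (intro mult_left_mono) auto
      finally show ?thesis .
    qed
    have P\<beta>: "1 \<le> P * \<beta>" using P78 ge_one_powr_ge_zero[of P "7 / 8"] P2 by simp
    have \<Lambda>e: "\<Lambda> \<le> \<Lambda> ^ e" "\<Lambda>\<^sup>2 \<le> \<Lambda> ^ e"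
    proof -
      show "\<Lambda> \<le> \<Lambda> ^ e" using \<Lambda>1 by (intro self_le_power) (auto simp: e_def)
      show "\<Lambda>\<^sup>2 \<le> \<Lambda> ^ e" using \<Lambda>1 by (intro power_increasing) (auto simp: e_def)
    qed
    have \<Lambda>eq: "\<Lambda> ^ e * (P * \<beta>) = D ^ e * (P powr (1 + \<epsilon>) * \<beta>)"
    proof -
      have "(P powr \<eta>) ^ e = (P powr \<eta>) powr real e" using P2 by (intro powr_realpow[symmetric]) simp
      also have "\<dots> = P powr \<epsilon>" by (simp add: powr_powr \<eta>_def e_def)
      finally have "\<Lambda> ^ e = D ^ e * P powr \<epsilon>" by (simp add: \<Lambda>_def power_mult_distrib)
      moreover have "P powr (1 + \<epsilon>) = P * P powr \<epsilon>" using P2 by (simp add: powr_add)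
      ultimately show ?thesis by simp
    qed
    have "norm (weighted_sum (Suc j) \<alpha> m b N) \<le> (C1 + 6) * (\<Lambda> ^ e * (P * \<beta>))"
    proof (cases "real N \<le> P * \<beta>")
      case True
      have "norm (weighted_sum (Suc j) \<alpha> m b N) \<le> real N * ln (real X)"
        unfolding X_def by (rule norm_weighted_sum_trivial) (use m in auto)
      also have "\<dots> \<le> (P * \<beta>) * \<Lambda> ^ e"
      proof (rule mult_mono[OF True])
        show "ln (real X) \<le> \<Lambda> ^ e" using lnX \<Lambda>e by linarith
      qed (use lnX P\<beta> in auto)
      also have "\<dots> = 1 * (\<Lambda> ^ e * (P * \<beta>))" by simp
      also have "\<dots> \<le> (C1 + 6) * (\<Lambda> ^ e * (P * \<beta>))"
        using C1 \<Lambda>1 P\<beta> by (intro mult_right_mono) auto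
      finally show ?thesis .
    next
      case False
      have B1: "B < 1"
      proof (rule ccontr)
        assume "\<not> B < 1"
        then have "1 \<le> \<beta>" unfolding \<beta>_def using \<delta>4 by (intro ge_one_powr_ge_zero) auto
        then have "P * 1 \<le> P * \<beta>" using P2 by (intro mult_left_mono) auto
        then show False using False NP by linarith
      qed
      have m3: "m ^ 3 \<le> N"
      proof (rule ccontr)
        assume "\<not> m ^ 3 \<le> N"
        then have "N \<le> m ^ 3" by simp
        also have "\<dots> \<le> m ^ 7" using m by (intro power_increasing) auto
        finally have "N ^ 7 * N \<le> N ^ 7 * m ^ 7" by (intro mult_left_mono) auto
        then have "real (N ^ 7 * N) \<le> real (N ^ 7 * m ^ 7)" by (rule of_nat_mono)
        moreover have "real (N ^ 7 * N) = real N powr 8" using N by (simp add: powr_numeral eval_nat_numeral)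
        moreover have "real (N ^ 7 * m ^ 7) = P powr 7" using P2 by (simp add: P_def power_mult_distrib powr_numeral)
        ultimately have "real N powr 8 \<le> P powr 7" by simp
        then have "(real N powr 8) powr (1 / 8) \<le> (P powr 7) powr (1 / 8)" by (intro powr_mono2) auto
        moreover have "(real N powr 8) powr (1 / 8) = real N" unfolding powr_powr using N by simp
        moreover have "(P powr 7) powr (1 / 8) = P powr (7 / 8)" by (simp add: powr_powr)
        ultimately have "real N \<le> P powr (7 / 8)" by (simp only:)
        then show False using P78 False by linarith
      qed
      \<comment> \<open>B < 1 bounds q by N ^ k, so its logarithm is of order ln P.\<close>
      have L2: "1 + ln (real q) \<le> \<Lambda>"
      proof -
        have "real q / real N ^ Suc j \<le> B" using Pm by (simp add: B_def)
        then have "real q / real N ^ Suc j < 1" using B1 by linarith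
        then have "real q < real N ^ Suc j" using N by (simp add: divide_less_eq)
        also have "\<dots> \<le> P ^ Suc j" using NP by (intro power_mono) auto
        finally have "ln (real q) \<le> ln (P ^ Suc j)" using q by (intro ln_mono) auto
        also have "\<dots> = real k * ln P" using P2 by (simp add: ln_realpow k_def del: power_Suc)
        also have "\<dots> \<le> real k * (P powr \<eta> / \<eta>)" using lnP by (intro mult_left_mono) auto
        finally have "1 + ln (real q) \<le> 1 * 1 + (real k / \<eta>) * P powr \<eta>" by simp
        also have "\<dots> \<le> 1 * P powr \<eta> + (real k / \<eta>) * P powr \<eta>" using Pe by simp
        also have "\<dots> = (1 + real k / \<eta>) * P powr \<eta>" by (simp only: distrib_right)
        also have "\<dots> \<le> D * P powr \<eta>" using Dpos by (intro mult_right_mono) (auto simp: D_def)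
        finally show ?thesis by (simp only: \<Lambda>_def)
      qed
      have L3: "real (tau n) \<le> \<Lambda>" if n: "1 \<le> n" "real n \<le> C3 * (4 * P) ^ (2 * k)" for n
      proof -
        have "real (tau n) \<le> C0 * real n powr \<eta>'" using C0(2) n(1) by blast
        also have "\<dots> \<le> C0 * (C3 * (4 * P) ^ (2 * k)) powr \<eta>'"
          using n \<eta> C0 by (intro mult_left_mono powr_mono2) auto
        also have "(C3 * (4 * P) ^ (2 * k)) powr \<eta>' = C3 powr \<eta>' * ((4 * P) ^ (2 * k)) powr \<eta>'"
          using C3 P2 by (simp only: powr_mult)
        also have "((4 * P) ^ (2 * k)) powr \<eta>' = ((4 * P) powr real (2 * k)) powr \<eta>'"
          using P2 by (subst powr_realpow) auto
        also have "\<dots> = (4 * P) powr (real (2 * k) * \<eta>')" by (rule powr_powr)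
        also have "real (2 * k) * \<eta>' = \<eta>" by (simp add: \<eta>'_def k_def)
        also have "(4 * P) powr \<eta> = 4 powr \<eta> * P powr \<eta>" using P2 by (simp only: powr_mult)
        also have "C0 * (C3 powr \<eta>' * (4 powr \<eta> * P powr \<eta>)) = (C0 * (C3 powr \<eta>' * 4 powr \<eta>)) * P powr \<eta>" by simp
        also have "\<dots> \<le> D * P powr \<eta>" using Dpos by (intro mult_right_mono) (auto simp: D_def)
        finally show ?thesis by (simp only: \<Lambda>_def)
      qed
      let ?g = "\<lambda>r. twisted_poly (Suc j) \<alpha> m b r"
      define S where "S = (\<lambda>r. \<Sum>n=1..X. of_real (mangoldt n) * e2pi (poly (?g r) (real n)))"
      have Sr: "norm (S r) \<le> C1 * (\<Lambda> ^ e * (P * \<beta>))" for r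
      proof -
        interpret W: weyl_setting j N m q X a "\<alpha> (Suc j)" \<Lambda> "?g r"
        proof (unfold_locales)
          show "1 \<le> j" "rat_approx (\<alpha> (Suc j)) a q" "2 \<le> N" "1 \<le> m" "m ^ 3 \<le> N"
            by (rule j ra N m(1) m3)+
          show "real N * real m \<le> real X" "real X \<le> 2 * (real N * real m)" using XP by (simp_all only: P_def)
          show "degree (?g r) \<le> Suc j" "coeff (?g r) (Suc j) = \<alpha> (Suc j) / real (m ^ Suc j)"
            by (rule twisted_poly_degree_coeff[where \<alpha> = \<alpha>, OF j \<alpha>0 m(1)])+
          show "1 / real q + (real N * real m) powr (- 1 / 2) + real q / real N ^ Suc j < 1"
            using B1 by (simp only: B_def P_def)
          show "2 * ln (real X) + 1 \<le> \<Lambda>" by (rule L1)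
          show "1 + ln (real q) \<le> \<Lambda>" by (rule L2)
          fix n assume "1 \<le> n" "real n \<le> (real (weyl_const j) + fact (Suc j)) * (4 * (real N * real m)) ^ (2 * Suc j)"
          then show "real (tau n) \<le> \<Lambda>" by (intro L3) (simp_all only: C3_def P_def k_def)
        qed
        have K: "real W.K = 2 ^ j" by (simp add: W.K_def)
        have "W.\<beta> = \<beta>" "W.P = P"
          unfolding W.\<beta>_def W.B_def W.P_def K \<beta>_def B_def P_def \<delta>_def by (rule refl)+
        then show ?thesis
          using W.mangoldt_sum_bound unfolding S_def W.F_def C1_def e_def by (simp only: mult.assoc)
      qed
      define F where "F = (\<lambda>x. if [x = b] (mod m) then e2pi (phase (Suc j) \<alpha> ((real x - real b) / real m)) else 0)"
      have "(\<Sum>n=1..X. of_real (mangoldt n) * F n) = (\<Sum>n=1..X. \<Sum>r<m. of_real (mangoldt n) * e2pi (poly (?g r) (real n)) / of_nat m)"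
        unfolding F_def progression_phase_eq_average[OF m(1)] by (simp add: sum_distrib_left sum_divide_distrib)
      also have "\<dots> = (\<Sum>r<m. \<Sum>n=1..X. of_real (mangoldt n) * e2pi (poly (?g r) (real n)) / of_nat m)"
        by (rule sum.swap)
      also have "\<dots> = (\<Sum>r<m. S r / of_nat m)"
        unfolding S_def sum_divide_distrib ..
      finally have SF: "(\<Sum>n=1..X. of_real (mangoldt n) * F n) = (\<Sum>r<m. S r / of_nat m)" .
      \<comment> \<open>The bound for S r is uniform in r, so averaging over the m twists loses
        nothing.\<close>
      have "norm (\<Sum>r<m. S r / of_nat m) \<le> (\<Sum>r<m. C1 * (\<Lambda> ^ e * (P * \<beta>)) / real m)"
        by (rule sum_norm_le) (use Sr in \<open>simp add: norm_divide divide_right_mono\<close>)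
      also have "\<dots> = C1 * (\<Lambda> ^ e * (P * \<beta>))" using m by simp
      finally have main: "norm (\<Sum>n=1..X. of_real (mangoldt n) * F n) \<le> C1 * (\<Lambda> ^ e * (P * \<beta>))" unfolding SF .
      have ws: "norm (weighted_sum (Suc j) \<alpha> m b N) \<le> norm (\<Sum>n=1..X. of_real (mangoldt n) * F n)
           + 2 * sqrt (real X) * (ln (real X))\<^sup>2 + ln (real X)"
      proof (rule norm_weighted_sum_le_mangoldt[OF m(1,3) X_def])
        fix n
        have "[m * n + b = b] (mod m)" by (simp add: cong_def)
        then show "F (m * n + b) = e2pi (phase (Suc j) \<alpha> (real n))" using m by (simp add: F_def)
      qed (use N in \<open>auto simp: F_def\<close>)
      have s1: "2 * sqrt (real X) * (ln (real X))\<^sup>2 \<le> 4 * (\<Lambda> ^ e * (P * \<beta>))"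
      proof -
        have "sqrt (real X) \<le> sqrt (4 * P)" using XP P2 by (intro real_sqrt_le_mono) auto
        also have "\<dots> = 2 * P powr (1 / 2)" using P2 by (simp add: real_sqrt_mult powr_half_sqrt)
        also have "P powr (1 / 2) \<le> P powr (7 / 8)" using P2 by (intro powr_mono) auto
        finally have s: "sqrt (real X) \<le> 2 * (P * \<beta>)" using P78 by simp
        have l: "(ln (real X))\<^sup>2 \<le> \<Lambda> ^ e"
          by (rule order_trans[OF power_mono[OF lnX(2,1)] \<Lambda>e(2)])
        have "sqrt (real X) * (ln (real X))\<^sup>2 \<le> (2 * (P * \<beta>)) * \<Lambda> ^ e"
          by (rule mult_mono[OF s l]) (use P\<beta> in auto)
        then show ?thesis by simp
      qed
      have s2: "ln (real X) \<le> 1 * (\<Lambda> ^ e * (P * \<beta>))"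
      proof -
        have "ln (real X) * 1 \<le> \<Lambda> ^ e * (P * \<beta>)"
        proof (rule mult_mono[OF _ P\<beta>])
          show "ln (real X) \<le> \<Lambda> ^ e" using lnX \<Lambda>e by linarith
        qed (use \<Lambda>1 in auto)
        then show ?thesis by simp
      qed
      have "0 \<le> \<Lambda> ^ e * (P * \<beta>)" using \<Lambda>1 P\<beta> by simp
      then have "norm (weighted_sum (Suc j) \<alpha> m b N) \<le> C1 * (\<Lambda> ^ e * (P * \<beta>)) + 6 * (\<Lambda> ^ e * (P * \<beta>))"
        using ws main s1 s2 by linarith
      then show ?thesis by (simp only: distrib_right)
    qed
    also have "(C1 + 6) * (\<Lambda> ^ e * (P * \<beta>)) = (C1 + 6) * D ^ e * (P powr (1 + \<epsilon>) * \<beta>)"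
      by (simp only: \<Lambda>eq mult.assoc)
    finally show "norm (weighted_sum (Suc j) \<alpha> m b N) \<le> (C1 + 6) * D ^ e * ((real N * real m) powr (1 + \<epsilon>) *
       (1 / real q + (real N * real m) powr (- 1 / 2) + real q / real N ^ Suc j) powr (1 / (2 ^ j * 2 ^ j)))"
      by (simp only: P_def B_def \<beta>_def \<delta>_def)
  qed
qed

lemma four_powr_eq: "4 powr (1 - real (Suc j)) = 1 / (2 ^ j * 2 ^ j :: real)"
proof -
  have "4 powr (1 - real (Suc j)) = 1 / 4 powr real j" by (simp add: powr_minus_divide)
  also have "(4::real) powr real j = 4 ^ j" by (rule powr_realpow) simp
  also have "(4::real) ^ j = 2 ^ j * 2 ^ j" by (simp flip: power_mult_distrib)
  finally show ?thesis .
qed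

theorem theorem5:
  shows "(\<forall>k::nat. 1 < k \<longrightarrow> (\<forall>\<epsilon>::real. 0 < \<epsilon> \<longrightarrow> (\<exists>C::real. 0 < C \<and>
           (\<forall>\<alpha> N m b a q. admissible k \<alpha> N m b a q \<longrightarrow>
             norm (weighted_sum k \<alpha> m b N) \<le>
               C * (real N * real m) powr (1 + \<epsilon>) *
               (1 / real q + (real N * real m) powr (- 1 / 2) + real q * real N powr (- real k))
                 powr (4 powr (1 - real k)))))) \<and>
         (\<exists>C::real. 0 < C \<and>
           (\<forall>\<alpha> N m b a q. admissible 1 \<alpha> N m b a q \<longrightarrow>
             norm (weighted_sum 1 \<alpha> m b N) \<le>
               C * (real N * real m) * (ln (real N)) ^ 4 *
               (real q powr (- 1 / 2) + (real N * real m) powr (- 1 / 5)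
                 + real N powr (- 1 / 2) * real q powr (1 / 2))))"
proof (intro conjI allI impI)
  fix k :: nat and \<epsilon> :: real
  assume k: "1 < k" and \<epsilon>: "0 < \<epsilon>"
  obtain j where j: "k = Suc j" "1 \<le> j" using k by (cases k) auto
  obtain C where C: "0 < C" "\<forall>\<alpha> N m b a q. admissible (Suc j) \<alpha> N m b a q \<longrightarrow>
     norm (weighted_sum (Suc j) \<alpha> m b N) \<le> C * ((real N * real m) powr (1 + \<epsilon>) *
       (1 / real q + (real N * real m) powr (- 1 / 2) + real q / real N ^ Suc j) powr (1 / (2 ^ j * 2 ^ j)))"
    using theorem5_polynomial[OF j(2) \<epsilon>] by blast
  show "\<exists>C::real. 0 < C \<and>
           (\<forall>\<alpha> N m b a q. admissible k \<alpha> N m b a q \<longrightarrow>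
             norm (weighted_sum k \<alpha> m b N) \<le>
               C * (real N * real m) powr (1 + \<epsilon>) *
               (1 / real q + (real N * real m) powr (- 1 / 2) + real q * real N powr (- real k))
                 powr (4 powr (1 - real k)))"
  proof (intro exI[of _ C] conjI allI impI)
    show "0 < C" by (rule C(1))
    fix \<alpha> N m b a q assume adm: "admissible k \<alpha> N m b a q"
    have "2 \<le> N" using adm by (simp add: admissible_def)
    then have "real N powr real k = real N ^ k" by (intro powr_realpow) simp
    then have "real N powr (- real k) = 1 / real N ^ k" by (simp only: powr_minus_divide)
    then have qN: "real q * real N powr (- real k) = real q / real N ^ Suc j"
      by (simp only: j(1) times_divide_eq_right mult_1_right)
    show "norm (weighted_sum k \<alpha> m b N) \<le>
               C * (real N * real m) powr (1 + \<epsilon>) *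
               (1 / real q + (real N * real m) powr (- 1 / 2) + real q * real N powr (- real k))
                 powr (4 powr (1 - real k))"
      using C(2) adm unfolding qN unfolding j(1) four_powr_eq by (simp only: mult.assoc)
  qed
next
  show "\<exists>C::real. 0 < C \<and>
           (\<forall>\<alpha> N m b a q. admissible 1 \<alpha> N m b a q \<longrightarrow>
             norm (weighted_sum 1 \<alpha> m b N) \<le>
               C * (real N * real m) * (ln (real N)) ^ 4 *
               (real q powr (- 1 / 2) + (real N * real m) powr (- 1 / 5)
                 + real N powr (- 1 / 2) * real q powr (1 / 2)))"
    using theorem5_linear by (intro exI[of _ 20000]) simp
qed

end
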